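(* For each of the algorithms $\mathbb{Z}$-affine $k$-consistency, BLP+AIP, BA$^k$, and CLAP, the following is true: (1) Every coset-CSP over a finite Abelian group is solved (for $\mathbb{Z}$-affine $k$-consistency, $k$ must be at least the arity of the template structure). (2) There exists a non-Abelian coset-CSP that is not solved, namely over $S_{18}$, the symmetric group on $18$ elements (for any constant or even sublinearly growing $k$). (3) There are non-Abelian coset-CSPs that are solved, namely over any $2$-nilpotent group of odd order. For example, there are non-Abelian $2$-nilpotent semidirect products $\mathbb{Z}_{p^2}\rtimes\mathbb{Z}_p$ of order $p^3$ for each odd prime $p$.
   Context: All structures are finite relational structures; $\mathbf{A}$, $\mathbf{B}$ have universes $A$, $B$. $\mathrm{CSP}(\mathbf{A})$ is the class of finite structures $\mathbf{B}$ over the vocabulary $\tau$ of the template $\mathbf{A}$ that admit a homomorphism $\mathbf{B}\to\mathbf{A}$; any finite $\tau$-structure is an instance. An algorithm solves $\mathrm{CSP}(\mathbf{A})$ if it accepts exactly those instances that are in $\mathrm{CSP}(\mathbf{A})$. $\mathbf{B}[X]$ is the induced substructure on $X$, $\binom{B}{\leq k}$ is the set of subsets of $B$ of size at most $k$, $\mathrm{ar}(R)$ is the arity of $R$; the arity of a structure is the maximum arity of its relations. The width $k$ is a positive integer parameter of $\mathbb{Z}$-affine $k$-consistency and of BA$^k$; "sublinearly growing $k$" means that $k\in o(n)$ is a function of the instance size $n$. For a finite group $\Gamma$, a coset-CSP over $\Gamma$ ($\Gamma$-coset-CSP) is a CSP whose template has universe $\Gamma$ and finitely many relations, each $r$-ary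 relation being a right coset $\Delta\delta$ of a subgroup $\Delta\leq\Gamma^r$ ($\delta\in\Gamma^r$). It is called Abelian or non-Abelian according to whether $\Gamma$ is. A group is $2$-nilpotent if its commutator subgroup is contained in its center. $k$-consistency: $\kappa_k^{\mathbf{A}}[\mathbf{B}]$ is the greatest (pointwise w.r.t. inclusion) map $\kappa$ assigning to each $X\in\binom{B}{\leq k}$ a set $\kappa(X)$ of homomorphisms $\mathbf{B}[X]\to\mathbf{A}$ such that for all $Y\subset X\in\binom{B}{\leq k}$: every $f\in\kappa(Y)$ extends to some $g\in\kappa(X)$, and for every $g\in\kappa(X)$ we have $g|_Y\in\kappa(Y)$. $\mathbb{Z}$-affine $k$-consistency: accept $\mathbf{B}$ iff, for $\kappa=\kappa_k^{\mathbf{A}}[\mathbf{B}]$, the following system in variables $z_{X,f}$ ($X\in\binom{B}{\leq k}$, $f\in\kappa(X)$) has an integer solution: $\sum_{f\in\kappa(X)}z_{X,f}=1$ for all $X\in\binom{B}{\leq k}$; $\sum_{f\in\kappa(X),f|_Y=g}z_{X,f}=z_{Y,g}$ for all $Y\subset X\in\binom{B}{\leq k}$, $g\in\kappa(Y)$. System $\mathsf{L}^{k}$: variables $\lambda_{X,f}$ for all $X\in\binom{B}{\leq k}$ and all maps $f\colon X\to A$, and $\mu_{R,\bar b,\bar a}$ for all $R\in\tau$, $\bar b\in R^{\mathbf{B}}$, $\bar a\in R^{\mathbf{A}}$; equations: (B1) $\sum_{f\colon X\to A}\lambda_{X,f}=1$ for all $X\in\binom{B}{\leq k}$; (B2) $\sum_{f\colon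 X\to A, f|_Y=g}\lambda_{X,f}=\lambda_{Y,g}$ for all $Y\subset X\in\binom{B}{\leq k}$, $g\colon Y\to A$; (B3) for all $R\in\tau$, $\bar b\in R^{\mathbf{B}}$, $\bar a'\in A^k$, $\bar i\in[\mathrm{ar}(R)]^k$: $\sum_{\bar a\in R^{\mathbf{A}},\,\bar a_{\bar i}=\bar a'}\mu_{R,\bar b,\bar a}=\lambda_{X(\bar b_{\bar i}),\,\bar b_{\bar i}\mapsto\bar a'}$, where $\bar a_{\bar i}=(a_{i_1},\dots,a_{i_k})$, $\bar b_{\bar i}=(b_{i_1},\dots,b_{i_k})$, $X(\bar b_{\bar i})$ is the set of entries of $\bar b_{\bar i}$, and $\bar b_{\bar i}\mapsto\bar a'$ is the function $X(\bar b_{\bar i})\to A$ mapping $\bar b_{\bar i}$ to $\bar a'$. $\mathsf{L}^k_{\mathsf{BLP}}$ is this system over the nonnegative rationals, $\mathsf{L}^k_{\mathsf{AIP}}$ is this system over $\mathbb{Z}$. BA$^k$: reject if $\mathsf{L}^k_{\mathsf{BLP}}$ is infeasible. Otherwise take a relative interior point $\Phi$ of its solution polytope (so $\Phi(x)=0$ iff every solution has $x=0$), and accept iff $\mathsf{L}^k_{\mathsf{AIP}}$ together with the constraints $x=0$ for all variables $x$ with $\Phi(x)=0$ has an integer solution. BLP+AIP is BA$^1$. CLAP: (i) for each $R\in\tau$, $\bar b\in R^{\mathbf{B}}$ initialize $S_{\bar b,R}:=R^{\mathbf{A}}$. (ii) Repeat until no set changes: for each $R\in\tau$, $\bar b\in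 R^{\mathbf{B}}$, $\bar a\in S_{\bar b,R}$, if $\mathsf{L}^1_{\mathsf{BLP}}$ with the additional constraints $\mu_{R,\bar b,\bar a}=1$ and $\mu_{R',\bar b',\bar a'}=0$ for all $R'\in\tau$, $\bar b'\in R'^{\mathbf{B}}$, $\bar a'\notin S_{\bar b',R'}$ is infeasible, remove $\bar a$ from $S_{\bar b,R}$. (iii) If some $S_{\bar b,R}=\emptyset$, reject. (iv) For each $R\in\tau$, $\bar b\in R^{\mathbf{B}}$, $\bar a\in S_{\bar b,R}$, run BA$^1$ with these same additional constraints added to $\mathsf{L}^1_{\mathsf{BLP}}$ (and hence implicitly also to $\mathsf{L}^1_{\mathsf{AIP}}$); if it accepts, accept. (v) If BA$^1$ rejects in all these runs, reject.
   Formalization: In (3), Z-affine k-consistency is also required to have k at least the arity of the template, as in (1); and CLAP is taken to accept an instance with no constraints, where literally step (v) would reject a satisfiable instance. *)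

theory Defs
  imports
    "HOL-Algebra.Product_Groups"
    "HOL-Algebra.Elementary_Groups"
    "HOL-Algebra.Bij"
    "HOL-Algebra.Sym_Groups"
    "HOL-Library.Landau_Symbols"
    "HOL-Computational_Algebra.Primes"
begin

section \<open>Relational structures and CSPs\<close>

record 'r vocab =
  symbols :: "'r set"
  ar :: "'r \<Rightarrow> nat"

record ('a, 'r) rel_struct =
  univ :: "'a set"
  rel :: "'r \<Rightarrow> 'a list set"

definition fin_struct :: "'r vocab \<Rightarrow> ('a, 'r) rel_struct \<Rightarrow> bool" where
  "fin_struct \<tau> B \<longleftrightarrow> finite (univ B) \<and>
     (\<forall>R\<in>symbols \<tau>. rel B R \<subseteq> {b. length b = ar \<tau> R \<and> set b \<subseteq> univ B})"

definition arity :: "'r vocab \<Rightarrow> nat" where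
  "arity \<tau> = Max (insert 0 (ar \<tau> ` symbols \<tau>))"

text \<open>Maps with domain \<open>X\<close> are represented throughout by extensional functions
  (\<open>undefined\<close> outside \<open>X\<close>), so that distinct members of \<open>X \<rightarrow>\<^sub>E A\<close> are distinct maps.\<close>

definition homs :: "'r vocab \<Rightarrow> ('b, 'r) rel_struct \<Rightarrow> ('a, 'r) rel_struct \<Rightarrow> ('b \<Rightarrow> 'a) set" where
  "homs \<tau> B A =
     {h \<in> univ B \<rightarrow>\<^sub>E univ A. \<forall>R\<in>symbols \<tau>. \<forall>b\<in>rel B R. map h b \<in> rel A R}"

definition CSP :: "'r vocab \<Rightarrow> ('a, 'r) rel_struct \<Rightarrow> ('b, 'r) rel_struct set" where
  "CSP \<tau> A = {B. fin_struct \<tau> B \<and> homs \<tau> B A \<noteq> {}}"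

definition induced :: "('b, 'r) rel_struct \<Rightarrow> 'b set \<Rightarrow> ('b, 'r) rel_struct" where
  "induced B X = \<lparr>univ = X, rel = (\<lambda>R. {b \<in> rel B R. set b \<subseteq> X})\<rparr>"

definition small_sets :: "nat \<Rightarrow> ('b, 'r) rel_struct \<Rightarrow> 'b set set" where
  "small_sets k B = {X. X \<subseteq> univ B \<and> card X \<le> k}"


section \<open>\<open>\<int>\<close>-affine \<open>k\<close>-consistency\<close>

definition k_consistent_family ::
  "nat \<Rightarrow> 'r vocab \<Rightarrow> ('a, 'r) rel_struct \<Rightarrow> ('b, 'r) rel_struct \<Rightarrow> ('b set \<Rightarrow> ('b \<Rightarrow> 'a) set) \<Rightarrow> bool"
where
  "k_consistent_family k \<tau> A B \<kappa> \<longleftrightarrow>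
     (\<forall>X\<in>small_sets k B. \<kappa> X \<subseteq> homs \<tau> (induced B X) A) \<and>
     (\<forall>X\<in>small_sets k B. \<forall>Y. Y \<subset> X \<longrightarrow>
        (\<forall>f\<in>\<kappa> Y. \<exists>g\<in>\<kappa> X. restrict g Y = f) \<and>
        (\<forall>g\<in>\<kappa> X. restrict g Y \<in> \<kappa> Y))"

text \<open>The order on \<open>'b set \<Rightarrow> ('b \<Rightarrow> 'a) set\<close> is pointwise inclusion. The greatest family
  exists because consistent families are closed under pointwise unions; its values outside
  \<open>small_sets k B\<close> are unconstrained and never used.\<close>

definition kappa ::
  "nat \<Rightarrow> 'r vocab \<Rightarrow> ('a, 'r) rel_struct \<Rightarrow> ('b, 'r) rel_struct \<Rightarrow> 'b set \<Rightarrow> ('b \<Rightarrow> 'a) set"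
where
  "kappa k \<tau> A B = (GREATEST \<kappa>. k_consistent_family k \<tau> A B \<kappa>)"

definition z_affine_accepts ::
  "nat \<Rightarrow> 'r vocab \<Rightarrow> ('a, 'r) rel_struct \<Rightarrow> ('b, 'r) rel_struct \<Rightarrow> bool"
where
  "z_affine_accepts k \<tau> A B \<longleftrightarrow>
     (let \<kappa> = kappa k \<tau> A B in
      \<exists>z :: 'b set \<Rightarrow> ('b \<Rightarrow> 'a) \<Rightarrow> int.
        (\<forall>X\<in>small_sets k B. (\<Sum>f\<in>\<kappa> X. z X f) = 1) \<and>
        (\<forall>X\<in>small_sets k B. \<forall>Y. Y \<subset> X \<longrightarrow>
           (\<forall>g\<in>\<kappa> Y. (\<Sum>f\<in>{f \<in> \<kappa> X. restrict f Y = g}. z X f) = z Y g)))"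


section \<open>The systems \<open>L\<^sup>k\<close> and the algorithm \<open>BA\<^sup>k\<close>\<close>

datatype ('r, 'b, 'a) lvar =
    Lam "'b set" "'b \<Rightarrow> 'a"
  | Mu 'r "'b list" "'a list"

definition lvars ::
  "nat \<Rightarrow> 'r vocab \<Rightarrow> ('a, 'r) rel_struct \<Rightarrow> ('b, 'r) rel_struct \<Rightarrow> ('r, 'b, 'a) lvar set"
where
  "lvars k \<tau> A B =
     {Lam X f | X f. X \<in> small_sets k B \<and> f \<in> X \<rightarrow>\<^sub>E univ A} \<union>
     {Mu R b a | R b a. R \<in> symbols \<tau> \<and> b \<in> rel B R \<and> a \<in> rel A R}"

text \<open>\<open>proj i a\<close> is the tuple \<open>a\<^sub>i = (a\<^bsub>i\<^sub>1\<^esub>, \<dots>, a\<^bsub>i\<^sub>k\<^esub>)\<close>, with positions counted from 0.\<close>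

definition proj :: "nat list \<Rightarrow> 'c list \<Rightarrow> 'c list" where
  "proj i a = map (\<lambda>j. a ! j) i"

text \<open>In the last family of equations, the function \<open>b\<^sub>i \<mapsto> a'\<close> is the unique \<open>f\<close> on the
  entries of \<open>b\<^sub>i\<close> with \<open>map f b\<^sub>i = a'\<close>. If \<open>b\<^sub>i\<close> has equal entries at positions where \<open>a'\<close>
  differs, there is no such function, hence no variable and no equation for this \<open>a'\<close>. For
  nonnegative solutions and \<open>k \<ge> 1\<close>, the left-hand side is then 0 anyway: the sum of all
  \<open>\<mu>\<^bsub>R,b,a\<^esub>\<close> and the sum of those for which \<open>b\<^sub>i \<mapsto> a\<^sub>i\<close> is a function are both 1. Hence \<open>BA\<^sup>k\<close>
  does not depend on this convention.\<close>

definition lsys ::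
  "nat \<Rightarrow> 'r vocab \<Rightarrow> ('a, 'r) rel_struct \<Rightarrow> ('b, 'r) rel_struct \<Rightarrow>
   (('r, 'b, 'a) lvar \<Rightarrow> 'c::comm_ring_1) set"
where
  "lsys k \<tau> A B = {\<Phi>.
     (\<forall>X\<in>small_sets k B. (\<Sum>f\<in>X \<rightarrow>\<^sub>E univ A. \<Phi> (Lam X f)) = 1) \<and>
     (\<forall>X\<in>small_sets k B. \<forall>Y. Y \<subset> X \<longrightarrow> (\<forall>g\<in>Y \<rightarrow>\<^sub>E univ A.
        (\<Sum>f\<in>{f \<in> X \<rightarrow>\<^sub>E univ A. restrict f Y = g}. \<Phi> (Lam X f)) = \<Phi> (Lam Y g))) \<and>
     (\<forall>R\<in>symbols \<tau>. \<forall>b\<in>rel B R.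
        \<forall>a'\<in>{a'. length a' = k \<and> set a' \<subseteq> univ A}.
        \<forall>i\<in>{i. length i = k \<and> set i \<subseteq> {..<ar \<tau> R}}.
        \<forall>f\<in>set (proj i b) \<rightarrow>\<^sub>E univ A. map f (proj i b) = a' \<longrightarrow>
          (\<Sum>a\<in>{a \<in> rel A R. proj i a = a'}. \<Phi> (Mu R b a)) = \<Phi> (Lam (set (proj i b)) f))}"

definition blp ::
  "nat \<Rightarrow> 'r vocab \<Rightarrow> ('a, 'r) rel_struct \<Rightarrow> ('b, 'r) rel_struct \<Rightarrow>
   (('r, 'b, 'a) lvar \<Rightarrow> rat) set"
where
  "blp k \<tau> A B = {\<Phi> \<in> lsys k \<tau> A B. \<forall>x\<in>lvars k \<tau> A B. 0 \<le> \<Phi> x}"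

definition aip ::
  "nat \<Rightarrow> 'r vocab \<Rightarrow> ('a, 'r) rel_struct \<Rightarrow> ('b, 'r) rel_struct \<Rightarrow>
   (('r, 'b, 'a) lvar \<Rightarrow> int) set"
where
  "aip k \<tau> A B = lsys k \<tau> A B"

text \<open>Relative interior of a convex set of rational vectors: every segment from a point of
  the set to \<open>\<Phi>\<close> can be prolonged beyond \<open>\<Phi>\<close> inside the set
  (compare \<open>convex_rel_interior_iff\<close> in HOL-Analysis for the real case).\<close>

definition rat_rel_interior :: "('v \<Rightarrow> rat) set \<Rightarrow> ('v \<Rightarrow> rat) set" where
  "rat_rel_interior P =
     {\<Phi> \<in> P. \<forall>\<Psi>\<in>P. \<exists>\<epsilon>>0. (\<lambda>x. \<Phi> x + \<epsilon> * (\<Phi> x - \<Psi> x)) \<in> P}"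

text \<open>\<open>BA\<^sup>k\<close> with additional constraints \<open>C\<close> (a set of rational assignments) on the BLP.
  The choice of the relative interior point is immaterial, since all of them have the same
  zero coordinates, and one exists whenever \<open>blp k \<tau> A B \<inter> C\<close> is nonempty
  (for the \<open>C\<close> used below).\<close>

definition ba_accepts_with ::
  "(('r, 'b, 'a) lvar \<Rightarrow> rat) set \<Rightarrow> nat \<Rightarrow> 'r vocab \<Rightarrow>
   ('a, 'r) rel_struct \<Rightarrow> ('b, 'r) rel_struct \<Rightarrow> bool"
where
  "ba_accepts_with C k \<tau> A B \<longleftrightarrow>
     (\<exists>\<Phi> \<in> rat_rel_interior (blp k \<tau> A B \<inter> C).
        \<exists>\<Psi> \<in> aip k \<tau> A B. \<forall>x\<in>lvars k \<tau> A B. \<Phi> x = 0 \<longrightarrow> \<Psi> x = 0)"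

definition ba_accepts ::
  "nat \<Rightarrow> 'r vocab \<Rightarrow> ('a, 'r) rel_struct \<Rightarrow> ('b, 'r) rel_struct \<Rightarrow> bool"
where
  "ba_accepts = ba_accepts_with UNIV"


section \<open>CLAP\<close>

text \<open>The family of sets \<open>S\<^bsub>b,R\<^esub>\<close> is represented by the set of all \<open>(R, b, a)\<close> with
  \<open>a \<in> S\<^bsub>b,R\<^esub>\<close>.\<close>

definition clap_init ::
  "'r vocab \<Rightarrow> ('a, 'r) rel_struct \<Rightarrow> ('b, 'r) rel_struct \<Rightarrow> ('r \<times> 'b list \<times> 'a list) set"
where
  "clap_init \<tau> A B = {(R, b, a). R \<in> symbols \<tau> \<and> b \<in> rel B R \<and> a \<in> rel A R}"

definition clap_constraints ::
  "'r vocab \<Rightarrow> ('a, 'r) rel_struct \<Rightarrow> ('b, 'r) rel_struct \<Rightarrow>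
   ('r \<times> 'b list \<times> 'a list) set \<Rightarrow> 'r \<times> 'b list \<times> 'a list \<Rightarrow>
   (('r, 'b, 'a) lvar \<Rightarrow> rat) set"
where
  "clap_constraints \<tau> A B S = (\<lambda>(R, b, a). {\<Phi>. \<Phi> (Mu R b a) = 1 \<and>
     (\<forall>(R', b', a') \<in> clap_init \<tau> A B - S. \<Phi> (Mu R' b' a') = 0)})"

definition clap_remove ::
  "'r vocab \<Rightarrow> ('a, 'r) rel_struct \<Rightarrow> ('b, 'r) rel_struct \<Rightarrow>
   ('r \<times> 'b list \<times> 'a list) set \<Rightarrow> ('r \<times> 'b list \<times> 'a list) set \<Rightarrow> bool"
where
  "clap_remove \<tau> A B S S' \<longleftrightarrow>
     (\<exists>t\<in>S. blp 1 \<tau> A B \<inter> clap_constraints \<tau> A B S t = {} \<and> S' = S - {t})"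

text \<open>The result of the removal phase: removals in any order, until none is possible.
  The result does not depend on the order, since infeasibility for \<open>S\<close> implies
  infeasibility for every subset of \<open>S\<close>.\<close>

definition clap_result ::
  "'r vocab \<Rightarrow> ('a, 'r) rel_struct \<Rightarrow> ('b, 'r) rel_struct \<Rightarrow>
   ('r \<times> 'b list \<times> 'a list) set \<Rightarrow> bool"
where
  "clap_result \<tau> A B S \<longleftrightarrow>
     (clap_remove \<tau> A B)\<^sup>*\<^sup>* (clap_init \<tau> A B) S \<and> (\<nexists>S'. clap_remove \<tau> A B S S')"

text \<open>Once no \<open>S\<^bsub>b,R\<^esub>\<close> is empty, \<open>S = {}\<close> means that the instance has no constraint at all.
  Then there is no run of \<open>BA\<^sup>1\<close> that could accept or reject; CLAP rejects only because of
  failed runs, so such an instance is accepted.\<close>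

definition clap_accepts ::
  "'r vocab \<Rightarrow> ('a, 'r) rel_struct \<Rightarrow> ('b, 'r) rel_struct \<Rightarrow> bool"
where
  "clap_accepts \<tau> A B \<longleftrightarrow>
     (\<exists>S. clap_result \<tau> A B S \<and>
        (\<forall>R\<in>symbols \<tau>. \<forall>b\<in>rel B R. \<exists>a. (R, b, a) \<in> S) \<and>
        (S = {} \<or> (\<exists>t\<in>S. ba_accepts_with (clap_constraints \<tau> A B S t) 1 \<tau> A B)))"


section \<open>Solving a CSP\<close>

datatype algorithm = Z_Affine_Consistency | BLP_AIP | BA | CLAP

text \<open>The width \<open>k\<close> is a parameter of \<open>Z_Affine_Consistency\<close> and \<open>BA\<close> only.\<close>

fun accepts ::
  "algorithm \<Rightarrow> nat \<Rightarrow> 'r vocab \<Rightarrow> ('a, 'r) rel_struct \<Rightarrow> ('b, 'r) rel_struct \<Rightarrow> bool"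
where
  "accepts Z_Affine_Consistency k = z_affine_accepts k"
| "accepts BLP_AIP k = ba_accepts 1"
| "accepts BA k = ba_accepts k"
| "accepts CLAP k = clap_accepts"

text \<open>The width may depend on the size of the instance. The first argument fixes the type from
  which the elements of the instances are drawn.\<close>

definition solves ::
  "'b itself \<Rightarrow> algorithm \<Rightarrow> (nat \<Rightarrow> nat) \<Rightarrow> 'r vocab \<Rightarrow> ('a, 'r) rel_struct \<Rightarrow> bool"
where
  "solves _ alg k \<tau> A \<longleftrightarrow>
     (\<forall>B :: ('b, 'r) rel_struct. fin_struct \<tau> B \<longrightarrow>
        (accepts alg (k (card (univ B))) \<tau> A B \<longleftrightarrow> B \<in> CSP \<tau> A))"


section \<open>Coset-CSPs and groups\<close>

text \<open>The elements of the library's power group are functions on \<open>{..<r}\<close>; \<open>map t [0..<r]\<close>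
  is the corresponding \<open>r\<close>-tuple.\<close>

definition coset_template ::
  "('a, 'm) monoid_scheme \<Rightarrow> 'r vocab \<Rightarrow> ('a, 'r) rel_struct \<Rightarrow> bool"
where
  "coset_template G \<tau> A \<longleftrightarrow>
     group G \<and> finite (carrier G) \<and> univ A = carrier G \<and> finite (symbols \<tau>) \<and>
     (\<forall>R\<in>symbols \<tau>. let r = ar \<tau> R; P = product_group {..<r} (\<lambda>_. G) in
        \<exists>\<Delta> \<delta>. subgroup \<Delta> P \<and> \<delta> \<in> carrier P \<and>
          rel A R = (\<lambda>t. map t [0..<r]) ` (\<Delta> #>\<^bsub>P\<^esub> \<delta>))"

definition group_center :: "('a, 'm) monoid_scheme \<Rightarrow> 'a set" where
  "group_center G = {z \<in> carrier G. \<forall>x\<in>carrier G. z \<otimes>\<^bsub>G\<^esub> x = x \<otimes>\<^bsub>G\<^esub> z}"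

definition two_nilpotent :: "('a, 'm) monoid_scheme \<Rightarrow> bool" where
  "two_nilpotent G \<longleftrightarrow> group G \<and> derived G (carrier G) \<subseteq> group_center G"

definition semidirect_product ::
  "('a, 'm) monoid_scheme \<Rightarrow> ('b, 'n) monoid_scheme \<Rightarrow> ('b \<Rightarrow> 'a \<Rightarrow> 'a) \<Rightarrow> ('a \<times> 'b) monoid"
where
  "semidirect_product N H \<theta> =
     \<lparr>carrier = carrier N \<times> carrier H,
      monoid.mult = (\<lambda>(a, x) (b, y). (a \<otimes>\<^bsub>N\<^esub> \<theta> x b, x \<otimes>\<^bsub>H\<^esub> y)),
      one = (\<one>\<^bsub>N\<^esub>, \<one>\<^bsub>H\<^esub>)\<rparr>"

end

theory Submission
  imports
    Defs
    "HOL-Algebra.FiniteProduct"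
    "HOL-Algebra.Multiplicative_Group"
    "HOL-Number_Theory.Cong"
begin

text \<open>The algorithms accept (CLAP if some tuple is forced in both) as soon as there are two nonnegative
  integral families of weights on partial homomorphisms whose marginals agree and whose totals are coprime: each one is, up to
  scaling, a solution of the BLP, and a Bezout combination of them is an integral solution on the
  union of their supports. A homomorphism is such a family of total 1.

  Conversely, an integral solution yields a homomorphism by taking, at each element, the
  corresponding integral combination of values, if the template is closed under \<open>x - y + z\<close> in some
  Abelian group on its universe. For cosets over a 2-nilpotent group of odd order, the Baer sum
  \<open>x y [y, x]\<^bsup>1/2\<^esup>\<close> provides this group.

  The counterexample lives in the dihedral group of order 12, that is, in the affine maps
  \<open>z \<mapsto> \<plusminus>z + w\<close> on six points. The global sign selects between an unsolvable linear system mod 2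
  and an unsolvable one mod 3. If the systems are expanding, then their local solutions carry
  uniform weights of total a power of 2 and of 3, respectively.\<close>

text \<open>An Abelian-like template is easy because a single combination of values repairs all
  constraints at once. A counterexample therefore needs two branches that no combination of values
  can merge although the marginals do merge them. Reflections achieve this: a subgroup of a dihedral
  power leaves the right-hand sides of the equations for the two signs independent of each other.
  Neither branch fools the integral test alone, being affine itself; only totals such as
  \<open>2 ^ K\<close> and \<open>3 ^ K\<close> together reach 1.

  Width linear in the size forces sparse systems: \<open>n + 1\<close> equations with five entries
  each in \<open>n\<close> variables. Counting makes them unsolvable, whereas expansion ensures that
  consequences on few variables come from few equations. The same incidence pattern serves both
  moduli, and the Chinese remainder theorem merges the right-hand sides.

  CLAP is the obstacle for this scheme, since fixing a tuple of the system would fix the sign and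
  leave one branch. Its accepting run has to fix a tuple on which both branches agree.\<close>

section \<open>Weights on partial maps\<close>

text \<open>The total \<open>c\<close> is not normalized to 1: an integral family of total \<open>c\<close> stands for a rational one
  with common denominator \<open>c\<close>.\<close>

definition weights ::
  "nat \<Rightarrow> 'b set \<Rightarrow> 'a set \<Rightarrow> 'c::comm_ring_1 \<Rightarrow> ('b set \<Rightarrow> ('b \<Rightarrow> 'a) \<Rightarrow> 'c) \<Rightarrow> bool"
where
  "weights K V A c w \<longleftrightarrow>
     (\<forall>X. X \<subseteq> V \<and> card X \<le> K \<longrightarrow> (\<Sum>f\<in>X \<rightarrow>\<^sub>E A. w X f) = c \<and>
        (\<forall>Y\<subseteq>X. \<forall>g\<in>Y \<rightarrow>\<^sub>E A. (\<Sum>f\<in>{f \<in> X \<rightarrow>\<^sub>E A. restrict f Y = g}. w X f) = w Y g))"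

definition supported ::
  "'r vocab \<Rightarrow> ('a, 'r) rel_struct \<Rightarrow> ('b, 'r) rel_struct \<Rightarrow> ('b set \<Rightarrow> ('b \<Rightarrow> 'a) \<Rightarrow> 'c::zero) \<Rightarrow> bool"
where
  "supported \<tau> A B w \<longleftrightarrow>
     (\<forall>R\<in>symbols \<tau>. \<forall>b\<in>rel B R. \<forall>f\<in>set b \<rightarrow>\<^sub>E univ A. w (set b) f \<noteq> 0 \<longrightarrow> map f b \<in> rel A R)"

text \<open>At most one \<open>f\<close> on \<open>set b\<close> satisfies
  \<open>map f b = a\<close>, and none does if \<open>a\<close> differs at two positions where
  \<open>b\<close> agrees. The sum is the weight of the map that \<open>a\<close> induces, and 0 if
  there is none.\<close>

definition lsys_point ::
  "('a, 'r) rel_struct \<Rightarrow> ('b set \<Rightarrow> ('b \<Rightarrow> 'a) \<Rightarrow> 'c::comm_ring_1) \<Rightarrow> ('r, 'b, 'a) lvar \<Rightarrow> 'c"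
where
  "lsys_point A w x = (case x of Lam X f \<Rightarrow> w X f
     | Mu R b a \<Rightarrow> (\<Sum>f\<in>{f \<in> set b \<rightarrow>\<^sub>E univ A. map f b = a}. w (set b) f))"

lemma lsys_point_simps [simp]:
  "lsys_point A w (Lam X f) = w X f"
  "lsys_point A w (Mu R b a) = (\<Sum>f\<in>{f \<in> set b \<rightarrow>\<^sub>E univ A. map f b = a}. w (set b) f)"
  by (simp_all add: lsys_point_def)

lemma weightsD:
  assumes "weights K V A c w" "X \<subseteq> V" "card X \<le> K"
  shows "(\<Sum>f\<in>X \<rightarrow>\<^sub>E A. w X f) = c"
    and "Y \<subseteq> X \<Longrightarrow> g \<in> Y \<rightarrow>\<^sub>E A \<Longrightarrow> (\<Sum>f\<in>{f \<in> X \<rightarrow>\<^sub>E A. restrict f Y = g}. w X f) = w Y g"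
  using assms unfolding weights_def by blast+

lemma weights_linear:
  assumes "weights K V A c w" "weights K V A d v"
  shows "weights K V A (x * c + y * d) (\<lambda>X f. x * w X f + y * v X f)"
  using assms unfolding weights_def by (simp add: sum.distrib sum_distrib_left [symmetric])

lemma weights_of_int:
  assumes "weights K V A c w" "c \<noteq> 0"
  shows "weights K V A (1::rat) (\<lambda>X f. of_int (w X f) / of_int c)"
  using assms unfolding weights_def
  by (simp add: sum_divide_distrib [symmetric] of_int_sum [symmetric] del: of_int_sum)

lemma weights_from_steps:
  assumes fin: "finite V" "finite A"
    and base: "w {} (\<lambda>_. undefined) = c"
    and step: "\<And>X u g. insert u X \<subseteq> V \<Longrightarrow> u \<notin> X \<Longrightarrow> card (insert u X) \<le> K \<Longrightarrow> g \<in> X \<rightarrow>\<^sub>E A \<Longrightarrow>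
      (\<Sum>f\<in>{f \<in> insert u X \<rightarrow>\<^sub>E A. restrict f X = g}. w (insert u X) f) = w X g"
  shows "weights K V A c w"
proof -
  have marg: "(\<Sum>f\<in>{f \<in> X \<rightarrow>\<^sub>E A. restrict f Y = g}. w X f) = w Y g"
    if "X \<subseteq> V" "card X \<le> K" "Y \<subseteq> X" "g \<in> Y \<rightarrow>\<^sub>E A" for X Y g
  proof -
    have "finite (X - Y)" using that fin finite_subset by blast
    then show ?thesis using that
    proof (induction "X - Y" arbitrary: X rule: finite_induct)
      case empty
      then have "X = Y" by blast
      then have "{f \<in> X \<rightarrow>\<^sub>E A. restrict f Y = g} = {g}" using empty
        by (auto simp: PiE_restrict)
      then have "(\<Sum>f\<in>{f \<in> X \<rightarrow>\<^sub>E A. restrict f Y = g}. w X f) = (\<Sum>f\<in>{g}. w X f)"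
        by (rule sum.cong) simp
      moreover have "(\<Sum>f\<in>{g}. w X f) = w Y g" using \<open>X = Y\<close> by simp
      ultimately show ?case by (rule trans)
    next
      case (insert u D)
      define Z where "Z = X - {u}"
      have XZ: "X = insert u Z" "u \<notin> Z" using insert Z_def by auto
      have finX: "finite X" using insert.prems(1) fin finite_subset by blast
      have YZ: "Y \<subseteq> Z" using insert Z_def by auto
      have D: "D = Z - Y" using insert.hyps Z_def by auto
      have cZ: "card Z \<le> K" using insert.prems(2) finX XZ by auto
      have finZ: "finite (Z \<rightarrow>\<^sub>E A)" "finite (X \<rightarrow>\<^sub>E A)" using finX XZ fin by (auto intro: finite_PiE)
      have "(\<Sum>f\<in>{f \<in> X \<rightarrow>\<^sub>E A. restrict f Y = g}. w X f)
          = (\<Sum>h\<in>{h \<in> Z \<rightarrow>\<^sub>E A. restrict h Y = g}. \<Sum>f\<in>{f \<in> {f \<in> X \<rightarrow>\<^sub>E A. restrict f Y = g}. restrict f Z = h}. w X f)"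
        by (rule sum.group [symmetric])
          (use finZ YZ XZ in \<open>auto simp: restrict_restrict Int_absorb1 intro!: restrict_PiE_iff [THEN iffD2]\<close>)
      also have "\<dots> = (\<Sum>h\<in>{h \<in> Z \<rightarrow>\<^sub>E A. restrict h Y = g}. w Z h)"
      proof (rule sum.cong [OF refl])
        fix h assume h: "h \<in> {h \<in> Z \<rightarrow>\<^sub>E A. restrict h Y = g}"
        have "{f \<in> {f \<in> X \<rightarrow>\<^sub>E A. restrict f Y = g}. restrict f Z = h} = {f \<in> insert u Z \<rightarrow>\<^sub>E A. restrict f Z = h}"
          using h YZ XZ by (auto simp: restrict_restrict Int_absorb1)
        then show "(\<Sum>f\<in>{f \<in> {f \<in> X \<rightarrow>\<^sub>E A. restrict f Y = g}. restrict f Z = h}. w X f) = w Z h"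
          using step [of u Z h] h XZ insert.prems by simp
      qed
      also have "\<dots> = w Y g"
        using insert.hyps(3) [OF D] insert.prems cZ YZ XZ by auto
      finally show ?case .
    qed
  qed
  have "(\<Sum>f\<in>X \<rightarrow>\<^sub>E A. w X f) = c" if "X \<subseteq> V" "card X \<le> K" for X
    using marg [OF that, of "{}" "\<lambda>_. undefined"] base by (simp add: restrict_def)
  then show ?thesis unfolding weights_def using marg by blast
qed

text \<open>A map that acts on each element separately commutes with restriction, so marginals
  survive the transport. This carries weights on residues over to group elements.\<close>

lemma weights_push:
  assumes fin: "finite V" "finite A" "finite A'" and w: "weights K V A c w"
    and phi: "\<And>u y. u \<in> V \<Longrightarrow> y \<in> A \<Longrightarrow> \<phi> u y \<in> A'"
  shows "weights K V A' c (\<lambda>X f. \<Sum>y\<in>{y \<in> X \<rightarrow>\<^sub>E A. (\<lambda>u\<in>X. \<phi> u (y u)) = f}. w X y)"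
proof -
  have finP: "finite (X \<rightarrow>\<^sub>E A)" "finite (X \<rightarrow>\<^sub>E A')" if "X \<subseteq> V" for X
    using that fin finite_subset by (blast intro: finite_PiE)+
  have "(\<Sum>f\<in>X \<rightarrow>\<^sub>E A'. \<Sum>y\<in>{y \<in> X \<rightarrow>\<^sub>E A. (\<lambda>u\<in>X. \<phi> u (y u)) = f}. w X y) = (\<Sum>y\<in>X \<rightarrow>\<^sub>E A. w X y)"
    if "X \<subseteq> V" for X
    by (rule sum.group) (use finP [OF that] phi that in \<open>auto intro!: phi\<close>)
  moreover have "(\<Sum>f\<in>{f \<in> X \<rightarrow>\<^sub>E A'. restrict f Y = g}. \<Sum>y\<in>{y \<in> X \<rightarrow>\<^sub>E A. (\<lambda>u\<in>X. \<phi> u (y u)) = f}. w X y)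
      = (\<Sum>y\<in>{y \<in> Y \<rightarrow>\<^sub>E A. (\<lambda>u\<in>Y. \<phi> u (y u)) = g}. w Y y)"
    if X: "X \<subseteq> V" "card X \<le> K" "Y \<subseteq> X" and g: "g \<in> Y \<rightarrow>\<^sub>E A'" for X Y g
  proof -
    let ?T = "\<lambda>X y. \<lambda>u\<in>X. \<phi> u (y u)"
    have T: "restrict (?T X y) Y = ?T Y (restrict y Y)" for y
      using X(3) by (intro ext) auto
    have "(\<Sum>f\<in>{f \<in> X \<rightarrow>\<^sub>E A'. restrict f Y = g}. \<Sum>y\<in>{y \<in> X \<rightarrow>\<^sub>E A. ?T X y = f}. w X y)
        = (\<Sum>f\<in>{f \<in> X \<rightarrow>\<^sub>E A'. restrict f Y = g}. \<Sum>y\<in>{y \<in> {y \<in> X \<rightarrow>\<^sub>E A. ?T Y (restrict y Y) = g}. ?T X y = f}. w X y)"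
      using T by (intro sum.cong refl) auto
    also have "\<dots> = (\<Sum>y\<in>{y \<in> X \<rightarrow>\<^sub>E A. ?T Y (restrict y Y) = g}. w X y)"
      by (rule sum.group) (use finP [OF X(1)] X T in \<open>auto intro!: phi\<close>)
    also have "\<dots> = (\<Sum>z\<in>{z \<in> Y \<rightarrow>\<^sub>E A. ?T Y z = g}. \<Sum>y\<in>{y \<in> {y \<in> X \<rightarrow>\<^sub>E A. ?T Y (restrict y Y) = g}. restrict y Y = z}. w X y)"
      by (rule sum.group [symmetric]) (use finP [OF X(1)] finP [of Y] X in auto)
    also have "\<dots> = (\<Sum>z\<in>{z \<in> Y \<rightarrow>\<^sub>E A. ?T Y z = g}. w Y z)"
    proof (rule sum.cong [OF refl])
      fix z assume z: "z \<in> {z \<in> Y \<rightarrow>\<^sub>E A. ?T Y z = g}"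
      then have "{y \<in> {y \<in> X \<rightarrow>\<^sub>E A. ?T Y (restrict y Y) = g}. restrict y Y = z} = {y \<in> X \<rightarrow>\<^sub>E A. restrict y Y = z}"
        by auto
      then show "(\<Sum>y\<in>{y \<in> {y \<in> X \<rightarrow>\<^sub>E A. ?T Y (restrict y Y) = g}. restrict y Y = z}. w X y) = w Y z"
        using weightsD(2) [OF w X] z by auto
    qed
    finally show ?thesis .
  qed
  ultimately show ?thesis
    unfolding weights_def using w [unfolded weights_def] by simp
qed

text \<open>Conditioning on the map \<open>a\<close> on \<open>C\<close>, left unnormalized so that
  integrality is kept. Every query has to include \<open>C\<close>, which costs
  \<open>card C\<close> of the width.\<close>

lemma weights_condition:
  assumes fin: "finite V" "finite A" and w: "weights K V A c w"
    and C: "C \<subseteq> V" "L + card C \<le> K" and a: "a \<in> C \<rightarrow>\<^sub>E A"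
  shows "weights L V A (w C a)
    (\<lambda>X f. \<Sum>g\<in>{g \<in> X \<union> C \<rightarrow>\<^sub>E A. restrict g X = f \<and> restrict g C = a}. w (X \<union> C) g)"
proof -
  have finP: "finite (X \<rightarrow>\<^sub>E A)" if "X \<subseteq> V" for X
    using that fin finite_subset by (blast intro: finite_PiE)+
  have card: "card (X \<union> C) \<le> K" if "card X \<le> L" for X
    using card_Un_le [of X C] C that by linarith
  have "(\<Sum>f\<in>X \<rightarrow>\<^sub>E A. \<Sum>g\<in>{g \<in> X \<union> C \<rightarrow>\<^sub>E A. restrict g X = f \<and> restrict g C = a}. w (X \<union> C) g) = w C a"
    if X: "X \<subseteq> V" "card X \<le> L" for X
  proof -
    have "(\<Sum>f\<in>X \<rightarrow>\<^sub>E A. \<Sum>g\<in>{g \<in> X \<union> C \<rightarrow>\<^sub>E A. restrict g X = f \<and> restrict g C = a}. w (X \<union> C) g)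
       = (\<Sum>f\<in>X \<rightarrow>\<^sub>E A. \<Sum>g\<in>{g \<in> {g \<in> X \<union> C \<rightarrow>\<^sub>E A. restrict g C = a}. restrict g X = f}. w (X \<union> C) g)"
      by (intro sum.cong refl) auto
    also have "\<dots> = (\<Sum>g\<in>{g \<in> X \<union> C \<rightarrow>\<^sub>E A. restrict g C = a}. w (X \<union> C) g)"
      by (rule sum.group) (use finP [of X] finP [of "X \<union> C"] X C in auto)
    also have "\<dots> = w C a"
      by (rule weightsD(2) [OF w]) (use X C card a in auto)
    finally show ?thesis .
  qed
  moreover have "(\<Sum>f\<in>{f \<in> X \<rightarrow>\<^sub>E A. restrict f Y = h}.
        \<Sum>g\<in>{g \<in> X \<union> C \<rightarrow>\<^sub>E A. restrict g X = f \<and> restrict g C = a}. w (X \<union> C) g)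
      = (\<Sum>g\<in>{g \<in> Y \<union> C \<rightarrow>\<^sub>E A. restrict g Y = h \<and> restrict g C = a}. w (Y \<union> C) g)"
    if X: "X \<subseteq> V" "card X \<le> L" "Y \<subseteq> X" and h: "h \<in> Y \<rightarrow>\<^sub>E A" for X Y h
  proof -
    have r: "restrict (restrict g X) Y = restrict g Y" for g :: "'a \<Rightarrow> 'b"
      using X(3) by (simp add: Int_absorb1)
    have "(\<Sum>f\<in>{f \<in> X \<rightarrow>\<^sub>E A. restrict f Y = h}.
        \<Sum>g\<in>{g \<in> X \<union> C \<rightarrow>\<^sub>E A. restrict g X = f \<and> restrict g C = a}. w (X \<union> C) g)
      = (\<Sum>f\<in>{f \<in> X \<rightarrow>\<^sub>E A. restrict f Y = h}.
        \<Sum>g\<in>{g \<in> {g \<in> X \<union> C \<rightarrow>\<^sub>E A. restrict g Y = h \<and> restrict g C = a}. restrict g X = f}. w (X \<union> C) g)"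
      using r by (intro sum.cong refl) auto
    also have "\<dots> = (\<Sum>g\<in>{g \<in> X \<union> C \<rightarrow>\<^sub>E A. restrict g Y = h \<and> restrict g C = a}. w (X \<union> C) g)"
      by (rule sum.group) (use finP [of X] finP [of "X \<union> C"] X C r in auto)
    also have "\<dots> = (\<Sum>g'\<in>{g \<in> Y \<union> C \<rightarrow>\<^sub>E A. restrict g Y = h \<and> restrict g C = a}.
        \<Sum>g\<in>{g \<in> {g \<in> X \<union> C \<rightarrow>\<^sub>E A. restrict g Y = h \<and> restrict g C = a}. restrict g (Y \<union> C) = g'}. w (X \<union> C) g)"
      by (rule sum.group [symmetric])
        (use finP [of "Y \<union> C"] finP [of "X \<union> C"] X C h a
          in \<open>auto simp: Int_absorb1 Int_absorb2\<close>)
    also have "\<dots> = (\<Sum>g'\<in>{g \<in> Y \<union> C \<rightarrow>\<^sub>E A. restrict g Y = h \<and> restrict g C = a}. w (Y \<union> C) g')"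
    proof (rule sum.cong [OF refl])
      fix g' assume g': "g' \<in> {g \<in> Y \<union> C \<rightarrow>\<^sub>E A. restrict g Y = h \<and> restrict g C = a}"
      have "restrict g Y = restrict g' Y \<and> restrict g C = restrict g' C" if "restrict g (Y \<union> C) = g'" for g
        unfolding that [symmetric] by (simp add: Int_absorb1)
      then have "{g \<in> {g \<in> X \<union> C \<rightarrow>\<^sub>E A. restrict g Y = h \<and> restrict g C = a}. restrict g (Y \<union> C) = g'}
          = {g \<in> X \<union> C \<rightarrow>\<^sub>E A. restrict g (Y \<union> C) = g'}"
        using g' by auto
      then show "(\<Sum>g\<in>{g \<in> {g \<in> X \<union> C \<rightarrow>\<^sub>E A. restrict g Y = h \<and> restrict g C = a}. restrict g (Y \<union> C) = g'}. w (X \<union> C) g) = w (Y \<union> C) g'"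
        using weightsD(2) [OF w _ card [OF X(2)], of "Y \<union> C" g'] X C g'
        by (metis (mono_tags, lifting) Un_least Un_mono mem_Collect_eq order_refl)
    qed
    finally show ?thesis .
  qed
  ultimately show ?thesis unfolding weights_def by simp
qed

text \<open>Each equation for a tuple of positions is a marginal from the whole scope
  \<open>set b\<close> to some of its elements. Hence \<open>K\<close> has to bound the arities as
  well as \<open>k\<close>.\<close>

lemma lsys_point_in_lsys:
  fixes w :: "'b set \<Rightarrow> ('b \<Rightarrow> 'a) \<Rightarrow> 'c::comm_ring_1"
  assumes B: "fin_struct \<tau> B" and fin: "finite (univ A)"
    and relA: "\<And>R. R \<in> symbols \<tau> \<Longrightarrow> finite (rel A R)"
    and w: "weights K (univ B) (univ A) 1 w" and sup: "supported \<tau> A B w"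
    and K: "k \<le> K" "\<And>R. R \<in> symbols \<tau> \<Longrightarrow> ar \<tau> R \<le> K"
  shows "lsys_point A w \<in> lsys k \<tau> A B"
proof -
  have finB: "finite (univ B)" using B by (simp add: fin_struct_def)
  have 1: "(\<Sum>f\<in>X \<rightarrow>\<^sub>E univ A. w X f) = 1"
    "Y \<subset> X \<Longrightarrow> g \<in> Y \<rightarrow>\<^sub>E univ A \<Longrightarrow> (\<Sum>f\<in>{f \<in> X \<rightarrow>\<^sub>E univ A. restrict f Y = g}. w X f) = w Y g"
    if "X \<in> small_sets k B" for X Y g
    using that weightsD [OF w] K by (auto simp: small_sets_def)
  have 2: "(\<Sum>a\<in>{a \<in> rel A R. proj i a = a'}. lsys_point A w (Mu R b a)) = w (set (proj i b)) f"
    if R: "R \<in> symbols \<tau>" and b: "b \<in> rel B R" and i: "set i \<subseteq> {..<ar \<tau> R}"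
      and f: "f \<in> set (proj i b) \<rightarrow>\<^sub>E univ A" and a': "map f (proj i b) = a'" for R b a' i f
  proof -
    have len: "length b = ar \<tau> R" and sb: "set b \<subseteq> univ B"
      using B R b by (auto simp: fin_struct_def)
    have cb: "card (set b) \<le> K" using card_length [of b] K(2) [OF R] len by simp
    have sub: "set (proj i b) \<subseteq> set b" using i len by (auto simp: proj_def)
    have finP: "finite (set b \<rightarrow>\<^sub>E univ A)" using fin by (auto intro: finite_PiE)
    have pm: "proj i (map f' b) = map f' (proj i b)" for f' :: "'b \<Rightarrow> 'a"
      using i len by (auto simp: proj_def)
    have eq: "map f' (proj i b) = a' \<longleftrightarrow> restrict f' (set (proj i b)) = f" for f'
      using f a' by (auto simp: fun_eq_iff restrict_def PiE_def extensional_def)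
    have "(\<Sum>a\<in>{a \<in> rel A R. proj i a = a'}. lsys_point A w (Mu R b a))
        = (\<Sum>a\<in>{a \<in> rel A R. proj i a = a'}. \<Sum>f'\<in>{f' \<in> {f' \<in> set b \<rightarrow>\<^sub>E univ A. map f' b \<in> rel A R \<and> proj i (map f' b) = a'}. map f' b
            = a}. w (set b) f')"
      by (auto intro!: sum.cong)
    also have "\<dots> = (\<Sum>f'\<in>{f' \<in> set b \<rightarrow>\<^sub>E univ A. map f' b \<in> rel A R \<and> proj i (map f' b) = a'}. w (set b) f')"
      by (rule sum.group) (use finP relA [OF R] in auto)
    \<comment> \<open>Maps whose image is not in the relation have weight 0 by
      \<open>supported\<close>, so they may join the sum.\<close>
    also have "\<dots> = (\<Sum>f'\<in>{f' \<in> set b \<rightarrow>\<^sub>E univ A. restrict f' (set (proj i b)) = f}. w (set b) f')"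
      by (rule sum.mono_neutral_left) (use finP sup R b in \<open>auto simp: pm eq supported_def\<close>)
    also have "\<dots> = w (set (proj i b)) f"
      by (rule weightsD(2) [OF w sb cb sub f])
    finally show ?thesis .
  qed
  show ?thesis unfolding lsys_def using 1 2 by (auto simp del: lsys_point_simps(2))
qed

section \<open>Acceptance from weights with coprime totals\<close>

text \<open>Nonnegative weights cannot cancel: a marginal is at least each of its summands. Together
  with \<open>weights_extend_neq_0\<close> this gives the two closure properties that k-consistency
  demands of the support.\<close>

lemma weights_restrict_neq_0:
  fixes w :: "'b set \<Rightarrow> ('b \<Rightarrow> 'a) \<Rightarrow> int"
  assumes "finite V" "finite A" "weights K V A c w" "\<And>X f. 0 \<le> w X f"
    and "X \<subseteq> V" "card X \<le> K" "Y \<subseteq> X" "f \<in> X \<rightarrow>\<^sub>E A" "w X f \<noteq> 0"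
  shows "w Y (restrict f Y) \<noteq> 0"
proof -
  have fin: "finite (X \<rightarrow>\<^sub>E A)" using assms finite_subset by (blast intro: finite_PiE)
  have "w X f \<le> (\<Sum>h\<in>{h \<in> X \<rightarrow>\<^sub>E A. restrict h Y = restrict f Y}. w X h)"
    by (rule member_le_sum) (use assms fin in auto)
  also have "\<dots> = w Y (restrict f Y)"
    by (rule weightsD(2) [OF assms(3)]) (use assms in auto)
  finally show ?thesis using assms(4) [of X f] assms(9) by linarith
qed

lemma weights_extend_neq_0:
  assumes "weights K V A c w" "X \<subseteq> V" "card X \<le> K" "Y \<subseteq> X" "g \<in> Y \<rightarrow>\<^sub>E A" "w Y g \<noteq> 0"
  shows "\<exists>f\<in>X \<rightarrow>\<^sub>E A. restrict f Y = g \<and> w X f \<noteq> 0"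
proof (rule ccontr)
  assume "\<not> ?thesis"
  then have "(\<Sum>f\<in>{f \<in> X \<rightarrow>\<^sub>E A. restrict f Y = g}. w X f) = 0"
    by (intro sum.neutral) auto
  then show False using weightsD(2) [OF assms(1-5)] assms(6) by simp
qed

section \<open>Z-affine k-consistency\<close>

lemma kappa_consistent: "k_consistent_family k \<tau> A B (kappa k \<tau> A B)"
  and kappa_greatest: "k_consistent_family k \<tau> A B \<kappa> \<Longrightarrow> \<kappa> X \<subseteq> kappa k \<tau> A B X"
proof -
  let ?U = "\<lambda>X. \<Union>{\<kappa> X | \<kappa>. k_consistent_family k \<tau> A B \<kappa>}"
  have U: "k_consistent_family k \<tau> A B ?U"
  proof -
    have a: "?U X \<subseteq> homs \<tau> (induced B X) A" if "X \<in> small_sets k B" for X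
      using that by (auto simp: k_consistent_family_def)
    have b: "(\<forall>f\<in>?U Y. \<exists>g\<in>?U X. restrict g Y = f) \<and> (\<forall>g\<in>?U X. restrict g Y \<in> ?U Y)"
      if "X \<in> small_sets k B" "Y \<subset> X" for X Y
    proof (intro conjI ballI)
      fix f assume "f \<in> ?U Y"
      then obtain \<kappa> where k: "k_consistent_family k \<tau> A B \<kappa>" "f \<in> \<kappa> Y" by blast
      with that obtain g where "g \<in> \<kappa> X" "restrict g Y = f"
        unfolding k_consistent_family_def by blast
      with k show "\<exists>g\<in>?U X. restrict g Y = f" by blast
    next
      fix g assume "g \<in> ?U X"
      then obtain \<kappa> where k: "k_consistent_family k \<tau> A B \<kappa>" "g \<in> \<kappa> X" by blast
      with that have "restrict g Y \<in> \<kappa> Y" unfolding k_consistent_family_def by blast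
      with k show "restrict g Y \<in> ?U Y" by blast
    qed
    show ?thesis
      by (rule k_consistent_family_def [THEN iffD2], rule conjI; intro ballI allI impI a b)
  qed
  have "kappa k \<tau> A B = ?U"
    unfolding kappa_def
  proof (rule Greatest_equality)
    show "k_consistent_family k \<tau> A B ?U" by (rule U)
    fix \<kappa> assume "k_consistent_family k \<tau> A B \<kappa>"
    then show "\<kappa> \<le> ?U" unfolding le_fun_def by blast
  qed
  then show "k_consistent_family k \<tau> A B (kappa k \<tau> A B)"
    using U by (simp only:)
  show "\<kappa> X \<subseteq> kappa k \<tau> A B X" if "k_consistent_family k \<tau> A B \<kappa>"
    unfolding \<open>kappa k \<tau> A B = ?U\<close> using that by blast
qed

text \<open>The two supports together form a k-consistent family and hence lie within
  \<open>kappa\<close>, which may be larger. The Bezout combination vanishes on the rest, so sums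
  over \<open>kappa\<close> agree with sums over all maps.\<close>

lemma z_affine_accepts_weights:
  fixes w v :: "'b set \<Rightarrow> ('b \<Rightarrow> 'a) \<Rightarrow> int"
  assumes B: "fin_struct \<tau> B" and fin: "finite (univ A)"
    and w: "weights K (univ B) (univ A) c w" "\<And>X f. 0 \<le> w X f" "supported \<tau> A B w"
    and v: "weights K (univ B) (univ A) d v" "\<And>X f. 0 \<le> v X f" "supported \<tau> A B v"
    and cd: "coprime c d" and k: "k \<le> K"
  shows "z_affine_accepts k \<tau> A B"
proof -
  have finB: "finite (univ B)" using B by (simp add: fin_struct_def)
  define \<kappa> where "\<kappa> X = (if X \<in> small_sets k B then {f \<in> X \<rightarrow>\<^sub>E univ A. w X f \<noteq> 0 \<or> v X f \<noteq> 0} else {})" for X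
  have small: "X \<subseteq> univ B" "card X \<le> K" if "X \<in> small_sets k B" for X
    using that k by (auto simp: small_sets_def)
  have sub: "Y \<in> small_sets k B" if "X \<in> small_sets k B" "Y \<subseteq> X" for X Y
    using that finB unfolding small_sets_def
    by (metis (mono_tags, lifting) card_mono finite_subset le_trans mem_Collect_eq subset_trans)
  have hom: "f \<in> homs \<tau> (induced B X) A"
    if X: "X \<in> small_sets k B" and f: "f \<in> X \<rightarrow>\<^sub>E univ A" and u: "u X f \<noteq> 0"
      and uw: "weights K (univ B) (univ A) e u" "\<And>X f. 0 \<le> u X f" "supported \<tau> A B u"
    for X f e and u :: "'b set \<Rightarrow> ('b \<Rightarrow> 'a) \<Rightarrow> int"
  proof -
    have "map f b \<in> rel A R" if "R \<in> symbols \<tau>" "b \<in> rel B R" "set b \<subseteq> X" for R b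
    proof -
      have "u (set b) (restrict f (set b)) \<noteq> 0"
        by (rule weights_restrict_neq_0 [OF finB fin uw(1,2) small [OF X] that(3) f u])
      moreover have "restrict f (set b) \<in> set b \<rightarrow>\<^sub>E univ A" using f that(3) by auto
      ultimately have "map (restrict f (set b)) b \<in> rel A R"
        using uw(3) that unfolding supported_def by blast
      then show ?thesis by (simp cong: map_cong)
    qed
    then show ?thesis using f by (auto simp: homs_def induced_def)
  qed
  have "k_consistent_family k \<tau> A B \<kappa>"
    unfolding k_consistent_family_def
  proof (intro conjI ballI allI impI)
    fix X assume X: "X \<in> small_sets k B"
    show "\<kappa> X \<subseteq> homs \<tau> (induced B X) A"
      using hom [OF X _ _ w] hom [OF X _ _ v] X by (auto simp: \<kappa>_def)
    fix Y assume Y: "Y \<subset> X"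
    {
      fix f assume f: "f \<in> \<kappa> Y"
      show "\<exists>g\<in>\<kappa> X. restrict g Y = f"
        using f X sub [OF X] Y weights_extend_neq_0 [OF w(1) small [OF X], of Y f]
          weights_extend_neq_0 [OF v(1) small [OF X], of Y f]
        by (auto simp: \<kappa>_def psubset_eq) 
    next
      fix g assume g: "g \<in> \<kappa> X"
      show "restrict g Y \<in> \<kappa> Y"
        using g X sub [OF X] Y weights_restrict_neq_0 [OF finB fin w(1,2) small [OF X], of Y g]
          weights_restrict_neq_0 [OF finB fin v(1,2) small [OF X], of Y g]
        by (auto simp: \<kappa>_def psubset_eq)
    }
  qed
  then have le: "\<kappa> X \<subseteq> kappa k \<tau> A B X" for X by (rule kappa_greatest)
  have ge: "kappa k \<tau> A B X \<subseteq> X \<rightarrow>\<^sub>E univ A" if "X \<in> small_sets k B" for X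
  proof -
    have "kappa k \<tau> A B X \<subseteq> homs \<tau> (induced B X) A"
      using kappa_consistent [of k \<tau> A B] that unfolding k_consistent_family_def by blast
    then show ?thesis by (auto simp: homs_def induced_def)
  qed
  obtain x y where xy: "x * c + y * d = 1"
    using bezout_int [of c d] cd by auto
  define z where "z X f = x * w X f + y * v X f" for X f
  have z: "weights K (univ B) (univ A) 1 z"
    using weights_linear [OF w(1) v(1), of x y] xy by (simp add: z_def [abs_def])
  have finP: "finite (X \<rightarrow>\<^sub>E univ A)" if "X \<in> small_sets k B" for X
    using small(1) [OF that] finB fin finite_subset by (blast intro: finite_PiE)
  have zero: "z X f = 0" if "X \<in> small_sets k B" "f \<in> X \<rightarrow>\<^sub>E univ A" "f \<notin> kappa k \<tau> A B X" for X f
    using that le [of X] by (auto simp: \<kappa>_def z_def)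
  have "(\<Sum>f\<in>kappa k \<tau> A B X. z X f) = 1" if X: "X \<in> small_sets k B" for X
  proof -
    have "(\<Sum>f\<in>kappa k \<tau> A B X. z X f) = (\<Sum>f\<in>X \<rightarrow>\<^sub>E univ A. z X f)"
      by (rule sum.mono_neutral_left) (use finP [OF X] ge [OF X] zero [OF X] in auto)
    then show ?thesis using weightsD(1) [OF z small [OF X]] by simp
  qed
  moreover have "(\<Sum>f\<in>{f \<in> kappa k \<tau> A B X. restrict f Y = g}. z X f) = z Y g"
    if X: "X \<in> small_sets k B" and Y: "Y \<subset> X" and g: "g \<in> kappa k \<tau> A B Y" for X Y g
  proof -
    have "(\<Sum>f\<in>{f \<in> kappa k \<tau> A B X. restrict f Y = g}. z X f) = (\<Sum>f\<in>{f \<in> X \<rightarrow>\<^sub>E univ A. restrict f Y = g}. z X f)"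
      by (rule sum.mono_neutral_left) (use finP [OF X] ge [OF X] zero [OF X] in auto)
    then show ?thesis using weightsD(2) [OF z small [OF X], of Y g] Y g sub [OF X, of Y] ge [of Y] by auto
  qed
  ultimately show ?thesis unfolding z_affine_accepts_def Let_def by blast
qed

section \<open>Relative interior points and BA\<close>

lemma rat_rel_interior_full_support:
  assumes fin: "finite V" and P: "P = {\<Phi> \<in> Q. \<forall>x\<in>V. 0 \<le> \<Phi> x}" and ne: "P \<noteq> {}"
    and Q: "\<And>\<Phi> \<Psi> \<epsilon>. \<Phi> \<in> Q \<Longrightarrow> \<Psi> \<in> Q \<Longrightarrow> (\<lambda>x. \<Phi> x + \<epsilon> * (\<Phi> x - \<Psi> x)) \<in> Q"
  obtains \<Phi> where "\<Phi> \<in> rat_rel_interior P"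
    and "\<And>\<Psi> x. \<Psi> \<in> P \<Longrightarrow> x \<in> V \<Longrightarrow> \<Phi> x = 0 \<Longrightarrow> \<Psi> x = 0"
proof -
  \<comment> \<open>A point of largest support works: its midpoint with any other point of
    \<open>P\<close> would support the union of both. Every inequality that can be slack is then
    slack, which leaves room to move away from any \<open>\<Psi>\<close>.\<close>
  let ?m = "\<lambda>\<Phi>. card {x \<in> V. \<Phi> x \<noteq> 0}"
  have "\<And>\<Phi>. ?m \<Phi> \<le> card V" using fin by (simp add: card_mono)
  then obtain \<Phi> where \<Phi>: "\<Phi> \<in> P" and max: "\<And>\<Psi>. \<Psi> \<in> P \<Longrightarrow> ?m \<Psi> \<le> ?m \<Phi>"
    using ex_has_greatest_nat [of "\<lambda>\<Phi>. \<Phi> \<in> P" "SOME \<Phi>. \<Phi> \<in> P" ?m "Suc (card V)"] ne some_in_eq [of P]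
    by (auto simp: less_Suc_eq_le)
  have full: "\<Psi> x = 0" if \<Psi>: "\<Psi> \<in> P" and x: "x \<in> V" "\<Phi> x = 0" for \<Psi> x
  proof (rule ccontr)
    assume nz: "\<Psi> x \<noteq> 0"
    \<comment> \<open>With step \<open>-1/2\<close> the extrapolation is the midpoint of
      \<open>\<Phi>\<close> and \<open>\<Psi>\<close>.\<close>
    define \<Theta> where "\<Theta> = (\<lambda>x. \<Phi> x + (-1/2) * (\<Phi> x - \<Psi> x))"
    have th: "\<Theta> x = (\<Phi> x + \<Psi> x) / 2" for x by (simp add: \<Theta>_def field_simps)
    have "\<Theta> \<in> Q" unfolding \<Theta>_def using Q \<Phi> \<Psi> P by blast
    moreover have "0 \<le> \<Theta> x" if "x \<in> V" for x
      using that \<Phi> \<Psi> P unfolding th by auto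
    ultimately have "\<Theta> \<in> P" using P by simp
    moreover have "{x \<in> V. \<Phi> x \<noteq> 0} \<subset> {x \<in> V. \<Theta> x \<noteq> 0}"
    proof
      show "{x \<in> V. \<Phi> x \<noteq> 0} \<subseteq> {x \<in> V. \<Theta> x \<noteq> 0}"
      proof clarsimp
        fix x assume "x \<in> V" "\<Phi> x \<noteq> 0" "\<Theta> x = 0"
        moreover have "0 \<le> \<Phi> x" "0 \<le> \<Psi> x" using \<open>x \<in> V\<close> \<Phi> \<Psi> P by auto
        ultimately show False using th [of x] by auto
      qed
      have "\<Theta> x \<noteq> 0" using x nz th [of x] by simp
      then show "{x \<in> V. \<Phi> x \<noteq> 0} \<noteq> {x \<in> V. \<Theta> x \<noteq> 0}" using x by blast
    qed
    then have "?m \<Phi> < ?m \<Theta>" using fin by (intro psubset_card_mono) auto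
    ultimately show False using max [of \<Theta>] by simp
  qed
  have "\<exists>\<epsilon>>0. (\<lambda>x. \<Phi> x + \<epsilon> * (\<Phi> x - \<Psi> x)) \<in> P" if \<Psi>: "\<Psi> \<in> P" for \<Psi>
  proof -
    \<comment> \<open>On the support, \<open>\<epsilon> * \<Psi> x \<le> \<Phi> x\<close> suffices
      for nonnegativity; the \<open>+ 1\<close> keeps the divisor positive where
      \<open>\<Psi> x = 0\<close>.\<close>
    define \<delta> where "\<delta> x = (if \<Phi> x = 0 then 1 else \<Phi> x / (\<Psi> x + 1))" for x
    define \<epsilon> where "\<epsilon> = Min (insert 1 (\<delta> ` V))"
    have nn: "0 \<le> \<Phi> x" "0 \<le> \<Psi> x" if "x \<in> V" for x using that \<Phi> \<Psi> P by auto
    have pos: "0 < \<delta> x" if "x \<in> V" for x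
      using nn [OF that] by (auto simp: \<delta>_def intro!: divide_pos_pos)
    have \<epsilon>: "0 < \<epsilon>" using fin pos by (auto simp: \<epsilon>_def)
    have "0 \<le> \<Phi> x + \<epsilon> * (\<Phi> x - \<Psi> x)" if x: "x \<in> V" for x
    proof (cases "\<Phi> x = 0")
      case True
      then show ?thesis using full [OF \<Psi> x] by simp
    next
      case False
      have "\<epsilon> \<le> \<delta> x" using fin x by (auto simp: \<epsilon>_def)
      then have "\<epsilon> * (\<Psi> x + 1) \<le> \<Phi> x"
        using False nn [OF x] by (simp add: \<delta>_def pos_le_divide_eq)
      moreover have "0 \<le> \<epsilon> * \<Phi> x" using \<epsilon> nn [OF x] by simp
      ultimately show ?thesis using \<epsilon> by (simp add: algebra_simps)
    qed
    moreover have "(\<lambda>x. \<Phi> x + \<epsilon> * (\<Phi> x - \<Psi> x)) \<in> Q" using Q \<Phi> \<Psi> P by blast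
    ultimately show ?thesis using \<epsilon> P by auto
  qed
  with \<Phi> have "\<Phi> \<in> rat_rel_interior P" by (simp add: rat_rel_interior_def)
  then show thesis using full that by blast
qed

lemma lsys_affine:
  fixes \<Phi> \<Psi> :: "('r, 'b, 'a) lvar \<Rightarrow> 'c::comm_ring_1"
  assumes "\<Phi> \<in> lsys k \<tau> A B" "\<Psi> \<in> lsys k \<tau> A B"
  shows "(\<lambda>x. \<Phi> x + \<epsilon> * (\<Phi> x - \<Psi> x)) \<in> lsys k \<tau> A B"
  using assms unfolding lsys_def
  by (simp add: sum.distrib sum_distrib_left [symmetric] sum_subtractf)

lemma finite_lvars:
  assumes "fin_struct \<tau> B" "finite (univ A)" "finite (symbols \<tau>)"
    and "\<And>R. R \<in> symbols \<tau> \<Longrightarrow> finite (rel A R)"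
  shows "finite (lvars k \<tau> A B)"
proof -
  have finB: "finite (univ B)" using assms by (simp add: fin_struct_def)
  have relB: "finite (rel B R)" if "R \<in> symbols \<tau>" for R
  proof (rule finite_subset)
    show "rel B R \<subseteq> {b. set b \<subseteq> univ B \<and> length b = ar \<tau> R}"
      using assms(1) that by (auto simp: fin_struct_def)
  qed (rule finite_lists_length_eq [OF finB])
  have "finite (small_sets k B)" using finB by (auto simp: small_sets_def)
  moreover have "finite (X \<rightarrow>\<^sub>E univ A)" if "X \<in> small_sets k B" for X
    using that finB assms(2) finite_subset unfolding small_sets_def by (blast intro: finite_PiE)
  ultimately have "finite (SIGMA X : small_sets k B. X \<rightarrow>\<^sub>E univ A)" by blast
  moreover have "finite (SIGMA R : symbols \<tau>. rel B R \<times> rel A R)" using assms relB by blast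
  ultimately have "finite ((\<lambda>(X, f). Lam X f) ` (SIGMA X : small_sets k B. X \<rightarrow>\<^sub>E univ A)
    \<union> (\<lambda>(R, b, a). Mu R b a) ` (SIGMA R : symbols \<tau>. rel B R \<times> rel A R))" by blast
  moreover have "lvars k \<tau> A B \<subseteq> (\<lambda>(X, f). Lam X f) ` (SIGMA X : small_sets k B. X \<rightarrow>\<^sub>E univ A)
    \<union> (\<lambda>(R, b, a). Mu R b a) ` (SIGMA R : symbols \<tau>. rel B R \<times> rel A R)"
    unfolding lvars_def by (intro Un_mono subsetI; clarsimp simp: image_iff)
  ultimately show ?thesis by (rule rev_finite_subset)
qed

lemma lsys_point_linear:
  "lsys_point A (\<lambda>X f. x * w X f + y * v X f) i = x * lsys_point A w i + y * lsys_point A v i"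
  by (cases i) (simp_all add: sum.distrib sum_distrib_left)

lemma lsys_point_of_int:
  "lsys_point A (\<lambda>X f. of_int (w X f) / of_int c) i = (of_int (lsys_point A w i) / of_int c :: rat)"
  by (cases i) (simp_all add: sum_divide_distrib)

lemma lsys_point_nonneg: "(\<And>X f. 0 \<le> w X f) \<Longrightarrow> 0 \<le> lsys_point A (w :: _ \<Rightarrow> _ \<Rightarrow> int) i"
  by (cases i) (auto intro: sum_nonneg)

lemma lsys_point_in_blp:
  fixes w :: "'b set \<Rightarrow> ('b \<Rightarrow> 'a) \<Rightarrow> int"
  assumes "fin_struct \<tau> B" "finite (univ A)" "\<And>R. R \<in> symbols \<tau> \<Longrightarrow> finite (rel A R)"
    and "weights K (univ B) (univ A) c w" "0 < c" "\<And>X f. 0 \<le> w X f" "supported \<tau> A B w"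
    and "k \<le> K" "\<And>R. R \<in> symbols \<tau> \<Longrightarrow> ar \<tau> R \<le> K"
  shows "lsys_point A (\<lambda>X f. of_int (w X f) / of_int c) \<in> blp k \<tau> A B"
proof -
  have "weights K (univ B) (univ A) (1::rat) (\<lambda>X f. of_int (w X f) / of_int c)"
    using assms by (intro weights_of_int) auto
  moreover have "supported \<tau> A B (\<lambda>X f. of_int (w X f) / of_int c :: rat)"
    using assms(5,7) by (auto simp: supported_def)
  ultimately have "lsys_point A (\<lambda>X f. of_int (w X f) / of_int c :: rat) \<in> lsys k \<tau> A B"
    using assms by (intro lsys_point_in_lsys)
  moreover have "0 \<le> lsys_point A (\<lambda>X f. of_int (w X f) / of_int c :: rat) i" for i
    using lsys_point_nonneg [of w A i] assms(5,6) unfolding lsys_point_of_int by simp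
  ultimately show ?thesis by (simp add: blp_def)
qed

text \<open>An interior point of full support vanishes only where both rescaled families vanish, and
  there their Bezout combination is 0 too.\<close>

lemma ba_accepts_weights:
  fixes w v :: "'b set \<Rightarrow> ('b \<Rightarrow> 'a) \<Rightarrow> int" and C :: "(('r, 'b, 'a) lvar \<Rightarrow> rat) set"
  assumes B: "fin_struct \<tau> B" and fin: "finite (univ A)" "finite (symbols \<tau>)"
      "\<And>R. R \<in> symbols \<tau> \<Longrightarrow> finite (rel A R)"
    and w: "weights K (univ B) (univ A) c w" "0 < c" "\<And>X f. 0 \<le> w X f" "supported \<tau> A B w"
    and v: "weights K (univ B) (univ A) d v" "0 < d" "\<And>X f. 0 \<le> v X f" "supported \<tau> A B v"
    and cd: "coprime c d" and K: "k \<le> K" "\<And>R. R \<in> symbols \<tau> \<Longrightarrow> ar \<tau> R \<le> K"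
    and C: "\<And>\<Phi> \<Psi> \<epsilon>. \<Phi> \<in> C \<Longrightarrow> \<Psi> \<in> C \<Longrightarrow> (\<lambda>x. \<Phi> x + \<epsilon> * (\<Phi> x - \<Psi> x)) \<in> C"
    and wC: "lsys_point A (\<lambda>X f. of_int (w X f) / of_int c) \<in> C"
    and vC: "lsys_point A (\<lambda>X f. of_int (v X f) / of_int d) \<in> C"
  shows "ba_accepts_with C k \<tau> A B"
proof -
  let ?P = "blp k \<tau> A B \<inter> C"
  have wP: "lsys_point A (\<lambda>X f. of_int (w X f) / of_int c) \<in> ?P"
    and vP: "lsys_point A (\<lambda>X f. of_int (v X f) / of_int d) \<in> ?P"
    using wC vC lsys_point_in_blp [OF B fin(1,3) w K] lsys_point_in_blp [OF B fin(1,3) v K] by auto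
  obtain \<Phi> where \<Phi>: "\<Phi> \<in> rat_rel_interior ?P"
    and full: "\<And>\<Psi> x. \<Psi> \<in> ?P \<Longrightarrow> x \<in> lvars k \<tau> A B \<Longrightarrow> \<Phi> x = 0 \<Longrightarrow> \<Psi> x = 0"
  proof (rule rat_rel_interior_full_support)
    show "finite (lvars k \<tau> A B)" using B fin by (rule finite_lvars)
    show "?P = {\<Phi> \<in> lsys k \<tau> A B \<inter> C. \<forall>x\<in>lvars k \<tau> A B. 0 \<le> \<Phi> x}" by (auto simp: blp_def)
    show "?P \<noteq> {}" using wP by blast
    show "(\<lambda>x. \<Phi> x + \<epsilon> * (\<Phi> x - \<Psi> x)) \<in> lsys k \<tau> A B \<inter> C"
      if "\<Phi> \<in> lsys k \<tau> A B \<inter> C" "\<Psi> \<in> lsys k \<tau> A B \<inter> C" for \<Phi> \<Psi> :: "_ \<Rightarrow> rat" and \<epsilon>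
      using that C lsys_affine by blast
  qed (use that in blast)
  obtain x y where xy: "x * c + y * d = 1"
    using bezout_int [of c d] cd by auto
  define z where "z X f = x * w X f + y * v X f" for X f
  have z: "weights K (univ B) (univ A) 1 z"
    using weights_linear [OF w(1) v(1), of x y] xy by (simp add: z_def [abs_def])
  have "supported \<tau> A B z" using w(4) v(4) unfolding supported_def z_def by fastforce
  with z have "lsys_point A z \<in> aip k \<tau> A B"
    unfolding aip_def using lsys_point_in_lsys [OF B fin(1,3)] K by blast
  moreover have "lsys_point A z i = 0" if "i \<in> lvars k \<tau> A B" "\<Phi> i = 0" for i
    using full [OF wP that] full [OF vP that] w(2) v(2)
    unfolding lsys_point_of_int z_def [abs_def] lsys_point_linear by simp
  ultimately show ?thesis unfolding ba_accepts_with_def using \<Phi> by blast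
qed

section \<open>The removal phase of CLAP\<close>

lemma clap_constraints_affine:
  assumes "\<Phi> \<in> clap_constraints \<tau> A B S t" "\<Psi> \<in> clap_constraints \<tau> A B S t"
  shows "(\<lambda>x. \<Phi> x + \<epsilon> * (\<Phi> x - \<Psi> x)) \<in> clap_constraints \<tau> A B S t"
  using assms by (auto simp: clap_constraints_def split: prod.splits)

lemma clap_constraints_mono:
  "S \<subseteq> S' \<Longrightarrow> clap_constraints \<tau> A B S t \<subseteq> clap_constraints \<tau> A B S' t"
  by (fastforce simp: clap_constraints_def split: prod.splits)

text \<open>Allowing more tuples only relaxes the constraints, so what is feasible relative to
  \<open>T\<close> stays feasible relative to every larger set. Removals never reach
  \<open>T\<close>, and they stop by finiteness.\<close>

lemma clap_result_above:
  assumes fin: "finite (clap_init \<tau> A B)" and T: "T \<subseteq> clap_init \<tau> A B"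
    and stable: "\<And>t. t \<in> T \<Longrightarrow> blp 1 \<tau> A B \<inter> clap_constraints \<tau> A B T t \<noteq> {}"
  obtains S where "clap_result \<tau> A B S" "T \<subseteq> S" "S \<subseteq> clap_init \<tau> A B"
proof -
  have "\<exists>S'. (clap_remove \<tau> A B)\<^sup>*\<^sup>* S S' \<and> (\<nexists>S''. clap_remove \<tau> A B S' S'') \<and> T \<subseteq> S' \<and> S' \<subseteq> S"
    if "finite S" "T \<subseteq> S" for S
    using that
  proof (induction "card S" arbitrary: S rule: less_induct)
    case less
    show ?case
    proof (cases "\<exists>S'. clap_remove \<tau> A B S S'")
      case True
      then obtain t S' where t: "t \<in> S" "blp 1 \<tau> A B \<inter> clap_constraints \<tau> A B S t = {}"
        and S': "S' = S - {t}" "clap_remove \<tau> A B S S'" unfolding clap_remove_def by blast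
      have "t \<notin> T" using stable [of t] t(2) clap_constraints_mono [OF less.prems(2), of \<tau> A B t] by blast
      moreover have "card S' < card S" using t S' less.prems by (metis card_Diff1_less)
      ultimately obtain S'' where "(clap_remove \<tau> A B)\<^sup>*\<^sup>* S' S''" "\<nexists>S'. clap_remove \<tau> A B S'' S'"
        "T \<subseteq> S''" "S'' \<subseteq> S'"
        using less.hyps [of S'] less.prems S' by blast
      then show ?thesis using S' by (meson Diff_subset converse_rtranclp_into_rtranclp order_trans)
    next
      case False
      then show ?thesis using less.prems by blast
    qed
  qed
  from this [OF fin T] show thesis using that unfolding clap_result_def by blast
qed

text \<open>Conditioning the weights on the map that a tuple of their support induces shows that CLAP never
  removes this tuple. The hypothesis on \<open>(R0, b0, a0)\<close> makes one run of \<open>BA\<^sup>1\<close> harmless: both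
  families already satisfy the constraint that this run adds.\<close>

lemma clap_accepts_weights:
  fixes w v :: "'b set \<Rightarrow> ('b \<Rightarrow> 'a) \<Rightarrow> int"
  assumes B: "fin_struct \<tau> B" and fin: "finite (univ A)" "finite (symbols \<tau>)"
      "\<And>R. R \<in> symbols \<tau> \<Longrightarrow> finite (rel A R)"
    and w: "weights K (univ B) (univ A) c w" "0 < c" "\<And>X f. 0 \<le> w X f" "supported \<tau> A B w"
    and v: "weights K (univ B) (univ A) d v" "0 < d" "\<And>X f. 0 \<le> v X f" "supported \<tau> A B v"
    and cd: "coprime c d" and M: "\<And>R. R \<in> symbols \<tau> \<Longrightarrow> ar \<tau> R \<le> M" "1 \<le> M" "2 * M \<le> K"
    and t0: "clap_init \<tau> A B \<noteq> {} \<Longrightarrow> (R0, b0, a0) \<in> clap_init \<tau> A B \<and>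
      lsys_point A w (Mu R0 b0 a0) = c \<and> lsys_point A v (Mu R0 b0 a0) = d"
  shows "clap_accepts \<tau> A B"
proof -
  have finB: "finite (univ B)" using B by (simp add: fin_struct_def)
  define T where "T = {(R, b, a). (R, b, a) \<in> clap_init \<tau> A B \<and>
    (lsys_point A w (Mu R b a) \<noteq> 0 \<or> lsys_point A v (Mu R b a) \<noteq> 0)}"
  have Tsub: "T \<subseteq> clap_init \<tau> A B" by (auto simp: T_def)
  have K: "1 \<le> K" "\<And>R. R \<in> symbols \<tau> \<Longrightarrow> ar \<tau> R \<le> K" using M by fastforce+
  have scope: "set b \<subseteq> univ B" "card (set b) \<le> M" if "R \<in> symbols \<tau>" "b \<in> rel B R" for R b
    using B that M(1) [OF that(1)] card_length [of b] by (fastforce simp: fin_struct_def)+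
  have init: "finite (clap_init \<tau> A B)"
  proof -
    have "(\<lambda>(R, b, a). Mu R b a) ` clap_init \<tau> A B \<subseteq> lvars 1 \<tau> A B"
      by (auto simp: clap_init_def lvars_def)
    moreover have "inj_on (\<lambda>(R, b, a). Mu R b a) (clap_init \<tau> A B)" by (auto simp: inj_on_def)
    ultimately show ?thesis using finite_lvars [OF B fin] by (meson finite_imageD finite_subset)
  qed
  have in_constraints: "lsys_point A (\<lambda>X f. of_int (u X f) / of_int e) \<in> clap_constraints \<tau> A B S (R, b, a)"
    if "lsys_point A u (Mu R b a) = e" "e \<noteq> 0" "T \<subseteq> S"
      "\<And>R b a. (R, b, a) \<in> clap_init \<tau> A B \<Longrightarrow> lsys_point A u (Mu R b a) \<noteq> 0 \<Longrightarrow> (R, b, a) \<in> T"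
    for e R b a S and u :: "'b set \<Rightarrow> ('b \<Rightarrow> 'a) \<Rightarrow> int"
    using that unfolding clap_constraints_def by (fastforce simp: lsys_point_of_int simp del: lsys_point_simps)
  have cond: "blp 1 \<tau> A B \<inter> clap_constraints \<tau> A B T (R, b, a) \<noteq> {}"
    if u: "weights K (univ B) (univ A) e u" "\<And>X f. 0 \<le> u X f" "supported \<tau> A B u"
      and uT: "\<And>R b a. (R, b, a) \<in> clap_init \<tau> A B \<Longrightarrow> lsys_point A u (Mu R b a) \<noteq> 0 \<Longrightarrow> (R, b, a) \<in> T"
      and t: "(R, b, a) \<in> clap_init \<tau> A B" "lsys_point A u (Mu R b a) \<noteq> 0"
    for e R b a and u :: "'b set \<Rightarrow> ('b \<Rightarrow> 'a) \<Rightarrow> int"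
  proof -
    have R: "R \<in> symbols \<tau>" and b: "b \<in> rel B R" using t by (auto simp: clap_init_def)
    let ?C = "set b"
    have "\<exists>f\<in>{f \<in> ?C \<rightarrow>\<^sub>E univ A. map f b = a}. u ?C f \<noteq> 0"
      using t(2) unfolding lsys_point_simps by (meson sum.neutral)
    then obtain f where f: "f \<in> ?C \<rightarrow>\<^sub>E univ A" "map f b = a" "u ?C f \<noteq> 0" by blast
    have uniq: "{g \<in> ?C \<rightarrow>\<^sub>E univ A. map g b = a} = {f}"
    proof (intro equalityI subsetI)
      fix g assume g: "g \<in> {g \<in> ?C \<rightarrow>\<^sub>E univ A. map g b = a}"
      then have "g \<in> ?C \<rightarrow>\<^sub>E univ A" "\<And>x. x \<in> ?C \<Longrightarrow> g x = f x" using f(2) by auto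
      then have "g = f" using f(1) by (blast intro: PiE_ext)
      then show "g \<in> {f}" by simp
    qed (use f in auto)
    \<comment> \<open>Conditioning on a scope of at most \<open>M\<close> elements leaves width
      \<open>M\<close> for reading any other scope; this is where \<open>2 * M \<le> K\<close> is
      spent.\<close>
    define u' where "u' X h = (\<Sum>g\<in>{g \<in> X \<union> ?C \<rightarrow>\<^sub>E univ A. restrict g X = h \<and> restrict g ?C = f}. u (X \<union> ?C) g)" for X h
    have u'w: "weights M (univ B) (univ A) (u ?C f) u'"
      unfolding u'_def using scope [OF R b] M(3) f
      by (intro weights_condition [OF finB fin(1) u(1)]) auto
    have nn: "0 \<le> u' X h" for X h unfolding u'_def using u(2) by (simp add: sum_nonneg)
    have supp: "u (set b') h \<noteq> 0" if b': "R' \<in> symbols \<tau>" "b' \<in> rel B R'" and h: "u' (set b') h \<noteq> 0" for R' b' h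
    proof -
      obtain g where g: "g \<in> set b' \<union> ?C \<rightarrow>\<^sub>E univ A" "restrict g (set b') = h" "u (set b' \<union> ?C) g \<noteq> 0"
        using h unfolding u'_def by (smt (verit, best) mem_Collect_eq sum.neutral)
      have "card (set b' \<union> ?C) \<le> K"
        using card_Un_le [of "set b'" ?C] scope [OF R b] scope [OF b'] M by linarith
      then show ?thesis
        using weights_restrict_neq_0 [OF finB fin(1) u(1,2), of "set b' \<union> ?C" "set b'" g]
          g scope [OF R b] scope [OF b'] by auto
    qed
    have "supported \<tau> A B u'" using supp u(3) unfolding supported_def by blast
    then have blp: "lsys_point A (\<lambda>X h. of_int (u' X h) / of_int (u ?C f)) \<in> blp 1 \<tau> A B"
      using f(3) u(2) [of ?C f] M nn by (intro lsys_point_in_blp [OF B fin(1,3) u'w]) auto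
    have "u' ?C f = (\<Sum>g\<in>{f}. u ?C g)"
      unfolding u'_def by (rule sum.cong) (use f(1) in \<open>auto simp: PiE_restrict\<close>)
    then have one: "lsys_point A u' (Mu R b a) = u ?C f" using uniq by simp
    \<comment> \<open>Conditioning creates no new support, so tuples outside \<open>T\<close> keep
      weight 0.\<close>
    have "(R', b', a') \<in> T" if "(R', b', a') \<in> clap_init \<tau> A B" "lsys_point A u' (Mu R' b' a') \<noteq> 0" for R' b' a'
    proof (rule uT [OF that(1)])
      have R': "R' \<in> symbols \<tau>" "b' \<in> rel B R'" using that by (auto simp: clap_init_def)
      have "\<exists>h\<in>{f \<in> set b' \<rightarrow>\<^sub>E univ A. map f b' = a'}. u' (set b') h \<noteq> 0"
        using that(2) unfolding lsys_point_simps by (meson sum.neutral)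
      then have "\<exists>h\<in>{f \<in> set b' \<rightarrow>\<^sub>E univ A. map f b' = a'}. u (set b') h \<noteq> 0"
        using supp [OF R'] by blast
      moreover have "finite {f \<in> set b' \<rightarrow>\<^sub>E univ A. map f b' = a'}" 
        using fin(1) by (auto intro!: finite_subset [OF _ finite_PiE [of "set b'" "\<lambda>_. univ A"]])
      ultimately show "lsys_point A u (Mu R' b' a') \<noteq> 0"
        unfolding lsys_point_simps using u(2) by (subst sum_nonneg_eq_0_iff) auto
    qed
    then show ?thesis
      using in_constraints [OF one f(3) order_refl] blp by blast
  qed
  have wT: "(R, b, a) \<in> T" if "(R, b, a) \<in> clap_init \<tau> A B" "lsys_point A w (Mu R b a) \<noteq> 0" for R b a
    using that by (simp add: T_def)
  have vT: "(R, b, a) \<in> T" if "(R, b, a) \<in> clap_init \<tau> A B" "lsys_point A v (Mu R b a) \<noteq> 0" for R b a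
    using that by (simp add: T_def)
  obtain S where S: "clap_result \<tau> A B S" "T \<subseteq> S" "S \<subseteq> clap_init \<tau> A B"
  proof (rule clap_result_above [OF init Tsub])
    show "blp 1 \<tau> A B \<inter> clap_constraints \<tau> A B T t \<noteq> {}" if "t \<in> T" for t
    proof -
      obtain R b a where t: "t = (R, b, a)" by (cases t)
      with that have "(R, b, a) \<in> clap_init \<tau> A B" "lsys_point A w (Mu R b a) \<noteq> 0 \<or> lsys_point A v (Mu R b a) \<noteq> 0"
        by (auto simp: T_def)
      then show ?thesis using cond [OF w(1,3,4) wT] cond [OF v(1,3,4) vT] t by blast
    qed
  qed
  have "\<exists>a. (R, b, a) \<in> S" if Rb: "R \<in> symbols \<tau>" "b \<in> rel B R" for R b
  proof -
    have "w {} (\<lambda>_. undefined) = c"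
      using weightsD(1) [OF w(1), of "{}"] by simp
    then obtain f where f: "f \<in> set b \<rightarrow>\<^sub>E univ A" "w (set b) f \<noteq> 0"
      using weights_extend_neq_0 [OF w(1), of "set b" "{}" "\<lambda>_. undefined"] w(2) scope [OF Rb] M
      by auto
    have "w (set b) f \<le> lsys_point A w (Mu R b (map f b))"
      unfolding lsys_point_simps by (rule member_le_sum) (use f w(3) fin(1) in
          \<open>auto intro!: finite_subset [OF _ finite_PiE [of "set b" "\<lambda>_. univ A"]]\<close>)
    then have "lsys_point A w (Mu R b (map f b)) \<noteq> 0" using f(2) w(3) [of "set b" f] by linarith
    moreover have "map f b \<in> rel A R" using w(4) f Rb unfolding supported_def by blast
    ultimately have "(R, b, map f b) \<in> T" using Rb by (auto simp: T_def clap_init_def)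
    then show ?thesis using S by blast
  qed
  moreover have "S = {} \<or> (\<exists>t\<in>S. ba_accepts_with (clap_constraints \<tau> A B S t) 1 \<tau> A B)"
  proof (cases "clap_init \<tau> A B = {}")
    case True
    then show ?thesis using S by blast
  next
    case False
    note t0 = t0 [OF False]
    then have tT: "(R0, b0, a0) \<in> T" using w(2) by (auto simp: T_def)
    have "ba_accepts_with (clap_constraints \<tau> A B S (R0, b0, a0)) 1 \<tau> A B"
      using in_constraints [OF _ _ S(2) wT] in_constraints [OF _ _ S(2) vT] t0 w(2) v(2)
      by (intro ba_accepts_weights [OF B fin w v cd K] clap_constraints_affine) auto
    then show ?thesis using tT S by blast
  qed
  ultimately show ?thesis unfolding clap_accepts_def using S(1) by blast
qed

section \<open>Templates that are affine over an Abelian group\<close>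

lemma weights_delta:
  assumes fin: "finite V" "finite A" and h: "h \<in> V \<rightarrow> A"
  shows "weights K V A (1::int) (\<lambda>X f. if f = restrict h X then 1 else 0)"
proof -
  have "(\<Sum>f\<in>{f \<in> X \<rightarrow>\<^sub>E A. restrict f Y = g}. if f = restrict h X then 1 else (0::int))
      = (if g = restrict h Y then 1 else 0)"
    if "X \<subseteq> V" "Y \<subseteq> X" for X Y g
  proof -
    have "finite (X \<rightarrow>\<^sub>E A)" using that fin finite_subset by (blast intro: finite_PiE)
    then have "finite {f \<in> X \<rightarrow>\<^sub>E A. restrict f Y = g}" by simp
    moreover have "restrict h X \<in> X \<rightarrow>\<^sub>E A" using that h by auto
    moreover have "restrict (restrict h X) Y = restrict h Y" using that by (simp add: Int_absorb1)
    ultimately show ?thesis by (auto simp: sum.delta)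
  qed
  note marg = this
  show ?thesis
  proof (rule weights_from_steps [OF fin])
    show "(if (\<lambda>_. undefined) = restrict h {} then 1 else (0::int)) = 1" by (simp add: restrict_def)
  qed (rule marg, auto)
qed

lemma ar_le_arity: "finite (symbols \<tau>) \<Longrightarrow> R \<in> symbols \<tau> \<Longrightarrow> ar \<tau> R \<le> arity \<tau>"
  unfolding arity_def by (intro Max_ge) auto

text \<open>The point mass at \<open>h\<close> plays the role of both families, its total 1 being
  coprime to itself.\<close>

lemma accepts_if_hom:
  fixes A :: "('a, 'r) rel_struct" and B :: "('b, 'r) rel_struct"
  assumes B: "fin_struct \<tau> B" and fin: "finite (univ A)" "finite (symbols \<tau>)"
      "\<And>R. R \<in> symbols \<tau> \<Longrightarrow> finite (rel A R)"
    and h: "h \<in> homs \<tau> B A"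
  shows "accepts alg k \<tau> A B"
proof -
  have finB: "finite (univ B)" using B by (simp add: fin_struct_def)
   define w :: "'b set \<Rightarrow> ('b \<Rightarrow> 'a) \<Rightarrow> int" where "w X f = (if f = restrict h X then 1 else 0)" for X f
  have w: "weights K (univ B) (univ A) 1 w" for K
    unfolding w_def using finB fin(1) h by (intro weights_delta) (auto simp: homs_def)
  have nn: "0 \<le> w X f" for X f by (simp add: w_def)
  have sup: "supported \<tau> A B w"
    unfolding supported_def w_def using h by (auto simp: homs_def cong: map_cong)
  \<comment> \<open>\<open>Suc\<close> makes the bound positive even if all relations are nullary,
    as \<open>clap_accepts_weights\<close> requires.\<close>
  let ?M = "Suc (arity \<tau>)"
  have M: "ar \<tau> R \<le> ?M" "ar \<tau> R \<le> k + 2 * ?M" if "R \<in> symbols \<tau>" for R k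
    using ar_le_arity [OF fin(2) that] by auto
  have ba: "ba_accepts k \<tau> A B" for k
    unfolding ba_accepts_def
    by (rule ba_accepts_weights [OF B fin w [of "k + 2 * ?M"] _ nn sup w [of "k + 2 * ?M"] _ nn sup])
      (use M in auto)
  have z: "z_affine_accepts k \<tau> A B"
    by (rule z_affine_accepts_weights [OF B fin(1) w nn sup w nn sup]) auto
  have cl: "clap_accepts \<tau> A B"
  proof (cases "clap_init \<tau> A B = {}")
    case True
    show ?thesis
      by (rule clap_accepts_weights [OF B fin w [of "2 * ?M"] _ nn sup w [of "2 * ?M"] _ nn sup])
        (use M True in auto)
  next
    case False
    then obtain R b where Rb: "R \<in> symbols \<tau>" "b \<in> rel B R" by (auto simp: clap_init_def)
    \<comment> \<open>The point mass puts all its weight on the image of \<open>b\<close>, so any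
      constraint can provide the accepting run.\<close>
    let ?a = "map h b"
    have sb: "set b \<subseteq> univ B" using B Rb by (auto simp: fin_struct_def)
    have a: "(R, b, ?a) \<in> clap_init \<tau> A B" using Rb h by (auto simp: clap_init_def homs_def)
    have "{f \<in> set b \<rightarrow>\<^sub>E univ A. map f b = ?a} = {restrict h (set b)}"
    proof (intro equalityI subsetI)
      fix f assume "f \<in> {f \<in> set b \<rightarrow>\<^sub>E univ A. map f b = ?a}"
      then show "f \<in> {restrict h (set b)}"
        by (auto simp: fun_eq_iff PiE_def extensional_def)
    qed (use sb h in \<open>auto simp: homs_def\<close>)
    then have "lsys_point A w (Mu R b ?a) = 1" by (simp add: w_def)
    then show ?thesis using a
      by (intro clap_accepts_weights [OF B fin w [of "2 * ?M"] _ nn sup w [of "2 * ?M"] _ nn sup, where M = ?M])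
        (use M in auto)
  qed
  show ?thesis using ba z cl by (cases alg) auto
qed

text \<open>Over an Abelian \<open>H\<close> these are the cosets of subgroups of the
  \<open>r\<close>-th power. The form x - y + z mentions no subgroup, so it can be verified for
  another operation than the one in which the coset was given.\<close>

definition affine_rel :: "('a, 'm) monoid_scheme \<Rightarrow> nat \<Rightarrow> 'a list set \<Rightarrow> bool" where
  "affine_rel H r T \<longleftrightarrow> T \<noteq> {} \<and> T \<subseteq> {a. length a = r \<and> set a \<subseteq> carrier H} \<and>
     (\<forall>a\<in>T. \<forall>b\<in>T. \<forall>c\<in>T. map (\<lambda>i. a ! i \<otimes>\<^bsub>H\<^esub> inv\<^bsub>H\<^esub> (b ! i) \<otimes>\<^bsub>H\<^esub> c ! i) [0..<r] \<in> T)"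

context comm_group
begin

text \<open>Summation over fibres, for products of powers. It turns marginal equations between
  coefficients into equalities between combinations of group elements.\<close>

lemma finprod_fibres:
  fixes z :: "'c \<Rightarrow> int"
  assumes "finite F" "finite C" and \<phi>: "\<phi> \<in> F \<rightarrow> C" and \<psi>: "\<psi> \<in> C \<rightarrow> carrier G"
  shows "(\<Otimes>x\<in>F. \<psi> (\<phi> x) [^] z x) = (\<Otimes>c\<in>C. \<psi> c [^] (\<Sum>x\<in>{x \<in> F. \<phi> x = c}. z x))"
  using assms(1) \<phi>
proof (induction F rule: finite_induct)
  case empty
  have "(\<Otimes>c\<in>C. \<psi> c [^] (0::int)) = \<one>"
    by (rule finprod_one_eqI) (use \<psi> in auto)
  then show ?case by simp
next
  case (insert x F)
  have car: "\<psi> c \<in> carrier G" if "c \<in> C" for c using \<psi> that by auto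
  have \<phi>x: "\<phi> x \<in> C" and \<phi>F: "\<phi> \<in> F \<rightarrow> C" using insert.prems by auto
  have "(\<Otimes>c\<in>C. \<psi> c [^] (\<Sum>y\<in>{y \<in> insert x F. \<phi> y = c}. z y))
      = (\<Otimes>c\<in>C. (if \<phi> x = c then \<psi> c [^] z x else \<one>) \<otimes> \<psi> c [^] (\<Sum>y\<in>{y \<in> F. \<phi> y = c}. z y))"
  proof (rule finprod_cong')
    fix c assume c: "c \<in> C"
    have "{y \<in> insert x F. \<phi> y = c} = (if \<phi> x = c then insert x {y \<in> F. \<phi> y = c} else {y \<in> F. \<phi> y = c})"
      by auto
    then show "\<psi> c [^] (\<Sum>y\<in>{y \<in> insert x F. \<phi> y = c}. z y)
        = (if \<phi> x = c then \<psi> c [^] z x else \<one>) \<otimes> \<psi> c [^] (\<Sum>y\<in>{y \<in> F. \<phi> y = c}. z y)"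
      using insert.hyps car [OF c] by (simp add: int_pow_mult)
  qed (use car in auto)
  also have "\<dots> = (\<Otimes>c\<in>C. if \<phi> x = c then \<psi> c [^] z x else \<one>) \<otimes> (\<Otimes>c\<in>C. \<psi> c [^] (\<Sum>y\<in>{y \<in> F. \<phi> y = c}. z y))"
    by (rule finprod_multf) (use car in auto)
  also have "(\<Otimes>c\<in>C. if \<phi> x = c then \<psi> c [^] z x else \<one>) = \<psi> (\<phi> x) [^] z x"
    by (rule finprod_singleton) (use assms(2) car \<phi>x in auto)
  also have "\<dots> \<otimes> (\<Otimes>c\<in>C. \<psi> c [^] (\<Sum>y\<in>{y \<in> F. \<phi> y = c}. z y)) = (\<Otimes>y\<in>insert x F. \<psi> (\<phi> y) [^] z y)"
    using insert.hyps insert.IH [OF \<phi>F] car \<phi>x \<phi>F by (subst finprod_insert) auto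
  finally show ?case ..
qed

text \<open>The differences to a base point \<open>o'\<close> form a subgroup, which contains all
  their integral combinations. Coefficients of sum 1 restore exactly one copy of
  \<open>o'\<close>.\<close>

lemma affine_rel_combination:
  fixes z :: "'c \<Rightarrow> int"
  assumes T: "affine_rel G r T" and F: "finite F" "g \<in> F \<rightarrow> T" and z: "(\<Sum>x\<in>F. z x) = 1"
  shows "map (\<lambda>i. \<Otimes>x\<in>F. (g x ! i) [^] z x) [0..<r] \<in> T"
proof -
  obtain o' where o': "o' \<in> T" using T by (auto simp: affine_rel_def)
  have len: "length a = r" and sub: "set a \<subseteq> carrier G" if "a \<in> T" for a
    using T that unfolding affine_rel_def by blast+
  have car: "a ! i \<in> carrier G" if "a \<in> T" "i < r" for a i
    using len [OF that(1)] sub [OF that(1)] that(2) by auto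
  note oc = car [OF o']
  have closed: "map (\<lambda>i. a ! i \<otimes> inv (b ! i) \<otimes> c ! i) [0..<r] \<in> T" if "a \<in> T" "b \<in> T" "c \<in> T" for a b c
    using T that unfolding affine_rel_def by blast
  define D where "D v \<longleftrightarrow> v \<in> {..<r} \<rightarrow> carrier G \<and> map (\<lambda>i. v i \<otimes> o' ! i) [0..<r] \<in> T" for v
  have Dcar: "v i \<in> carrier G" if "D v" "i < r" for v i using that by (auto simp: D_def)
  have Dcong: "D v" if "D u" "\<And>i. i < r \<Longrightarrow> u i = v i" for u v
  proof -
    have "map (\<lambda>i. v i \<otimes> o' ! i) [0..<r] = map (\<lambda>i. u i \<otimes> o' ! i) [0..<r]" using that(2) by auto
    moreover have "v \<in> {..<r} \<rightarrow> carrier G" using that Dcar [OF that(1)] by (intro Pi_I) (metis lessThan_iff)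
    ultimately show ?thesis using that(1) unfolding D_def by (simp del: map_eq_conv)
  qed
  have one: "D (\<lambda>_. \<one>)"
  proof -
    have "map (\<lambda>i. \<one> \<otimes> o' ! i) [0..<r] = o'" using len [OF o'] oc by (auto intro!: nth_equalityI)
    then show ?thesis using o' by (simp add: D_def)
  qed
  have mult: "D (\<lambda>i. u i \<otimes> v i)" if "D u" "D v" for u v
  proof -
    have "map (\<lambda>i. map (\<lambda>i. u i \<otimes> o' ! i) [0..<r] ! i \<otimes> inv (o' ! i) \<otimes> map (\<lambda>i. v i \<otimes> o' ! i) [0..<r] ! i) [0..<r] \<in> T"
      using that o' by (intro closed) (auto simp: D_def)
    also have "map (\<lambda>i. map (\<lambda>i. u i \<otimes> o' ! i) [0..<r] ! i \<otimes> inv (o' ! i) \<otimes> map (\<lambda>i. v i \<otimes> o' ! i) [0..<r] ! i) [0..<r]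
        = map (\<lambda>i. u i \<otimes> v i \<otimes> o' ! i) [0..<r]"
      using Dcar [OF that(1)] Dcar [OF that(2)] oc by (auto simp: m_assoc)
    finally show ?thesis using Dcar [OF that(1)] Dcar [OF that(2)] by (auto simp: D_def)
  qed
  have inv: "D (\<lambda>i. inv (u i))" if "D u" for u
  proof -
    have "map (\<lambda>i. o' ! i \<otimes> inv (map (\<lambda>i. u i \<otimes> o' ! i) [0..<r] ! i) \<otimes> o' ! i) [0..<r] \<in> T"
      using that o' by (intro closed) (auto simp: D_def)
    also have "map (\<lambda>i. o' ! i \<otimes> inv (map (\<lambda>i. u i \<otimes> o' ! i) [0..<r] ! i) \<otimes> o' ! i) [0..<r]
        = map (\<lambda>i. inv (u i) \<otimes> o' ! i) [0..<r]"
      using Dcar [OF that] oc by (auto simp: inv_mult_group m_assoc [symmetric])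
    finally show ?thesis using Dcar [OF that] by (auto simp: D_def)
  qed
  have npow: "D (\<lambda>i. u i [^] n)" if "D u" for u and n :: nat
    using one mult that by (induction n) auto
  have ipow: "D (\<lambda>i. u i [^] n)" if "D u" for u and n :: int
  proof (cases "n < 0")
    case True
    have "D (\<lambda>i. inv (u i [^] nat (- n)))" by (intro inv npow that)
    with True show ?thesis by (simp only: int_pow_def2 if_True)
  next
    case False
    have "D (\<lambda>i. u i [^] nat n)" by (intro npow that)
    with False show ?thesis by (simp only: int_pow_def2 if_False)
  qed
  have diff: "D (\<lambda>i. g x ! i \<otimes> inv (o' ! i))" if "x \<in> F" for x
  proof -
    have gx: "g x \<in> T" using F that by blast
    have "map (\<lambda>i. g x ! i \<otimes> inv (o' ! i) \<otimes> o' ! i) [0..<r] = g x"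
      using len [OF gx] car [OF gx] oc by (auto intro!: nth_equalityI simp: m_assoc)
    then show ?thesis using gx car [OF gx] oc by (auto simp: D_def)
  qed
  have "D (\<lambda>i. \<Otimes>x\<in>F'. (g x ! i \<otimes> inv (o' ! i)) [^] z x)" if "F' \<subseteq> F" for F'
  proof -
    have "finite F'" using that F finite_subset by blast
    then show ?thesis using that
    proof (induction F' rule: finite_induct)
      case (insert x F')
      have "D (\<lambda>i. (g x ! i \<otimes> inv (o' ! i)) [^] z x \<otimes> (\<Otimes>x\<in>F'. (g x ! i \<otimes> inv (o' ! i)) [^] z x))"
        using insert by (intro mult ipow diff) auto
      moreover have "(g x ! i \<otimes> inv (o' ! i)) [^] z x \<otimes> (\<Otimes>x\<in>F'. (g x ! i \<otimes> inv (o' ! i)) [^] z x)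
          = (\<Otimes>x\<in>insert x F'. (g x ! i \<otimes> inv (o' ! i)) [^] z x)" if i: "i < r" for i
      proof (rule finprod_insert [symmetric])
        show "(\<lambda>x. (g x ! i \<otimes> inv (o' ! i)) [^] z x) \<in> F' \<rightarrow> carrier G"
          using Dcar [OF diff i] insert by blast
        show "(g x ! i \<otimes> inv (o' ! i)) [^] z x \<in> carrier G"
          using Dcar [OF diff i] insert by blast
      qed (use insert in auto)
      ultimately show ?case by (rule Dcong)
    qed (use one in simp)
  qed
  then have D: "D (\<lambda>i. \<Otimes>x\<in>F. (g x ! i \<otimes> inv (o' ! i)) [^] z x)" by blast
  have "(\<Otimes>x\<in>F. (g x ! i \<otimes> inv (o' ! i)) [^] z x) \<otimes> o' ! i = (\<Otimes>x\<in>F. (g x ! i) [^] z x)" if i: "i < r" for i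
  proof -
    have gc: "g x ! i \<in> carrier G" if "x \<in> F" for x using F that car i by blast
    have "(\<Otimes>x\<in>F. (g x ! i \<otimes> inv (o' ! i)) [^] z x) = (\<Otimes>x\<in>F. (g x ! i) [^] z x \<otimes> inv (o' ! i) [^] z x)"
      by (rule finprod_cong') (use gc oc [OF i] in \<open>auto simp: int_pow_mult_distrib m_comm\<close>)
    also have "\<dots> = (\<Otimes>x\<in>F. (g x ! i) [^] z x) \<otimes> (\<Otimes>x\<in>F. inv (o' ! i) [^] z x)"
      by (rule finprod_multf) (use gc oc [OF i] in auto)
    \<comment> \<open>Fibres over a one-point set: this adds up the exponents of a constant
      base.\<close>
    also have "(\<Otimes>x\<in>F. inv (o' ! i) [^] z x) = (\<Otimes>c\<in>{()}. inv (o' ! i) [^] (\<Sum>x\<in>{x \<in> F. () = c}. z x))"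
      using finprod_fibres [of F "{()}" "\<lambda>_. ()" "\<lambda>_. inv (o' ! i)" z] F(1) oc [OF i] by simp
    also have "\<dots> = inv (o' ! i)" using z oc [OF i] by simp
    finally show ?thesis using gc oc [OF i] by (simp add: m_assoc)
  qed
  then have "map (\<lambda>i. (\<Otimes>x\<in>F. (g x ! i \<otimes> inv (o' ! i)) [^] z x) \<otimes> o' ! i) [0..<r]
      = map (\<lambda>i. \<Otimes>x\<in>F. (g x ! i) [^] z x) [0..<r]" by simp
  then show ?thesis using D by (simp add: D_def del: map_eq_conv)
qed

end

section \<open>Rounding integral solutions to homomorphisms\<close>

lemma lsys_Mu:
  assumes "\<Phi> \<in> lsys k \<tau> A B" "R \<in> symbols \<tau>" "b \<in> rel B R" "length i = k" "set i \<subseteq> {..<ar \<tau> R}"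
    and "f \<in> set (proj i b) \<rightarrow>\<^sub>E univ A"
  shows "(\<Sum>a\<in>{a \<in> rel A R. proj i a = map f (proj i b)}. \<Phi> (Mu R b a)) = \<Phi> (Lam (set (proj i b)) f)"
proof -
  have "map f (proj i b) \<in> {a'. length a' = k \<and> set a' \<subseteq> univ A}"
    using assms(4,6) by (auto simp: proj_def)
  moreover have "i \<in> {i. length i = k \<and> set i \<subseteq> {..<ar \<tau> R}}" using assms(4,5) by simp
  moreover have "\<forall>R\<in>symbols \<tau>. \<forall>b\<in>rel B R.
      \<forall>a'\<in>{a'. length a' = k \<and> set a' \<subseteq> univ A}. \<forall>i\<in>{i. length i = k \<and> set i \<subseteq> {..<ar \<tau> R}}.
      \<forall>f\<in>set (proj i b) \<rightarrow>\<^sub>E univ A. map f (proj i b) = a' \<longrightarrow>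
        (\<Sum>a\<in>{a \<in> rel A R. proj i a = a'}. \<Phi> (Mu R b a)) = \<Phi> (Lam (set (proj i b)) f)"
    using assms(1) unfolding lsys_def mem_Collect_eq by (elim conjE)
  ultimately show ?thesis using assms(2,3,6) by simp
qed

text \<open>On a constraint, the coefficients \<open>Mu\<close> sum to 1 and so combine whole tuples
  to a tuple of the relation. The unary marginals identify its entries with the values of
  \<open>h\<close>.\<close>

lemma hom_if_aip:
  assumes H: "comm_group H" "carrier H = univ A" and fin: "finite (univ A)"
    and aff: "\<And>R. R \<in> symbols \<tau> \<Longrightarrow> affine_rel H (ar \<tau> R) (rel A R)"
    and B: "fin_struct \<tau> B" and k: "1 \<le> k" and \<Psi>: "\<Psi> \<in> aip k \<tau> A B"
  shows "homs \<tau> B A \<noteq> {}"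
proof -
  interpret comm_group H by (rule H)
  define h where "h v = (\<Otimes>\<^bsub>H\<^esub>c\<in>univ A. c [^]\<^bsub>H\<^esub> \<Psi> (Lam {v} (\<lambda>_\<in>{v}. c)))" for v
  have hA: "h v \<in> univ A" for v
    unfolding h_def using H by (subst H(2) [symmetric], intro finprod_closed) auto
  have marg: "(\<Sum>a\<in>{a \<in> rel A R. a ! i = c}. \<Psi> (Mu R b a)) = \<Psi> (Lam {b ! i} (\<lambda>_\<in>{b ! i}. c))"
    if R: "R \<in> symbols \<tau>" "b \<in> rel B R" and i: "i < ar \<tau> R" and c: "c \<in> univ A" for R b i c
  proof -
    \<comment> \<open>Repeating one position \<open>k\<close> times extracts the unary marginals
      from the system of width \<open>k\<close>.\<close>
    let ?f = "\<lambda>_\<in>{b ! i}. c" and ?i = "replicate k i"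
    have p: "proj ?i x = replicate k (x ! i)" for x :: "'x list" by (simp add: proj_def)
    have "(\<Sum>a\<in>{a \<in> rel A R. proj ?i a = replicate k c}. \<Psi> (Mu R b a)) = \<Psi> (Lam (set (proj ?i b)) ?f)"
      using lsys_Mu [OF \<Psi> [unfolded aip_def] R, of ?i ?f] i c k by (simp add: p)
    then show ?thesis using k by (simp add: p)
  qed
  have one: "(\<Sum>c\<in>univ A. \<Psi> (Lam {v} (\<lambda>_\<in>{v}. c))) = 1" if "v \<in> univ B" for v
  proof -
    have "bij_betw (\<lambda>c. \<lambda>_\<in>{v}. c) (univ A) ({v} \<rightarrow>\<^sub>E univ A)"
      by (rule bij_betw_byWitness [where f' = "\<lambda>f. f v"]) (auto simp: fun_eq_iff PiE_def extensional_def)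
    then have "(\<Sum>c\<in>univ A. \<Psi> (Lam {v} (\<lambda>_\<in>{v}. c))) = (\<Sum>f\<in>{v} \<rightarrow>\<^sub>E univ A. \<Psi> (Lam {v} f))"
      by (rule sum.reindex_bij_betw)
    also have "\<dots> = 1"
      using \<Psi> that k unfolding aip_def lsys_def by (simp add: small_sets_def)
    finally show ?thesis .
  qed
  have "map h b \<in> rel A R" if R: "R \<in> symbols \<tau>" "b \<in> rel B R" for R b
  proof -
    let ?r = "ar \<tau> R" and ?T = "rel A R"
    have b: "length b = ?r" "set b \<subseteq> univ B" using B R by (auto simp: fin_struct_def)
    have aR: "affine_rel H ?r ?T" using aff R by blast
    have T: "length a = ?r" "set a \<subseteq> univ A" if "a \<in> ?T" for a
      using aR that H(2) unfolding affine_rel_def by blast+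
    have finT: "finite ?T"
      by (rule finite_subset [OF _ finite_lists_length_eq [OF fin, of ?r]]) (use T in auto)
    show ?thesis
    \<comment> \<open>A nullary constraint offers no position from which the sum of the
      \<open>Mu\<close> could be derived, but its relation must be \<open>{[]}\<close>.\<close>
    proof (cases "?r = 0")
      case True
      then have "?T \<subseteq> {[]}" using T by auto
      then have "?T = {[]}" using aR by (auto simp: affine_rel_def)
      then show ?thesis using b True by simp
    next
      case False
      have "(\<Sum>a\<in>?T. \<Psi> (Mu R b a)) = (\<Sum>c\<in>univ A. \<Sum>a\<in>{a \<in> ?T. a ! 0 = c}. \<Psi> (Mu R b a))"
        by (rule sum.group [symmetric]) (use finT fin T False in \<open>force+\<close>)
      also have "\<dots> = (\<Sum>c\<in>univ A. \<Psi> (Lam {b ! 0} (\<lambda>_\<in>{b ! 0}. c)))"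
        using marg [OF R] False by (intro sum.cong) auto
      also have "\<dots> = 1" using b False by (intro one) (metis in_mono length_greater_0_conv neq0_conv nth_mem)
      finally have "map (\<lambda>i. \<Otimes>\<^bsub>H\<^esub>a\<in>?T. (a ! i) [^]\<^bsub>H\<^esub> \<Psi> (Mu R b a)) [0..<?r] \<in> ?T"
        by (intro affine_rel_combination [OF aR finT, of "\<lambda>a. a"]) auto
      also have "map (\<lambda>i. \<Otimes>\<^bsub>H\<^esub>a\<in>?T. (a ! i) [^]\<^bsub>H\<^esub> \<Psi> (Mu R b a)) [0..<?r] = map h b"
      proof (rule nth_equalityI)
        fix i assume "i < length (map (\<lambda>i. \<Otimes>\<^bsub>H\<^esub>a\<in>?T. (a ! i) [^]\<^bsub>H\<^esub> \<Psi> (Mu R b a)) [0..<?r])"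
        then have i: "i < ?r" by simp
        have "(\<Otimes>\<^bsub>H\<^esub>a\<in>?T. (a ! i) [^]\<^bsub>H\<^esub> \<Psi> (Mu R b a))
            = (\<Otimes>\<^bsub>H\<^esub>c\<in>univ A. c [^]\<^bsub>H\<^esub> (\<Sum>a\<in>{a \<in> ?T. a ! i = c}. \<Psi> (Mu R b a)))"
          by (rule finprod_fibres [OF finT fin, of "\<lambda>a. a ! i" "\<lambda>c. c"]) (use T i H(2) in force)+
        also have "\<dots> = h (b ! i)"
          unfolding h_def H(2) [symmetric]
          using marg [OF R i, folded H(2)] by (intro finprod_cong') auto
        finally show "map (\<lambda>i. \<Otimes>\<^bsub>H\<^esub>a\<in>?T. (a ! i) [^]\<^bsub>H\<^esub> \<Psi> (Mu R b a)) [0..<?r] ! i = map h b ! i"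
          using i b by simp
      qed (use b in simp)
      finally show ?thesis .
    qed
  qed
  moreover have "map (restrict h (univ B)) b = map h b" if "R \<in> symbols \<tau>" "b \<in> rel B R" for R b
    using B that by (auto simp: fin_struct_def)
  ultimately have "restrict h (univ B) \<in> homs \<tau> B A" using hA by (simp add: homs_def del: map_eq_conv)
  then show ?thesis by blast
qed

text \<open>There are no variables \<open>Mu\<close> here. Since \<open>k\<close> bounds the
  arities, every scope is itself a small set; the maps in \<open>kappa\<close> on it are
  homomorphisms, so their images are tuples of the relation and their coefficients replace
  \<open>Mu\<close>.\<close>

lemma hom_if_z_affine:
  fixes A :: "('a, 'r) rel_struct" and B :: "('b, 'r) rel_struct"
  assumes H: "comm_group H" "carrier H = univ A" and fin: "finite (univ A)"
    and aff: "\<And>R. R \<in> symbols \<tau> \<Longrightarrow> affine_rel H (ar \<tau> R) (rel A R)"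
    and B: "fin_struct \<tau> B" and k: "1 \<le> k" "\<And>R. R \<in> symbols \<tau> \<Longrightarrow> ar \<tau> R \<le> k"
    and acc: "z_affine_accepts k \<tau> A B"
  shows "homs \<tau> B A \<noteq> {}"
proof -
  interpret comm_group H by (rule H)
  let ?\<kappa> = "kappa k \<tau> A B"
  obtain z :: "'b set \<Rightarrow> ('b \<Rightarrow> 'a) \<Rightarrow> int" where
    z: "(\<forall>X\<in>small_sets k B. (\<Sum>f\<in>?\<kappa> X. z X f) = 1) \<and>
      (\<forall>X\<in>small_sets k B. \<forall>Y. Y \<subset> X \<longrightarrow>
         (\<forall>g\<in>?\<kappa> Y. (\<Sum>f\<in>{f \<in> ?\<kappa> X. restrict f Y = g}. z X f) = z Y g))"
    using acc unfolding z_affine_accepts_def Let_def by (rule exE)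
  have z1: "(\<Sum>f\<in>?\<kappa> X. z X f) = 1" if "X \<in> small_sets k B" for X
    using conjunct1 [OF z] that by (rule bspec)
  have z2: "(\<Sum>f\<in>{f \<in> ?\<kappa> X. restrict f Y = g}. z X f) = z Y g"
    if "X \<in> small_sets k B" "Y \<subset> X" "g \<in> ?\<kappa> Y" for X Y g
    using bspec [OF spec [OF bspec [OF conjunct2 [OF z] that(1)], THEN mp, OF that(2)] that(3)] .
  have finB: "finite (univ B)" using B by (simp add: fin_struct_def)
  have \<kappa>: "?\<kappa> X \<subseteq> homs \<tau> (induced B X) A" if "X \<in> small_sets k B" for X
    using kappa_consistent [of k \<tau> A B] that unfolding k_consistent_family_def by blast
  then have \<kappa>E: "?\<kappa> X \<subseteq> X \<rightarrow>\<^sub>E univ A" if "X \<in> small_sets k B" for X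
    using that by (fastforce simp: homs_def induced_def)
  have fin\<kappa>: "finite (?\<kappa> X)" if "X \<in> small_sets k B" for X
  proof (rule finite_subset [OF \<kappa>E [OF that]])
    show "finite (X \<rightarrow>\<^sub>E univ A)"
      using that finB fin finite_subset unfolding small_sets_def by (blast intro: finite_PiE)
  qed
  have restr: "restrict f Y \<in> ?\<kappa> Y" if "X \<in> small_sets k B" "Y \<subset> X" "f \<in> ?\<kappa> X" for X Y f
    using kappa_consistent [of k \<tau> A B] that unfolding k_consistent_family_def by blast
  have sing: "{v} \<in> small_sets k B" if "v \<in> univ B" for v
    using that k by (simp add: small_sets_def)
  define h where "h v = (\<Otimes>\<^bsub>H\<^esub>f\<in>?\<kappa> {v}. f v [^]\<^bsub>H\<^esub> z {v} f)" for v
  have sv: "f v \<in> univ A" if "v \<in> univ B" "f \<in> ?\<kappa> {v}" for f v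
    using \<kappa>E [OF sing [OF that(1)]] that(2) by blast
  have hA: "h v \<in> univ A" if "v \<in> univ B" for v
    unfolding h_def using H sv [OF that] by (subst H(2) [symmetric], intro finprod_closed) auto
  have "map h b \<in> rel A R" if R: "R \<in> symbols \<tau>" "b \<in> rel B R" for R b
  proof -
    let ?r = "ar \<tau> R" and ?T = "rel A R" and ?X = "set b"
    have b: "length b = ?r" "set b \<subseteq> univ B" using B R by (auto simp: fin_struct_def)
    have X: "?X \<in> small_sets k B"
      using b k(2) [OF R(1)] card_length [of b] by (simp add: small_sets_def)
    have aR: "affine_rel H ?r ?T" using aff R by blast
    have mapT: "map f b \<in> ?T" if "f \<in> ?\<kappa> ?X" for f
      using \<kappa> [OF X] that R by (auto simp: homs_def induced_def)
    have "map (\<lambda>i. \<Otimes>\<^bsub>H\<^esub>f\<in>?\<kappa> ?X. (map f b ! i) [^]\<^bsub>H\<^esub> z ?X f) [0..<?r] \<in> ?T"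
      by (rule affine_rel_combination [OF aR fin\<kappa> [OF X] _ z1 [OF X]]) (use mapT in auto)
    also have "map (\<lambda>i. \<Otimes>\<^bsub>H\<^esub>f\<in>?\<kappa> ?X. (map f b ! i) [^]\<^bsub>H\<^esub> z ?X f) [0..<?r] = map h b"
    proof (rule nth_equalityI)
      fix i assume "i < length (map (\<lambda>i. \<Otimes>\<^bsub>H\<^esub>f\<in>?\<kappa> ?X. (map f b ! i) [^]\<^bsub>H\<^esub> z ?X f) [0..<?r])"
      then have i: "i < ?r" by simp
      let ?v = "b ! i"
      have v: "?v \<in> ?X" "?v \<in> univ B" using i b by (auto simp: subset_iff)
      have "(\<Otimes>\<^bsub>H\<^esub>f\<in>?\<kappa> ?X. f ?v [^]\<^bsub>H\<^esub> z ?X f) = h ?v"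
      \<comment> \<open>The equations only concern proper subsets, so a scope with a single element
        is treated apart.\<close>
      proof (cases "?X = {?v}")
        case True
        then show ?thesis unfolding h_def by (simp only:)
      next
        case False
        then have sub: "{?v} \<subset> ?X" using v by blast
        have "(\<Otimes>\<^bsub>H\<^esub>f\<in>?\<kappa> ?X. f ?v [^]\<^bsub>H\<^esub> z ?X f) = (\<Otimes>\<^bsub>H\<^esub>f\<in>?\<kappa> ?X. (restrict f {?v}) ?v [^]\<^bsub>H\<^esub> z ?X f)"
          by simp
        also have "\<dots> = (\<Otimes>\<^bsub>H\<^esub>g\<in>?\<kappa> {?v}. g ?v [^]\<^bsub>H\<^esub> (\<Sum>f\<in>{f \<in> ?\<kappa> ?X. restrict f {?v} = g}. z ?X f))"
          by (rule finprod_fibres [OF fin\<kappa> [OF X] fin\<kappa> [OF sing [OF v(2)]],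
                of "\<lambda>f. restrict f {?v}" "\<lambda>g. g ?v"])
            (use restr [OF X sub] sv [OF v(2)] H(2) in auto)
        also have "\<dots> = h ?v"
          unfolding h_def using z2 [OF X sub] sv [OF v(2), folded H(2)] by (intro finprod_cong') auto
        finally show ?thesis .
      qed
      then show "map (\<lambda>i. \<Otimes>\<^bsub>H\<^esub>f\<in>?\<kappa> ?X. (map f b ! i) [^]\<^bsub>H\<^esub> z ?X f) [0..<?r] ! i = map h b ! i"
        using i b by simp
    qed (use b in simp)
    finally show ?thesis .
  qed
  moreover have "map (restrict h (univ B)) b = map h b" if "R \<in> symbols \<tau>" "b \<in> rel B R" for R b
    using B that by (auto simp: fin_struct_def)
  ultimately have "restrict h (univ B) \<in> homs \<tau> B A" using hA by (simp add: homs_def del: map_eq_conv)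
  then show ?thesis by blast
qed

lemma hom_if_no_constraints:
  assumes "univ A \<noteq> {}" "\<And>R. R \<in> symbols \<tau> \<Longrightarrow> rel B R = {}"
  shows "homs \<tau> B A \<noteq> {}"
proof -
  obtain x where "x \<in> univ A" using assms by blast
  then have "(\<lambda>_\<in>univ B. x) \<in> homs \<tau> B A" using assms by (auto simp: homs_def)
  then show ?thesis by blast
qed

lemma solves_affine:
  fixes A :: "('a, 'r) rel_struct"
  assumes H: "comm_group H" "carrier H = univ A" and fin: "finite (univ A)" "finite (symbols \<tau>)"
    and aff: "\<And>R. R \<in> symbols \<tau> \<Longrightarrow> affine_rel H (ar \<tau> R) (rel A R)"
    and k: "1 \<le> k" "alg = Z_Affine_Consistency \<longrightarrow> arity \<tau> \<le> k"
  shows "solves TYPE('b) alg (\<lambda>_. k) \<tau> A"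
  unfolding solves_def
proof (intro allI impI iffI)
  fix B :: "('b, 'r) rel_struct" assume B: "fin_struct \<tau> B"
  have finR: "finite (rel A R)" if "R \<in> symbols \<tau>" for R
    by (rule finite_subset [OF _ finite_lists_length_eq [OF fin(1), of "ar \<tau> R"]])
      (use aff [OF that] H(2) in \<open>auto simp: affine_rel_def\<close>)
  {
    assume "B \<in> CSP \<tau> A"
    then show "accepts alg k \<tau> A B"
      using accepts_if_hom [OF B fin finR] by (auto simp: CSP_def)
  next
    assume acc: "accepts alg k \<tau> A B"
    have ba: "homs \<tau> B A \<noteq> {}" if "ba_accepts_with C k \<tau> A B" "1 \<le> k" for C k
      using that hom_if_aip [OF H fin(1) aff B that(2)] unfolding ba_accepts_with_def by blast
    have "homs \<tau> B A \<noteq> {}"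
    proof (cases alg)
      case Z_Affine_Consistency
      then show ?thesis
        using acc k ar_le_arity [OF fin(2)] by (intro hom_if_z_affine [OF H fin(1) aff B k(1)]) fastforce+
    next
      case BLP_AIP
      then show ?thesis using acc ba by (auto simp: ba_accepts_def)
    next
      case BA
      then show ?thesis using acc ba k by (auto simp: ba_accepts_def)
    next
      case CLAP
      then obtain S where S: "\<And>R b. R \<in> symbols \<tau> \<Longrightarrow> b \<in> rel B R \<Longrightarrow> \<exists>a. (R, b, a) \<in> S"
        and or: "S = {} \<or> (\<exists>t\<in>S. ba_accepts_with (clap_constraints \<tau> A B S t) 1 \<tau> A B)"
        using acc by (auto simp: clap_accepts_def)
      interpret comm_group H by (rule H)
      have "univ A \<noteq> {}" using one_closed H(2) by auto
      then show ?thesis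
      \<comment> \<open>If \<open>S\<close> is empty although every constraint retains a tuple, then
        there are no constraints and a constant map will do.\<close>
      proof (cases "S = {}")
        case True
        then show ?thesis using S \<open>univ A \<noteq> {}\<close> by (intro hom_if_no_constraints) auto
      next
        case False
        then show ?thesis using or ba [of _ 1] by blast
      qed
    qed
    then show "B \<in> CSP \<tau> A" using B by (simp add: CSP_def)
  }
qed

section \<open>Baer sums\<close>

text \<open>\<open>h\<close> plays the role of 1/2 on commutators: it can be 0 for an Abelian group and \<open>(n + 1) / 2\<close> for a
  2-nilpotent group of odd order \<open>n\<close>.\<close>

locale class_two = group G for G (structure) +
  fixes h :: nat
  assumes central: "x \<in> carrier G \<Longrightarrow> y \<in> carrier G \<Longrightarrow> z \<in> carrier G \<Longrightarrow>
      (inv x \<otimes> inv y \<otimes> x \<otimes> y) \<otimes> z = z \<otimes> (inv x \<otimes> inv y \<otimes> x \<otimes> y)"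
    and half: "x \<in> carrier G \<Longrightarrow> y \<in> carrier G \<Longrightarrow>
      (inv x \<otimes> inv y \<otimes> x \<otimes> y) [^] (2 * h) = inv x \<otimes> inv y \<otimes> x \<otimes> y"
begin

definition commutator :: "'a \<Rightarrow> 'a \<Rightarrow> 'a" where
  "commutator x y = inv x \<otimes> inv y \<otimes> x \<otimes> y"

definition baer :: "'a \<Rightarrow> 'a \<Rightarrow> 'a" where
  "baer x y = x \<otimes> y \<otimes> commutator y x [^] h"

lemma commutator_closed [simp]: "x \<in> carrier G \<Longrightarrow> y \<in> carrier G \<Longrightarrow> commutator x y \<in> carrier G"
  by (simp add: commutator_def)

lemma baer_closed [simp]: "x \<in> carrier G \<Longrightarrow> y \<in> carrier G \<Longrightarrow> baer x y \<in> carrier G"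
  by (simp add: baer_def)

lemma commutator_central:
  "x \<in> carrier G \<Longrightarrow> y \<in> carrier G \<Longrightarrow> z \<in> carrier G \<Longrightarrow> commutator x y \<otimes> z = z \<otimes> commutator x y"
  unfolding commutator_def by (rule central)

lemma pow_commutator_central:
  assumes "x \<in> carrier G" "y \<in> carrier G" "z \<in> carrier G"
  shows "commutator x y [^] (n::nat) \<otimes> z = z \<otimes> commutator x y [^] n"
  using group_commutes_pow [OF commutator_central [OF assms]] assms by simp

lemma inv_mult_cancel: "x \<in> carrier G \<Longrightarrow> y \<in> carrier G \<Longrightarrow> inv x \<otimes> (x \<otimes> y) = y"
  "x \<in> carrier G \<Longrightarrow> y \<in> carrier G \<Longrightarrow> x \<otimes> (inv x \<otimes> y) = y"
  by (simp_all add: m_assoc [symmetric])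

lemma mult_commutator: "x \<in> carrier G \<Longrightarrow> y \<in> carrier G \<Longrightarrow> x \<otimes> y \<otimes> commutator y x = y \<otimes> x"
  by (simp add: commutator_def m_assoc inv_mult_cancel)

text \<open>In any group \<open>[x y, z]\<close> is the conjugate of \<open>[x, z]\<close> by
  \<open>y\<close>, times \<open>[y, z]\<close>. Centrality removes the conjugation.\<close>

lemma commutator_mult_left:
  assumes [simp]: "x \<in> carrier G" "y \<in> carrier G" "z \<in> carrier G"
  shows "commutator (x \<otimes> y) z = commutator x z \<otimes> commutator y z"
proof -
  have "commutator (x \<otimes> y) z = inv y \<otimes> commutator x z \<otimes> (inv z \<otimes> y \<otimes> z)"
    by (simp add: commutator_def inv_mult_group m_assoc inv_mult_cancel)
  also have "\<dots> = commutator x z \<otimes> inv y \<otimes> (inv z \<otimes> y \<otimes> z)" by (simp add: commutator_central)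
  also have "\<dots> = commutator x z \<otimes> commutator y z" by (simp add: commutator_def m_assoc)
  finally show ?thesis .
qed

lemma commutator_inv: "x \<in> carrier G \<Longrightarrow> y \<in> carrier G \<Longrightarrow> inv (commutator x y) = commutator y x"
  by (simp add: commutator_def inv_mult_group m_assoc)

lemma commutator_mult_right:
  assumes [simp]: "x \<in> carrier G" "y \<in> carrier G" "z \<in> carrier G"
  shows "commutator x (y \<otimes> z) = commutator x y \<otimes> commutator x z"
proof -
  have "commutator x (y \<otimes> z) = inv (commutator y x \<otimes> commutator z x)"
    by (simp add: commutator_inv [of "y \<otimes> z" x, symmetric] commutator_mult_left)
  also have "commutator y x \<otimes> commutator z x = commutator z x \<otimes> commutator y x" by (rule commutator_central) simp_all
  also have "inv \<dots> = commutator x y \<otimes> commutator x z" by (simp add: inv_mult_group commutator_inv)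
  finally show ?thesis .
qed

lemma commutator_self [simp]: "x \<in> carrier G \<Longrightarrow> commutator x x = \<one>"
  by (simp add: commutator_def m_assoc inv_mult_cancel)

lemma commutator_one [simp]: "x \<in> carrier G \<Longrightarrow> commutator \<one> x = \<one>" "x \<in> carrier G \<Longrightarrow> commutator x \<one> = \<one>"
  by (simp_all add: commutator_def)

lemma commutator_pow_commutator [simp]:
  assumes [simp]: "x \<in> carrier G" "y \<in> carrier G" "z \<in> carrier G"
  shows "commutator (commutator x y [^] (n::nat)) z = \<one>" "commutator z (commutator x y [^] n) = \<one>"
proof -
  let ?u = "commutator x y [^] n"
  have "commutator ?u z = inv ?u \<otimes> (inv z \<otimes> (?u \<otimes> z))" by (simp add: commutator_def m_assoc)
  then show *: "commutator ?u z = \<one>" by (simp add: pow_commutator_central inv_mult_cancel)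
  show "commutator z ?u = \<one>" using commutator_inv [of ?u z] * by simp
qed

lemma commutator_mult_pow:
  assumes [simp]: "x \<in> carrier G" "y \<in> carrier G" "z \<in> carrier G"
  shows "(commutator x z \<otimes> commutator y z) [^] (n::nat) = commutator x z [^] n \<otimes> commutator y z [^] n"
    "(commutator z x \<otimes> commutator z y) [^] n = commutator z x [^] n \<otimes> commutator z y [^] n"
  by (intro pow_mult_distrib commutator_central commutator_closed assms)+

lemma commutator_inv_left:
  assumes [simp]: "x \<in> carrier G" "y \<in> carrier G"
  shows "commutator (inv x) y \<otimes> commutator x y = \<one>"
  by (simp add: commutator_mult_left [symmetric])

text \<open>In \<open>y x = x y [y, x]\<close> the commutator is the square of its half. One half
  cancels against the half of the inverse \<open>[x, y]\<close>, the other is the one in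
  \<open>baer x y\<close>.\<close>

lemma baer_comm:
  assumes [simp]: "x \<in> carrier G" "y \<in> carrier G"
  shows "baer x y = baer y x"
proof -
  have c: "commutator y x = commutator y x [^] h \<otimes> commutator y x [^] h"
    using half [of y x] by (simp add: commutator_def nat_pow_mult mult_2)
  have "commutator y x [^] h \<otimes> commutator x y [^] h = (commutator y x \<otimes> commutator x y) [^] h"
    by (intro pow_mult_distrib [symmetric] commutator_central commutator_closed assms)
  also have "commutator y x \<otimes> commutator x y = \<one>" by (simp add: commutator_inv [of x y, symmetric])
  finally have 1: "commutator y x [^] h \<otimes> commutator x y [^] h = \<one>" by simp
  have "baer y x = x \<otimes> y \<otimes> commutator y x \<otimes> commutator x y [^] h"
    by (simp add: baer_def mult_commutator)
  also have "\<dots> = x \<otimes> y \<otimes> (commutator y x [^] h \<otimes> commutator y x [^] h) \<otimes> commutator x y [^] h"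
    using c by simp
  also have "\<dots> = x \<otimes> y \<otimes> commutator y x [^] h \<otimes> (commutator y x [^] h \<otimes> commutator x y [^] h)"
    by (simp add: m_assoc)
  also have "\<dots> = baer x y" by (simp only: 1) (simp add: baer_def)
  finally show ?thesis ..
qed

text \<open>Since commutators are multiplicative in each argument, both sides are
  \<open>x y z\<close> times the halves of \<open>[y, x]\<close>, \<open>[z, x]\<close> and
  \<open>[z, y]\<close>, which are central and can be collected at the end.\<close>

lemma baer_assoc:
  assumes [simp]: "x \<in> carrier G" "y \<in> carrier G" "z \<in> carrier G"
  shows "baer (baer x y) z = baer x (baer y z)"
proof -
  let ?yx = "commutator y x [^] h" and ?zx = "commutator z x [^] h" and ?zy = "commutator z y [^] h"
  have "baer (baer x y) z = x \<otimes> y \<otimes> ?yx \<otimes> z \<otimes> (commutator z x \<otimes> commutator z y) [^] h"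
    by (simp add: baer_def commutator_mult_right)
  also have "\<dots> = x \<otimes> y \<otimes> (?yx \<otimes> z) \<otimes> (?zx \<otimes> ?zy)"
    by (simp add: commutator_mult_pow m_assoc)
  also have "\<dots> = x \<otimes> y \<otimes> z \<otimes> (?yx \<otimes> ?zx \<otimes> ?zy)"
    by (simp add: pow_commutator_central [of y x z] m_assoc)
  finally have 1: "baer (baer x y) z = x \<otimes> y \<otimes> z \<otimes> (?yx \<otimes> ?zx \<otimes> ?zy)" .
  have "baer x (baer y z) = x \<otimes> (y \<otimes> z \<otimes> ?zy) \<otimes> (commutator y x \<otimes> commutator z x) [^] h"
    by (simp add: baer_def commutator_mult_left)
  also have "\<dots> = x \<otimes> y \<otimes> z \<otimes> (?zy \<otimes> (?yx \<otimes> ?zx))"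
    by (simp add: commutator_mult_pow m_assoc)
  also have "\<dots> = x \<otimes> y \<otimes> z \<otimes> (?yx \<otimes> ?zx \<otimes> ?zy)"
    by (simp add: pow_commutator_central [of z y "?yx \<otimes> ?zx"])
  finally show ?thesis using 1 by simp
qed

lemma baer_one: "x \<in> carrier G \<Longrightarrow> baer x \<one> = x" "x \<in> carrier G \<Longrightarrow> baer \<one> x = x"
  by (simp_all add: baer_def)

lemma baer_inv:
  assumes [simp]: "x \<in> carrier G"
  shows "baer (inv x) x = \<one>"
proof -
  have "commutator x (inv x) = \<one>" by (simp add: commutator_def m_assoc inv_mult_cancel)
  then show ?thesis by (simp add: baer_def)
qed

abbreviation "baer_group \<equiv> \<lparr>carrier = carrier G, monoid.mult = baer, one = \<one>\<rparr>"

lemma comm_group_baer: "comm_group baer_group"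
proof (rule comm_groupI)
  show "\<exists>y\<in>carrier baer_group. y \<otimes>\<^bsub>baer_group\<^esub> x = \<one>\<^bsub>baer_group\<^esub>"
    if "x \<in> carrier baer_group" for x
    using that baer_inv [of x] by (intro bexI [of _ "inv x"]) simp_all
  show "x \<otimes>\<^bsub>baer_group\<^esub> y = y \<otimes>\<^bsub>baer_group\<^esub> x"
    if "x \<in> carrier baer_group" "y \<in> carrier baer_group" for x y
    using that baer_comm [of x y] by simp
qed (auto simp: baer_one baer_assoc)

lemma inv_baer: "x \<in> carrier G \<Longrightarrow> inv\<^bsub>baer_group\<^esub> x = inv x"
proof -
  interpret B: comm_group baer_group by (rule comm_group_baer)
  assume "x \<in> carrier G"
  then show ?thesis by (intro B.inv_equality) (auto simp: baer_inv)
qed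

text \<open>For elements \<open>u d\<close>, \<open>v d\<close>, \<open>w d\<close> of a right coset, take \<open>p = u v\<^bsup>-1\<^esup>\<close>, \<open>q = w v\<^bsup>-1\<^esup>\<close>, \<open>y
    = v d\<close>: the
  right-hand side lies in the same coset, since Baer sums are words in the group operations.\<close>

lemma baer_maltsev:
  assumes [simp]: "p \<in> carrier G" "q \<in> carrier G" "y \<in> carrier G"
  shows "baer (baer (p \<otimes> y) (inv y)) (q \<otimes> y) = baer p q \<otimes> y"
proof -
  let ?w = "commutator (inv y) p [^] h"
  have cy: "commutator (inv y) y = \<one>" by (simp add: commutator_def m_assoc inv_mult_cancel)
  have 1: "baer (p \<otimes> y) (inv y) = p \<otimes> ?w"
    by (simp add: baer_def commutator_mult_right cy m_assoc)
  \<comment> \<open>The twist introduced by \<open>inv y\<close> cancels the one that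
    \<open>q \<otimes> y\<close> introduces later.\<close>
  have 2: "?w \<otimes> commutator y p [^] h = \<one>"
    by (simp add: commutator_mult_pow [symmetric] commutator_inv_left)
  have "baer (p \<otimes> ?w) (q \<otimes> y) = p \<otimes> ?w \<otimes> (q \<otimes> y) \<otimes> (commutator q p \<otimes> commutator y p) [^] h"
    by (simp add: baer_def commutator_mult_left commutator_mult_right)
  also have "\<dots> = p \<otimes> (?w \<otimes> (q \<otimes> y)) \<otimes> (commutator q p [^] h \<otimes> commutator y p [^] h)"
    by (simp add: commutator_mult_pow m_assoc)
  also have "\<dots> = p \<otimes> (q \<otimes> y \<otimes> ?w) \<otimes> (commutator y p [^] h \<otimes> commutator q p [^] h)"
    by (simp add: pow_commutator_central [of "inv y" p "q \<otimes> y"] pow_commutator_central [of q p "commutator y p [^] h"])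
  also have "\<dots> = p \<otimes> q \<otimes> y \<otimes> (?w \<otimes> commutator y p [^] h) \<otimes> commutator q p [^] h"
    by (simp add: m_assoc)
  also have "\<dots> = p \<otimes> q \<otimes> (commutator q p [^] h \<otimes> y)"
    by (simp only: 2) (simp add: pow_commutator_central [of q p y] m_assoc)
  also have "\<dots> = baer p q \<otimes> y" by (simp add: baer_def m_assoc)
  finally show ?thesis using 1 by simp
qed

lemma coset_affine_rel:
  fixes r :: nat
  defines "P \<equiv> product_group {..<r} (\<lambda>_. G)"
  assumes \<Delta>: "subgroup \<Delta> P" and \<delta>: "\<delta> \<in> carrier P"
  shows "affine_rel baer_group r ((\<lambda>t. map t [0..<r]) ` (\<Delta> #>\<^bsub>P\<^esub> \<delta>))"
    (is "affine_rel _ _ ?T")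
proof -
  interpret P: group P unfolding P_def by (intro product_group) (rule is_group)
  have carP: "carrier P = {..<r} \<rightarrow>\<^sub>E carrier G" by (simp add: P_def)
  have pt: "(u \<otimes>\<^bsub>P\<^esub> v) i = u i \<otimes> v i" if "i < r" for u v i using that by (simp add: P_def)
  have inv: "(inv\<^bsub>P\<^esub> u) i = inv (u i)" if "u \<in> carrier P" "i < r" for u i
    using that by (simp add: P_def)
  have pow: "(u [^]\<^bsub>P\<^esub> n) i = u i [^] n" if "i < r" for u i and n :: nat
    using that by (induction n) (auto simp: P_def)
  have \<Delta>P: "u \<in> carrier P" if "u \<in> \<Delta>" for u using that \<Delta> by (rule subgroup.mem_carrier [rotated])
  have car: "u i \<in> carrier G" if "u \<in> carrier P" "i < r" for u i using that carP by auto
  have T: "?T = {map (\<lambda>i. u i \<otimes> \<delta> i) [0..<r] | u. u \<in> \<Delta>}"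
  proof -
    have "map (u \<otimes>\<^bsub>P\<^esub> \<delta>) [0..<r] = map (\<lambda>i. u i \<otimes> \<delta> i) [0..<r]" for u
      using pt [of _ u \<delta>] by simp
    moreover have "\<Delta> #>\<^bsub>P\<^esub> \<delta> = (\<lambda>u. u \<otimes>\<^bsub>P\<^esub> \<delta>) ` \<Delta>" unfolding r_coset_def by blast
    ultimately have "?T = (\<lambda>u. map (\<lambda>i. u i \<otimes> \<delta> i) [0..<r]) ` \<Delta>" by (simp only: image_image)
    then show ?thesis by (simp only: Setcompr_eq_image)
  qed
  have ne: "?T \<noteq> {}" unfolding T using subgroup.one_closed [OF \<Delta>] by blast
  have sub: "?T \<subseteq> {a. length a = r \<and> set a \<subseteq> carrier baer_group}"
    unfolding T using car [OF \<Delta>P] car [OF \<delta>] by auto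
  have "map (\<lambda>i. a ! i \<otimes>\<^bsub>baer_group\<^esub> inv\<^bsub>baer_group\<^esub> (b ! i) \<otimes>\<^bsub>baer_group\<^esub> c ! i) [0..<r] \<in> ?T"
    if a: "a \<in> ?T" and b: "b \<in> ?T" and c: "c \<in> ?T" for a b c
  proof -
    obtain u v w where uvw: "u \<in> \<Delta>" "v \<in> \<Delta>" "w \<in> \<Delta>"
      and abc: "a = map (\<lambda>i. u i \<otimes> \<delta> i) [0..<r]" "b = map (\<lambda>i. v i \<otimes> \<delta> i) [0..<r]"
        "c = map (\<lambda>i. w i \<otimes> \<delta> i) [0..<r]"
      using a b c unfolding T by blast
    define p where "p = u \<otimes>\<^bsub>P\<^esub> inv\<^bsub>P\<^esub> v"
    define q where "q = w \<otimes>\<^bsub>P\<^esub> inv\<^bsub>P\<^esub> v"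
    \<comment> \<open>This spells out \<open>baer p q\<close> followed by \<open>v\<close> in the
      operations of \<open>P\<close>, so that membership in \<open>\<Delta>\<close> follows from
      subgroup closure.\<close>
    define s where "s = p \<otimes>\<^bsub>P\<^esub> q \<otimes>\<^bsub>P\<^esub> (inv\<^bsub>P\<^esub> q \<otimes>\<^bsub>P\<^esub> inv\<^bsub>P\<^esub> p \<otimes>\<^bsub>P\<^esub> q \<otimes>\<^bsub>P\<^esub> p) [^]\<^bsub>P\<^esub> h \<otimes>\<^bsub>P\<^esub> v"
    have pq: "p \<in> \<Delta>" "q \<in> \<Delta>"
      using uvw \<Delta> by (auto simp: p_def q_def intro: subgroup.m_closed subgroup.m_inv_closed)
    have npow: "x [^]\<^bsub>P\<^esub> n \<in> \<Delta>" if "x \<in> \<Delta>" for x and n :: nat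
      using that \<Delta> by (induction n) (auto intro: subgroup.m_closed subgroup.one_closed)
    have s: "s \<in> \<Delta>"
      unfolding s_def using pq uvw
      by (intro subgroup.m_closed [OF \<Delta>] npow subgroup.m_inv_closed [OF \<Delta>])
    have "a ! i \<otimes>\<^bsub>baer_group\<^esub> inv\<^bsub>baer_group\<^esub> (b ! i) \<otimes>\<^bsub>baer_group\<^esub> c ! i = s i \<otimes> \<delta> i" if i: "i < r" for i
    proof -
      note [simp] = car [OF \<Delta>P [OF uvw(1)] i] car [OF \<Delta>P [OF uvw(2)] i] car [OF \<Delta>P [OF uvw(3)] i]
        car [OF \<delta> i] car [OF \<Delta>P [OF pq(1)] i] car [OF \<Delta>P [OF pq(2)] i]
      let ?y = "v i \<otimes> \<delta> i"
      have si: "s i = baer (p i) (q i) \<otimes> v i"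
        using \<Delta>P [OF pq(1)] \<Delta>P [OF pq(2)]
        by (simp add: s_def pt [OF i] pow [OF i] inv [OF _ i] baer_def commutator_def)
      have pi: "u i \<otimes> \<delta> i = p i \<otimes> ?y" and qi: "w i \<otimes> \<delta> i = q i \<otimes> ?y"
        using \<Delta>P [OF uvw(2)]
        by (simp_all add: p_def q_def pt [OF i] inv [OF _ i] m_assoc inv_mult_cancel)
      have "baer (baer (u i \<otimes> \<delta> i) (inv ?y)) (w i \<otimes> \<delta> i) = baer (p i) (q i) \<otimes> ?y"
        unfolding pi qi by (rule baer_maltsev) simp_all
      then show ?thesis using i si by (simp add: abc inv_baer m_assoc)
    qed
    then have "map (\<lambda>i. a ! i \<otimes>\<^bsub>baer_group\<^esub> inv\<^bsub>baer_group\<^esub> (b ! i) \<otimes>\<^bsub>baer_group\<^esub> c ! i) [0..<r]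
        = map (\<lambda>i. s i \<otimes> \<delta> i) [0..<r]" by simp
    then show ?thesis unfolding T using s by blast
  qed
  with ne sub show ?thesis unfolding affine_rel_def by blast
qed

lemma solves_coset_template:
  fixes A :: "('a, 'r) rel_struct"
  assumes "coset_template G \<tau> A" "1 \<le> k" "alg = Z_Affine_Consistency \<longrightarrow> arity \<tau> \<le> k"
  shows "solves TYPE('v) alg (\<lambda>_. k) \<tau> A"
proof (rule solves_affine [OF comm_group_baer])
  show "affine_rel baer_group (ar \<tau> R) (rel A R)" if R: "R \<in> symbols \<tau>" for R
  proof -
    let ?P = "product_group {..<ar \<tau> R} (\<lambda>_. G)"
    obtain \<Delta> \<delta> where "subgroup \<Delta> ?P" "\<delta> \<in> carrier ?P"
      "rel A R = (\<lambda>t. map t [0..<ar \<tau> R]) ` (\<Delta> #>\<^bsub>?P\<^esub> \<delta>)"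
    proof -
      have "\<forall>R\<in>symbols \<tau>. \<exists>\<Delta> \<delta>. subgroup \<Delta> (product_group {..<ar \<tau> R} (\<lambda>_. G))
          \<and> \<delta> \<in> carrier (product_group {..<ar \<tau> R} (\<lambda>_. G))
          \<and> rel A R = (\<lambda>t. map t [0..<ar \<tau> R]) ` (\<Delta> #>\<^bsub>product_group {..<ar \<tau> R} (\<lambda>_. G)\<^esub> \<delta>)"
        using assms(1) unfolding coset_template_def Let_def by (elim conjE)
      from bspec [OF this R] show thesis by (elim exE conjE) (rule that)
    qed
    then show ?thesis using coset_affine_rel by (simp only:)
  qed
qed (use assms in \<open>auto simp: coset_template_def\<close>)

end

lemma solves_abelian:
  fixes A :: "('a, 'r) rel_struct"
  assumes "comm_group G" "coset_template G \<tau> A" "1 \<le> k" "alg = Z_Affine_Consistency \<longrightarrow> arity \<tau> \<le> k"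
  shows "solves TYPE('v) alg (\<lambda>_. k) \<tau> A"
proof -
  interpret comm_group G by fact
  have commutator: "inv\<^bsub>G\<^esub> x \<otimes>\<^bsub>G\<^esub> inv\<^bsub>G\<^esub> y \<otimes>\<^bsub>G\<^esub> x \<otimes>\<^bsub>G\<^esub> y
      = \<one>\<^bsub>G\<^esub>" if "x \<in> carrier G" "y \<in> carrier G" for x y
  proof -
    have "inv\<^bsub>G\<^esub> x \<otimes>\<^bsub>G\<^esub> inv\<^bsub>G\<^esub> y \<otimes>\<^bsub>G\<^esub> x \<otimes>\<^bsub>G\<^esub> y
        = inv\<^bsub>G\<^esub> (x \<otimes>\<^bsub>G\<^esub> y) \<otimes>\<^bsub>G\<^esub> (x \<otimes>\<^bsub>G\<^esub> y)"
      using that by (simp add: inv_mult m_assoc)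
    then show ?thesis using that by simp
  qed
  interpret class_two G 0 by unfold_locales (simp_all add: commutator)
  show ?thesis using assms by (intro solves_coset_template)
qed

lemma solves_two_nilpotent_odd:
  fixes A :: "('a, 'r) rel_struct"
  assumes nil: "two_nilpotent G" and odd: "odd (order G)"
    and A: "coset_template G \<tau> A" "1 \<le> k" "alg = Z_Affine_Consistency \<longrightarrow> arity \<tau> \<le> k"
  shows "solves TYPE('v) alg (\<lambda>_. k) \<tau> A"
proof -
  interpret group G using nil by (simp add: two_nilpotent_def)
  have fin: "finite (carrier G)" using A by (simp add: coset_template_def)
  interpret class_two G "(order G + 1) div 2"
  proof
    fix x y z assume xyz: "x \<in> carrier G" "y \<in> carrier G" "z \<in> carrier G"
    \<comment> \<open>\<open>derived\<close> is generated by the products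
      \<open>x y (inv x) (inv y)\<close>; inserting inverses yields the convention of the
      locale.\<close>
    have "inv\<^bsub>G\<^esub> x \<otimes>\<^bsub>G\<^esub> inv\<^bsub>G\<^esub> y \<otimes>\<^bsub>G\<^esub> inv\<^bsub>G\<^esub> (inv\<^bsub>G\<^esub> x) \<otimes>\<^bsub>G\<^esub> inv\<^bsub>G\<^esub> (inv\<^bsub>G\<^esub> y)
        \<in> derived G (carrier G)"
      unfolding derived_def 
      by (rule generate.incl, rule UN_I [of "inv\<^bsub>G\<^esub> x"], simp add: xyz,
          rule UN_I [of "inv\<^bsub>G\<^esub> y"], simp_all add: xyz)
    then have "inv\<^bsub>G\<^esub> x \<otimes>\<^bsub>G\<^esub> inv\<^bsub>G\<^esub> y \<otimes>\<^bsub>G\<^esub> x \<otimes>\<^bsub>G\<^esub> y \<in> group_center G"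
      using nil unfolding two_nilpotent_def by (simp only: inv_inv xyz(1,2)) blast
    then show "inv\<^bsub>G\<^esub> x \<otimes>\<^bsub>G\<^esub> inv\<^bsub>G\<^esub> y \<otimes>\<^bsub>G\<^esub> x \<otimes>\<^bsub>G\<^esub> y \<otimes>\<^bsub>G\<^esub> z
        = z \<otimes>\<^bsub>G\<^esub> (inv\<^bsub>G\<^esub> x \<otimes>\<^bsub>G\<^esub> inv\<^bsub>G\<^esub> y \<otimes>\<^bsub>G\<^esub> x \<otimes>\<^bsub>G\<^esub> y)"
      using xyz by (simp add: group_center_def)
  next
    fix x y assume xy: "x \<in> carrier G" "y \<in> carrier G"
    let ?c = "inv\<^bsub>G\<^esub> x \<otimes>\<^bsub>G\<^esub> inv\<^bsub>G\<^esub> y \<otimes>\<^bsub>G\<^esub> x \<otimes>\<^bsub>G\<^esub> y"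
    \<comment> \<open>Oddness makes the halving exact. The exponent exceeds the group order by one,
      so by Lagrange the power is the element itself.\<close>
    have "2 * ((order G + 1) div 2) = Suc (order G)" using odd by simp
    then show "?c [^]\<^bsub>G\<^esub> (2 * ((order G + 1) div 2)) = ?c"
      using xy pow_order_eq_1 [of ?c] by simp
  qed
  show ?thesis using A by (intro solves_coset_template)
qed

section \<open>Non-Abelian semidirect products of order \<open>p\<^sup>3\<close>\<close>

context
  fixes p :: nat
  assumes p: "2 \<le> p"
begin

text \<open>The factors \<open>1 + x p\<close> form the subgroup of order \<open>p\<close> of the
  units modulo \<open>p^2\<close>, namely the kernel of reduction modulo \<open>p\<close>. The
  restriction is there because members of \<open>AutoGroup\<close> are extensional.\<close>

definition p_action :: "int \<Rightarrow> int \<Rightarrow> int" where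
  "p_action x = (\<lambda>a\<in>{0..<(int p)\<^sup>2}. (1 + x * int p) * a mod (int p)\<^sup>2)"

definition p3_group :: "(int \<times> int) monoid" where
  "p3_group = semidirect_product (integer_mod_group (p\<^sup>2)) (integer_mod_group p) p_action"

lemma carrier_factors: "carrier (integer_mod_group (p\<^sup>2)) = {0..<(int p)\<^sup>2}" "carrier (integer_mod_group p) = {0..<int p}"
  using p by (auto simp: carrier_integer_mod_group)

lemma modulus_pos: "0 < int p" "0 < (int p)\<^sup>2"
  using p by auto

text \<open>The cross term of the product is a multiple of \<open>p^2\<close>, and so is the effect
  of reducing \<open>x + y\<close> modulo \<open>p\<close>.\<close>

lemma p_action_mult:
  "(1 + x * int p) * ((1 + y * int p) * c) mod (int p)\<^sup>2 = (1 + ((x + y) mod int p) * int p) * c mod (int p)\<^sup>2"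
proof -
  have e: "(x + y) mod int p = x + y - int p * ((x + y) div int p)" by (simp add: minus_mult_div_eq_mod)
  have "(1 + x * int p) * ((1 + y * int p) * c) - (1 + ((x + y) mod int p) * int p) * c
      = (int p)\<^sup>2 * ((x * y + (x + y) div int p) * c)"
    unfolding e by (simp add: algebra_simps power2_eq_square)
  then show ?thesis by (metis dvd_triv_left mod_eq_dvd_iff)
qed

lemma p_action_apply: "a \<in> {0..<(int p)\<^sup>2} \<Longrightarrow> p_action x a = (1 + x * int p) * a mod (int p)\<^sup>2"
  by (simp add: p_action_def)

lemma p_action_closed: "a \<in> {0..<(int p)\<^sup>2} \<Longrightarrow> p_action x a \<in> {0..<(int p)\<^sup>2}"
  using modulus_pos by (simp add: p_action_def)

lemma p_action_theta:
  "a \<in> {0..<(int p)\<^sup>2} \<Longrightarrow> p_action x (p_action y a) = p_action ((x + y) mod int p) a"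
  using p_action_closed [of a y] by (simp add: p_action_apply mod_mult_right_eq p_action_mult)

lemma p_action_0: "a \<in> {0..<(int p)\<^sup>2} \<Longrightarrow> p_action 0 a = a"
  by (simp add: p_action_apply)

lemma p_action_Bij: "p_action x \<in> Bij {0..<(int p)\<^sup>2}"
proof -
  have 1: "p_action (- x) (p_action x a) = a" "p_action x (p_action (- x) a) = a" if "a \<in> {0..<(int p)\<^sup>2}" for a
    using p_action_theta [OF that, of "- x" x] p_action_theta [OF that, of x "- x"] p_action_0 [OF that] by simp_all
  have "bij_betw (p_action x) {0..<(int p)\<^sup>2} {0..<(int p)\<^sup>2}"
    by (rule bij_betw_byWitness [where f' = "p_action (- x)"]) (use 1 p_action_closed in \<open>auto simp del: atLeastLessThan_iff\<close>)
  then show ?thesis by (simp add: Bij_def p_action_def)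
qed

lemma p_action_add:
  assumes "a \<in> {0..<(int p)\<^sup>2}" "b \<in> {0..<(int p)\<^sup>2}"
  shows "p_action x ((a + b) mod (int p)\<^sup>2) = (p_action x a + p_action x b) mod (int p)\<^sup>2"
proof -
  have "(a + b) mod (int p)\<^sup>2 \<in> {0..<(int p)\<^sup>2}" using modulus_pos by simp
  then have "p_action x ((a + b) mod (int p)\<^sup>2) = (1 + x * int p) * (a + b) mod (int p)\<^sup>2"
    by (simp add: p_action_apply mod_mult_right_eq)
  also have "\<dots> = ((1 + x * int p) * a mod (int p)\<^sup>2 + (1 + x * int p) * b mod (int p)\<^sup>2) mod (int p)\<^sup>2"
    by (simp only: mod_add_eq distrib_left)
  finally show ?thesis using assms by (simp add: p_action_apply)
qed

lemma p_action_hom: "p_action \<in> hom (integer_mod_group p) (AutoGroup (integer_mod_group (p\<^sup>2)))"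
proof (rule homI)
  show "p_action x \<in> carrier (AutoGroup (integer_mod_group (p\<^sup>2)))" for x
    using p_action_Bij [of x] p_action_closed p_action_add
    by (simp add: AutoGroup_def auto_def hom_def carrier_factors del: atLeastLessThan_iff)
  show "p_action (x \<otimes>\<^bsub>integer_mod_group p\<^esub> y) = p_action x \<otimes>\<^bsub>AutoGroup (integer_mod_group (p\<^sup>2))\<^esub> p_action y"
    for x y
  proof -
    have "p_action ((x + y) mod int p) = compose {0..<(int p)\<^sup>2} (p_action x) (p_action y)"
    proof (rule extensionalityI)
      show "p_action ((x + y) mod int p) \<in> extensional {0..<(int p)\<^sup>2}" by (simp add: p_action_def)
    qed (simp_all add: p_action_theta compose_def)
    then show ?thesis using p_action_Bij by (simp add: AutoGroup_def BijGroup_def carrier_factors)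
  qed
qed

lemma p3_group_carrier: "carrier p3_group = {0..<(int p)\<^sup>2} \<times> {0..<int p}"
  by (simp add: p3_group_def semidirect_product_def carrier_factors)

lemma p3_group_one: "\<one>\<^bsub>p3_group\<^esub> = (0, 0)"
  by (simp add: p3_group_def semidirect_product_def)

lemma p3_group_mult: "(a, x) \<otimes>\<^bsub>p3_group\<^esub> (b, y) = ((a + p_action x b) mod (int p)\<^sup>2, (x + y) mod int p)"
  by (simp add: p3_group_def semidirect_product_def)

lemma group_p3_group: "group p3_group"
proof (rule groupI)
  fix u v w assume "u \<in> carrier p3_group" "v \<in> carrier p3_group" "w \<in> carrier p3_group"
  then obtain a x b y c z where uvw: "u = (a, x)" "v = (b, y)" "w = (c, z)"
    and a: "a \<in> {0..<(int p)\<^sup>2}" "b \<in> {0..<(int p)\<^sup>2}" "c \<in> {0..<(int p)\<^sup>2}"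
    by (auto simp: p3_group_carrier)
  have "p_action x ((b + p_action y c) mod (int p)\<^sup>2) = (p_action x b + p_action ((x + y) mod int p) c) mod (int p)\<^sup>2"
    using a p_action_closed by (simp add: p_action_add p_action_theta del: atLeastLessThan_iff)
  then show "u \<otimes>\<^bsub>p3_group\<^esub> v \<otimes>\<^bsub>p3_group\<^esub> w = u \<otimes>\<^bsub>p3_group\<^esub> (v \<otimes>\<^bsub>p3_group\<^esub> w)"
    by (simp add: uvw p3_group_mult mod_simps add.assoc)
next
  fix u assume "u \<in> carrier p3_group"
  then obtain a x where u: "u = (a, x)" and a: "a \<in> {0..<(int p)\<^sup>2}" "x \<in> {0..<int p}"
    by (auto simp: p3_group_carrier)
  have x: "((- x) mod int p + x) mod int p = 0" by (simp add: mod_simps)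
  show "\<one>\<^bsub>p3_group\<^esub> \<otimes>\<^bsub>p3_group\<^esub> u = u"
    using a by (simp add: u p3_group_one p3_group_mult p_action_0)
  show "\<exists>v\<in>carrier p3_group. v \<otimes>\<^bsub>p3_group\<^esub> u = \<one>\<^bsub>p3_group\<^esub>"
    by (rule bexI [of _ "((- p_action ((- x) mod int p) a) mod (int p)\<^sup>2, (- x) mod int p)"])
      (use modulus_pos x in \<open>simp_all add: u p3_group_one p3_group_mult p3_group_carrier mod_simps\<close>)
qed (use modulus_pos in \<open>auto simp: p3_group_carrier p3_group_one p3_group_mult\<close>)

lemma p3_group_order: "order p3_group = p ^ 3"
  by (simp add: order_def p3_group_carrier card_cartesian_product nat_power_eq power3_eq_cube power2_eq_square
      flip: of_nat_mult)

lemma p3_group_not_comm: "\<not> comm_group p3_group"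
proof
  assume "comm_group p3_group"
  then interpret comm_group p3_group .
  \<comment> \<open>As \<open>1 + p\<close> lies below \<open>p^2\<close>, the action of 1 sends 1
    to \<open>1 + p\<close> without reduction, which separates the two products of
    \<open>(1, 0)\<close> and \<open>(0, 1)\<close>.\<close>
  have le: "1 + int p < (int p)\<^sup>2"
  proof -
    have "int p * 2 \<le> int p * int p" using p by (intro mult_left_mono) auto
    then have "int p * 2 \<le> (int p)\<^sup>2" by (simp only: power2_eq_square)
    moreover have "2 \<le> int p" using p by simp
    ultimately show ?thesis by linarith
  qed
  have 1: "1 < (int p)\<^sup>2" "1 < int p" using p le by auto
  have "(1, 0) \<otimes>\<^bsub>p3_group\<^esub> (0, 1) = (0, 1) \<otimes>\<^bsub>p3_group\<^esub> (1, 0)"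
    by (rule m_comm) (use 1 in \<open>auto simp: p3_group_carrier\<close>)
  then show False using le p 1 by (simp add: p3_group_mult p_action_apply)
qed

text \<open>The action is trivial modulo \<open>p\<close>, so both coordinates are additive modulo
  \<open>p\<close> and a commutator is \<open>(d, 0)\<close> with \<open>p\<close> dividing
  \<open>d\<close>. Such \<open>d\<close> is fixed by every factor \<open>1 + y p\<close> modulo
  \<open>p^2\<close>, which makes commutators central.\<close>

lemma p3_group_two_nilpotent: "two_nilpotent p3_group"
proof -
  interpret group p3_group by (rule group_p3_group)
  have p2: "int p dvd (int p)\<^sup>2" by simp
  have fst_mod: "fst (u \<otimes>\<^bsub>p3_group\<^esub> v) mod int p = (fst u + fst v) mod int p"
    if uv: "u \<in> carrier p3_group" "v \<in> carrier p3_group" for u v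
  proof -
    obtain a x b y where e: "u = (a, x)" "v = (b, y)" by (cases u, cases v)
    have "b \<in> {0..<(int p)\<^sup>2}" using uv e by (simp add: p3_group_carrier)
    then have "fst (u \<otimes>\<^bsub>p3_group\<^esub> v) = (a + (1 + x * int p) * b) mod (int p)\<^sup>2"
      by (simp add: e p3_group_mult p_action_apply mod_simps)
    then have "fst (u \<otimes>\<^bsub>p3_group\<^esub> v) mod int p = (a + (1 + x * int p) * b) mod int p"
      using mod_mod_cancel [OF p2] by simp
    also have "\<dots> = (a + b + int p * (x * b)) mod int p" by (simp add: algebra_simps)
    finally show ?thesis by (simp add: e)
  qed
  have snd_mult: "snd (u \<otimes>\<^bsub>p3_group\<^esub> v) = (snd u + snd v) mod int p" for u v
    by (cases u, cases v) (simp add: p3_group_mult)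
  have "u \<otimes>\<^bsub>p3_group\<^esub> v \<otimes>\<^bsub>p3_group\<^esub> inv\<^bsub>p3_group\<^esub> u \<otimes>\<^bsub>p3_group\<^esub> inv\<^bsub>p3_group\<^esub> v \<in> group_center p3_group"
    if u: "u \<in> carrier p3_group" and v: "v \<in> carrier p3_group" for u v
  proof -
    define c where "c = u \<otimes>\<^bsub>p3_group\<^esub> v \<otimes>\<^bsub>p3_group\<^esub> inv\<^bsub>p3_group\<^esub> u \<otimes>\<^bsub>p3_group\<^esub> inv\<^bsub>p3_group\<^esub> v"
    have c: "c \<in> carrier p3_group" using u v by (simp add: c_def)
    \<comment> \<open>Comparing coordinates in this equation avoids computing inverses.\<close>
    have eq: "c \<otimes>\<^bsub>p3_group\<^esub> (v \<otimes>\<^bsub>p3_group\<^esub> u) = u \<otimes>\<^bsub>p3_group\<^esub> v"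
    proof -
      have "c = (u \<otimes>\<^bsub>p3_group\<^esub> v) \<otimes>\<^bsub>p3_group\<^esub> inv\<^bsub>p3_group\<^esub> (v \<otimes>\<^bsub>p3_group\<^esub> u)"
        using u v by (simp add: c_def inv_mult_group m_assoc)
      then show ?thesis using u v by (simp only: m_assoc inv_closed m_closed l_inv r_one)
    qed
    obtain d z where cd: "c = (d, z)" and d: "d \<in> {0..<(int p)\<^sup>2}" and z: "z \<in> {0..<int p}"
      using c by (auto simp: p3_group_carrier)
    have "(d + fst (v \<otimes>\<^bsub>p3_group\<^esub> u)) mod int p = fst (u \<otimes>\<^bsub>p3_group\<^esub> v) mod int p"
      using fst_mod [OF c, of "v \<otimes>\<^bsub>p3_group\<^esub> u"] u v eq cd by simp
    then have "(d + (fst v + fst u)) mod int p = (fst v + fst u) mod int p"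
      using fst_mod [OF u v] fst_mod [OF v u] by (metis add.commute mod_add_right_eq)
    then have pd: "int p dvd d" by (simp add: mod_eq_dvd_iff)
    have "(z + (snd v + snd u)) mod int p = (snd v + snd u) mod int p"
    proof -
      have "snd (u \<otimes>\<^bsub>p3_group\<^esub> v) = (z + snd (v \<otimes>\<^bsub>p3_group\<^esub> u)) mod int p"
        unfolding eq [symmetric] snd_mult cd by simp
      then show ?thesis unfolding snd_mult by (simp add: mod_simps add.commute)
    qed
    then have "int p dvd z" by (simp add: mod_eq_dvd_iff)
    then have z0: "z = 0" using z by (auto dest: zdvd_imp_le)
    have "c \<otimes>\<^bsub>p3_group\<^esub> w = w \<otimes>\<^bsub>p3_group\<^esub> c" if w: "w \<in> carrier p3_group" for w
    proof -
      obtain b y where e: "w = (b, y)" "b \<in> {0..<(int p)\<^sup>2}" "y \<in> {0..<int p}" using w by (auto simp: p3_group_carrier)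
      obtain k where k: "d = int p * k" using pd by (elim dvdE)
      have "p_action y d = (d + (int p)\<^sup>2 * (y * k)) mod (int p)\<^sup>2"
        using d by (simp add: p_action_apply k algebra_simps power2_eq_square)
      then have "p_action y d = d" using d by simp
      then show ?thesis using e by (simp add: cd z0 p3_group_mult p_action_0 add.commute)
    qed
    then show ?thesis using c unfolding c_def [symmetric] group_center_def by blast
  qed
  then have "derived_set p3_group (carrier p3_group) \<subseteq> group_center p3_group" by blast
  moreover have "subgroup (group_center p3_group) p3_group"
  proof (rule subgroupI)
    have "\<one>\<^bsub>p3_group\<^esub> \<in> group_center p3_group" by (simp add: group_center_def)
    then show "group_center p3_group \<noteq> {}" by blast
    fix z assume z: "z \<in> group_center p3_group"
    have zc: "z \<in> carrier p3_group" and zz: "\<And>x. x \<in> carrier p3_group \<Longrightarrow> z \<otimes>\<^bsub>p3_group\<^esub> x = x \<otimes>\<^bsub>p3_group\<^esub> z"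
      using z by (auto simp: group_center_def)
    have "inv\<^bsub>p3_group\<^esub> z \<otimes>\<^bsub>p3_group\<^esub> x = x \<otimes>\<^bsub>p3_group\<^esub> inv\<^bsub>p3_group\<^esub> z" if x: "x \<in> carrier p3_group" for x
      using zz [of "inv\<^bsub>p3_group\<^esub> x"] zc x inv_mult_group [of z "inv\<^bsub>p3_group\<^esub> x"] inv_mult_group [of "inv\<^bsub>p3_group\<^esub> x" z] by simp
    then show "inv\<^bsub>p3_group\<^esub> z \<in> group_center p3_group" using zc by (simp add: group_center_def)
    fix w assume "w \<in> group_center p3_group"
    then have wc: "w \<in> carrier p3_group" and ww: "\<And>x. x \<in> carrier p3_group \<Longrightarrow> w \<otimes>\<^bsub>p3_group\<^esub> x = x \<otimes>\<^bsub>p3_group\<^esub> w"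
      by (auto simp: group_center_def)
    have "z \<otimes>\<^bsub>p3_group\<^esub> w \<otimes>\<^bsub>p3_group\<^esub> x = x \<otimes>\<^bsub>p3_group\<^esub> (z \<otimes>\<^bsub>p3_group\<^esub> w)" if x: "x \<in> carrier p3_group" for x
    proof -
      have "z \<otimes>\<^bsub>p3_group\<^esub> w \<otimes>\<^bsub>p3_group\<^esub> x
          = z \<otimes>\<^bsub>p3_group\<^esub> x \<otimes>\<^bsub>p3_group\<^esub> w" using zc wc x ww [OF x] by (simp add: m_assoc)
      also have "\<dots> = x \<otimes>\<^bsub>p3_group\<^esub> z \<otimes>\<^bsub>p3_group\<^esub> w" using zz [OF x] by simp
      finally show ?thesis using zc wc x by (simp add: m_assoc)
    qed
    then show "z \<otimes>\<^bsub>p3_group\<^esub> w \<in> group_center p3_group" using zc wc by (simp add: group_center_def)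
  qed (auto simp: group_center_def)
  ultimately have "derived p3_group (carrier p3_group) \<subseteq> group_center p3_group"
    unfolding derived_def by (rule generate_subgroup_incl)
  then show ?thesis by (simp add: two_nilpotent_def group_p3_group)
qed

end

section \<open>Local solutions of linear systems\<close>

text \<open>\<open>L\<close> consists of the linear equations mod \<open>p\<close> that count as locally derivable. It need not be closed
  under arbitrary combinations, only under those that involve at most \<open>K\<close> variables; a local solution
  satisfies the derivable equations on its domain. Adding one variable either leaves it free or
  determines it, so all extension numbers are 1 or \<open>p\<close>.\<close>

locale solution_family =
  fixes p :: nat and V :: "'v set" and K :: nat and L :: "(('v \<Rightarrow> int) \<times> int) set"
  assumes prime: "prime p" and fin: "finite V"
    and combine: "\<And>X a d a' d' m. X \<subseteq> V \<Longrightarrow> card X \<le> K \<Longrightarrow> (a, d) \<in> L \<Longrightarrow> (a', d') \<in> L \<Longrightarrow>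
      (\<And>u. u \<notin> X \<Longrightarrow> int p dvd a u) \<Longrightarrow> (\<And>u. u \<notin> X \<Longrightarrow> int p dvd a' u) \<Longrightarrow>
      (\<lambda>u. a u + m * a' u, d + m * d') \<in> L"
    and consistent: "\<And>a d. (a, d) \<in> L \<Longrightarrow> (\<And>u. int p dvd a u) \<Longrightarrow> int p dvd d"
begin

definition eqs :: "'v set \<Rightarrow> (('v \<Rightarrow> int) \<times> int) set" where
  "eqs X = {(a, d) \<in> L. \<forall>u. u \<notin> X \<longrightarrow> int p dvd a u}"

definition solutions :: "'v set \<Rightarrow> ('v \<Rightarrow> int) set" where
  "solutions X = {f \<in> X \<rightarrow>\<^sub>E {0..<int p}. \<forall>(a, d)\<in>eqs X. [(\<Sum>u\<in>X. a u * f u) = d] (mod int p)}"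

text \<open>The uniform distribution on local solutions, scaled to total \<open>p ^ K\<close>. On at
  most \<open>K\<close> variables of \<open>V\<close> the division is exact, because the number of
  solutions is a power of \<open>p\<close> with exponent at most \<open>K\<close>.\<close>

definition solution_weight :: "'v set \<Rightarrow> ('v \<Rightarrow> int) \<Rightarrow> int" where
  "solution_weight X f = (if f \<in> solutions X then int (p ^ K div card (solutions X)) else 0)"

lemma p_gt_1: "1 < int p"
  using prime prime_gt_1_nat by simp

lemma eqs_mono: "X \<subseteq> Y \<Longrightarrow> eqs X \<subseteq> eqs Y"
  by (auto simp: eqs_def)

lemma finite_solutions: "finite X \<Longrightarrow> finite (solutions X)"
  unfolding solutions_def by (rule finite_subset [OF _ finite_PiE [of X "\<lambda>_. {0..<int p}"]]) auto

lemma solutions_cong: "f \<in> solutions X \<Longrightarrow> (a, d) \<in> eqs X \<Longrightarrow> [(\<Sum>u\<in>X. a u * f u) = d] (mod int p)"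
  by (auto simp: solutions_def)

lemma solutions_restrict:
  assumes f: "f \<in> solutions Y" and X: "X \<subseteq> Y" and Y: "finite Y"
  shows "restrict f X \<in> solutions X"
proof -
  have "[(\<Sum>u\<in>X. a u * restrict f X u) = d] (mod int p)" if ad: "(a, d) \<in> eqs X" for a d
  proof -
    have "[(\<Sum>u\<in>Y. a u * f u) = d] (mod int p)" using solutions_cong [OF f] eqs_mono [OF X] ad by blast
    moreover have "(\<Sum>u\<in>Y. a u * f u) = (\<Sum>u\<in>X. a u * f u) + (\<Sum>u\<in>Y - X. a u * f u)"
      using X Y by (metis add.commute sum.subset_diff)
    moreover have "int p dvd (\<Sum>u\<in>Y - X. a u * f u)"
      using ad by (intro dvd_sum) (auto simp: eqs_def)
    moreover have "(\<Sum>u\<in>X. a u * restrict f X u) = (\<Sum>u\<in>X. a u * f u)" by (intro sum.cong) auto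
    ultimately have "[(\<Sum>u\<in>X. a u * restrict f X u) + (\<Sum>u\<in>Y - X. a u * f u) = d] (mod int p)"
      and "[(\<Sum>u\<in>Y - X. a u * f u) = 0] (mod int p)" by (simp_all only: cong_0_iff)
    from cong_diff [OF this] show ?thesis by (simp only: add_diff_cancel_right' diff_zero)
  qed
  moreover have "restrict f X \<in> X \<rightarrow>\<^sub>E {0..<int p}" using f X by (auto simp: solutions_def)
  ultimately show ?thesis by (auto simp: solutions_def)
qed

text \<open>Which case occurs depends on the equations and not on \<open>g\<close>; uniform weights
  have matching marginals for this reason. A coefficient at \<open>u\<close> that is invertible
  determines the value, and eliminating \<open>u\<close> from the other equations leaves equations
  on \<open>X\<close> that \<open>g\<close> already satisfies.\<close>

lemma extension_count:
  assumes V: "insert u X \<subseteq> V" and u: "u \<notin> X" and card: "card (insert u X) \<le> K"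
  obtains N where "N = 1 \<or> N = p"
    and "\<And>g. g \<in> solutions X \<Longrightarrow> card {f \<in> solutions (insert u X). restrict f X = g} = N"
proof -
  have finX: "finite X" using V by (auto intro: finite_subset [OF _ fin])
  have bij: "card {f \<in> solutions (insert u X). restrict f X = g} = card {z \<in> {0..<int p}. g(u := z) \<in> solutions (insert u X)}"
    if g: "g \<in> solutions X" for g
  proof (rule bij_betw_same_card [of "\<lambda>f. f u"], rule bij_betw_byWitness [where f' = "\<lambda>z. g(u := z)"])
    have up: "g(u := f u) = f" if "f \<in> insert u X \<rightarrow>\<^sub>E {0..<int p}" "restrict f X = g" for f
    proof
      fix x
      show "(g(u := f u)) x = f x"
        using that(1) fun_cong [OF that(2), of x] by (cases "x \<in> X") (auto simp: PiE_def extensional_def)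
    qed
    show "\<forall>f\<in>{f \<in> solutions (insert u X). restrict f X = g}. g(u := f u) = f"
      using up by (auto simp: solutions_def)
    show "(\<lambda>f. f u) ` {f \<in> solutions (insert u X). restrict f X = g} \<subseteq> {z \<in> {0..<int p}. g(u := z) \<in> solutions (insert u X)}"
    proof clarify
      fix f assume f: "f \<in> solutions (insert u X)" "g = restrict f X"
      then have "f \<in> insert u X \<rightarrow>\<^sub>E {0..<int p}" by (simp add: solutions_def)
      then show "f u \<in> {0..<int p} \<and> (restrict f X)(u := f u) \<in> solutions (insert u X)"
        using up [of f] f by auto
    qed
    have "restrict (g(u := z)) X = g" for z
      using g u by (auto simp: solutions_def fun_eq_iff PiE_def extensional_def)
    then show "(\<lambda>z. g(u := z)) ` {z \<in> {0..<int p}. g(u := z) \<in> solutions (insert u X)} \<subseteq> {f \<in> solutions (insert u X). restrict f X = g}"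
      by auto
  qed auto
  have ext: "g(u := z) \<in> solutions (insert u X) \<longleftrightarrow>
      (\<forall>(a, d)\<in>eqs (insert u X). [a u * z + (\<Sum>v\<in>X. a v * g v) = d] (mod int p))"
    if g: "g \<in> solutions X" and z: "z \<in> {0..<int p}" for g z
  proof -
    have "g(u := z) \<in> insert u X \<rightarrow>\<^sub>E {0..<int p}" using g z by (auto simp: solutions_def intro!: PiE_fun_upd)
    moreover have "(\<Sum>v\<in>insert u X. a v * (g(u := z)) v) = a u * z + (\<Sum>v\<in>X. a v * g v)" for a
      using finX u by (subst sum.insert) (auto intro!: sum.cong)
    ultimately show ?thesis by (simp add: solutions_def)
  qed
  show thesis
  proof (cases "\<forall>(a, d)\<in>eqs (insert u X). int p dvd a u")
    case True
    then have e: "eqs (insert u X) = eqs X" by (auto simp: eqs_def)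
    have all: "g(u := z) \<in> solutions (insert u X)" if g: "g \<in> solutions X" and z: "z \<in> {0..<int p}" for g z
    proof -
      have "[a u * z + (\<Sum>v\<in>X. a v * g v) = d] (mod int p)" if ad: "(a, d) \<in> eqs X" for a d
      proof -
        have "[a u * z = 0] (mod int p)" using True ad e by (auto simp: cong_0_iff)
        from cong_add [OF this solutions_cong [OF g ad]] show ?thesis by simp
      qed
      then show ?thesis using ext [OF g z] e by auto
    qed
    show thesis
    proof (rule that [of p])
      fix g assume g: "g \<in> solutions X"
      have "{z \<in> {0..<int p}. g(u := z) \<in> solutions (insert u X)} = {0..<int p}" using all [OF g] by blast
      then show "card {f \<in> solutions (insert u X). restrict f X = g} = p" using bij [OF g] by simp
    qed simp
  next
    case False
    then obtain a0 d0 where ad0: "(a0, d0) \<in> eqs (insert u X)" and na0: "\<not> int p dvd a0 u" by auto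
    have cop: "coprime (a0 u) (int p)"
      using prime na0 by (simp add: coprime_commute prime_imp_coprime)
    then obtain b where b: "[a0 u * b = 1] (mod int p)" using cong_solve_coprime_int by blast
    show thesis
    proof (rule that [of 1])
      fix g assume g: "g \<in> solutions X"
      define z0 where "z0 = b * (d0 - (\<Sum>v\<in>X. a0 v * g v)) mod int p"
      have z0: "z0 \<in> {0..<int p}" using p_gt_1 by (simp add: z0_def)
      have sol0: "[a0 u * z0 + (\<Sum>v\<in>X. a0 v * g v) = d0] (mod int p)"
      proof -
        have "[a0 u * z0 = a0 u * (b * (d0 - (\<Sum>v\<in>X. a0 v * g v)))] (mod int p)"
          unfolding z0_def by (simp add: cong_def mod_mult_right_eq)
        also have "a0 u * (b * (d0 - (\<Sum>v\<in>X. a0 v * g v))) = (a0 u * b) * (d0 - (\<Sum>v\<in>X. a0 v * g v))"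
          by (simp add: mult.assoc)
        also have "[\<dots> = 1 * (d0 - (\<Sum>v\<in>X. a0 v * g v))] (mod int p)"
          using b by (rule cong_scalar_right)
        finally have "[a0 u * z0 + (\<Sum>v\<in>X. a0 v * g v) = 1 * (d0 - (\<Sum>v\<in>X. a0 v * g v)) + (\<Sum>v\<in>X. a0 v * g v)] (mod int p)"
          by (rule cong_add) simp
        then show ?thesis by simp
      qed
      have "g(u := z0) \<in> solutions (insert u X)"
      proof -
        have "[a u * z0 + (\<Sum>v\<in>X. a v * g v) = d] (mod int p)" if ad: "(a, d) \<in> eqs (insert u X)" for a d
        proof -
          \<comment> \<open>One elimination step with the pivot \<open>a0\<close>: the coefficient
            at \<open>u\<close> becomes 0 modulo \<open>p\<close>. Both equations live on at most
            \<open>K\<close> variables, so \<open>combine\<close> keeps the result in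
            \<open>L\<close>.\<close>
          define m where "m = - (a u * b)"
          have m: "[a u + m * a0 u = 0] (mod int p)"
          proof -
            have "a u + m * a0 u = a u * (1 - a0 u * b)" by (simp add: m_def algebra_simps)
            moreover have "int p dvd 1 - a0 u * b" using b by (simp add: cong_iff_dvd_diff dvd_diff_commute)
            ultimately show ?thesis by (simp add: cong_0_iff)
          qed
          have "(\<lambda>v. a v + m * a0 v, d + m * d0) \<in> L"
            by (rule combine [of "insert u X"]) (use V card ad ad0 in \<open>auto simp: eqs_def\<close>)
          moreover have "int p dvd a v + m * a0 v" if "v \<notin> X" for v
            using that ad ad0 m by (cases "v = u") (auto simp: eqs_def cong_0_iff)
          ultimately have "(\<lambda>v. a v + m * a0 v, d + m * d0) \<in> eqs X" by (simp add: eqs_def)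
          from solutions_cong [OF g this] have "[(\<Sum>v\<in>X. (a v + m * a0 v) * g v) = d + m * d0] (mod int p)" .
          moreover have "[(a u + m * a0 u) * z0 = 0 * z0] (mod int p)" using m by (rule cong_scalar_right)
          ultimately have "[(a u + m * a0 u) * z0 + (\<Sum>v\<in>X. (a v + m * a0 v) * g v) = 0 * z0 + (d + m * d0)] (mod int p)"
            by (intro cong_add)
          then have 1: "[a u * z0 + (\<Sum>v\<in>X. a v * g v) + m * (a0 u * z0 + (\<Sum>v\<in>X. a0 v * g v)) = d + m * d0] (mod int p)"
            by (simp add: algebra_simps sum.distrib sum_distrib_left)
          have "[m * (a0 u * z0 + (\<Sum>v\<in>X. a0 v * g v)) = m * d0] (mod int p)"
            using sol0 by (rule cong_scalar_left)
          from cong_diff [OF 1 this] show ?thesis by simp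
        qed
        then show ?thesis using ext [OF g z0] by auto
      qed
      moreover have "z = z0" if z: "z \<in> {0..<int p}" "g(u := z) \<in> solutions (insert u X)" for z
      proof -
        have "[a0 u * z + (\<Sum>v\<in>X. a0 v * g v) = d0] (mod int p)" using ext [OF g z(1)] z(2) ad0 by auto
        from cong_trans [OF this cong_sym [OF sol0]] have "[a0 u * z = a0 u * z0] (mod int p)"
          by (simp add: cong_add_rcancel)
        then have "[z = z0] (mod int p)" using cop by (simp add: cong_mult_lcancel)
        then show ?thesis using z z0 by (auto simp: cong_def)
      qed
      ultimately have "{z \<in> {0..<int p}. g(u := z) \<in> solutions (insert u X)} = {z0}" using z0 by blast
      then show "card {f \<in> solutions (insert u X). restrict f X = g} = 1" using bij [OF g] by simp
    qed simp
  qed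
qed

text \<open>This is where \<open>consistent\<close> enters: a derivable equation without variables
  must not be a contradiction.\<close>

lemma solutions_empty: "solutions {} = {\<lambda>_. undefined}"
  using consistent by (auto simp: solutions_def eqs_def cong_iff_dvd_diff)

lemma card_solutions_insert:
  assumes "finite X" "\<And>g. g \<in> solutions X \<Longrightarrow> card {f \<in> solutions (insert u X). restrict f X = g} = N"
  shows "card (solutions (insert u X)) = N * card (solutions X)"
proof -
  have "card (solutions (insert u X)) = (\<Sum>f\<in>solutions (insert u X). 1)" by simp
  also have "\<dots> = (\<Sum>g\<in>solutions X. \<Sum>f\<in>{f \<in> solutions (insert u X). restrict f X = g}. 1)"
    by (rule sum.group [symmetric]) (use assms(1) finite_solutions solutions_restrict in auto)
  finally show ?thesis using assms(2) by simp
qed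

lemma card_solutions_power:
  assumes "X \<subseteq> V" "card X \<le> K"
  shows "\<exists>e\<le>card X. card (solutions X) = p ^ e"
proof -
  have "finite X" using assms fin finite_subset by blast
  then show ?thesis using assms
  proof (induction X rule: finite_induct)
    case empty
    then show ?case by (simp add: solutions_empty)
  next
    case (insert u X)
    then obtain e where e: "e \<le> card X" "card (solutions X) = p ^ e" by auto
    obtain N where N: "N = 1 \<or> N = p"
      "\<And>g. g \<in> solutions X \<Longrightarrow> card {f \<in> solutions (insert u X). restrict f X = g} = N"
      by (rule extension_count [OF insert.prems(1) insert.hyps(2) insert.prems(2)]) (rule that)
    have "card (solutions (insert u X)) = N * p ^ e" using card_solutions_insert N insert e by simp
    then have "card (solutions (insert u X)) = p ^ e \<or> card (solutions (insert u X)) = p ^ Suc e" using N by auto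
    then show ?case using e insert by (auto intro: exI [of _ e] exI [of _ "Suc e"])
  qed
qed

text \<open>If \<open>X\<close> has \<open>c\<close> solutions, then dropping \<open>u\<close>
  merges \<open>N\<close> solutions of weight \<open>p ^ K / (N c)\<close> into one of weight
  \<open>p ^ K / c\<close>. A map that is no solution does not extend to one.\<close>

lemma weights_solution_weight: "weights K V {0..<int p} (int p ^ K) solution_weight"
proof (rule weights_from_steps [OF fin])
  show "solution_weight {} (\<lambda>_. undefined) = int p ^ K" by (simp add: solution_weight_def solutions_empty)
  fix X u g
  assume V: "insert u X \<subseteq> V" and u: "u \<notin> X" and card: "card (insert u X) \<le> K"
    and g: "g \<in> X \<rightarrow>\<^sub>E {0..<int p}"
  have finX: "finite X" using V by (auto intro: finite_subset [OF _ fin])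
  have cX: "X \<subseteq> V" "card X \<le> K" using V card finX u by auto
  let ?F = "{f \<in> insert u X \<rightarrow>\<^sub>E {0..<int p}. restrict f X = g}"
  have fF: "finite ?F" by (rule finite_subset [OF _ finite_PiE [of "insert u X" "\<lambda>_. {0..<int p}"]]) (use finX in auto)
  have "(\<Sum>f\<in>?F. solution_weight (insert u X) f) = (\<Sum>f\<in>{f \<in> solutions (insert u X). restrict f X = g}. solution_weight (insert u X) f)"
    by (rule sum.mono_neutral_right) (use fF in \<open>auto simp: solution_weight_def solutions_def\<close>)
  also have "\<dots> = solution_weight X g"
  proof (cases "g \<in> solutions X")
    case True
    obtain N where N: "N = 1 \<or> N = p"
      "\<And>g. g \<in> solutions X \<Longrightarrow> card {f \<in> solutions (insert u X). restrict f X = g} = N"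
      by (rule extension_count [OF V u card]) (rule that)
    have cs: "card (solutions (insert u X)) = N * card (solutions X)" using card_solutions_insert [OF finX] N by simp
    obtain e where e: "e \<le> card (insert u X)" "card (solutions (insert u X)) = p ^ e"
      using card_solutions_power [OF V card] by blast
    have Npos: "0 < N" using N p_gt_1 by auto
    have "p ^ e dvd p ^ K" using e card by (intro le_imp_power_dvd) simp
    then obtain q where q: "p ^ K = N * card (solutions X) * q" using e(2) cs by (metis dvdE)
    have "card (solutions X) \<noteq> 0" using True finite_solutions [OF finX] by auto
    then have "N * (p ^ K div card (solutions (insert u X))) = p ^ K div card (solutions X)"
      unfolding cs q using Npos by simp
    moreover have "(\<Sum>f\<in>{f \<in> solutions (insert u X). restrict f X = g}. solution_weight (insert u X) f)
        = int (N * (p ^ K div card (solutions (insert u X))))"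
      using N(2) [OF True] by (simp add: solution_weight_def)
    ultimately show ?thesis using True by (simp add: solution_weight_def)
  next
    case False
    then have "{f \<in> solutions (insert u X). restrict f X = g} = {}"
      using solutions_restrict [of _ "insert u X" X] finX by auto
    then have "(\<Sum>f\<in>{f \<in> solutions (insert u X). restrict f X = g}. solution_weight (insert u X) f) = 0"
      by (simp only: sum.empty)
    then show ?thesis using False by (simp add: solution_weight_def)
  qed
  finally show "(\<Sum>f\<in>?F. solution_weight (insert u X) f) = solution_weight X g" .
qed simp

lemma solution_weight_nonneg: "0 \<le> solution_weight X f"
  by (simp add: solution_weight_def)

end

section \<open>Expanding linear systems\<close>

text \<open>Since 3 exceeds half of 5, the variables of \<open>U\<close> cannot all occur twice: on
  average at least \<open>2 * 3 - 5 = 1\<close> variable per equation occurs exactly once.\<close>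

definition expanding :: "nat \<Rightarrow> nat \<Rightarrow> nat \<Rightarrow> (nat \<Rightarrow> nat \<Rightarrow> nat) \<Rightarrow> bool" where
  "expanding m n r T \<longleftrightarrow> (\<forall>j<m. \<forall>i<5. T j i < n) \<and>
     (\<forall>U. U \<subseteq> {..<m} \<and> U \<noteq> {} \<and> card U \<le> r \<longrightarrow>
        3 * card U \<le> card ((\<lambda>(j, i). T j i) ` (U \<times> {..<5})))"

text \<open>\<open>s ^ s / fact s\<close> is a single term of the exponential series at
  \<open>s\<close>, and e is at most 3.\<close>

lemma power_le_fact: "s ^ s \<le> 3 ^ s * (fact s :: nat)"
proof -
  have "real s ^ s / fact s \<le> (\<Sum>n. real s ^ n / fact n)"
    using sum_le_suminf [OF summable_exp [of "real s"], of "{s}"] by (simp add: divide_inverse mult.commute)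
  also have "\<dots> = exp (real s)" by (simp add: exp_def divide_inverse mult.commute)
  also have "\<dots> = exp 1 ^ s" by (simp add: exp_of_nat_mult [symmetric])
  also have "\<dots> \<le> 3 ^ s" by (intro power_mono exp_le) simp
  finally have "real s ^ s \<le> 3 ^ s * fact s" by (simp add: pos_divide_le_eq)
  then have "real (s ^ s) \<le> real (3 ^ s * fact s)" by simp
  then show ?thesis by (simp only: of_nat_le_iff)
qed

text \<open>The union bound for random \<open>T\<close>: the left-hand factor counts the sets \<open>U\<close> of \<open>s\<close> equations, the sets of
  \<open>3 s\<close> variables, and the ways to confine the \<open>5 s\<close> entries of \<open>U\<close> to such a set.\<close>

lemma bad_count_bound:
  assumes m: "m \<le> 2 * n" and s: "2916 * s \<le> n"
  shows "2 ^ s * ((m choose s) * (n choose (3 * s)) * (3 * s) ^ (5 * s)) \<le> n ^ (5 * s)"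
proof -
  have 1: "(m choose s) * s ^ s \<le> (6 * n) ^ s"
  proof -
    have "(m choose s) * s ^ s \<le> (m choose s) * (3 ^ s * fact s)" using power_le_fact by (intro mult_left_mono) auto
    also have "\<dots> = 3 ^ s * ((m choose s) * fact s)" by simp
    also have "\<dots> \<le> 3 ^ s * m ^ s" by (intro mult_left_mono binomial_fact_pow) auto
    also have "\<dots> \<le> 3 ^ s * (2 * n) ^ s" using m by (intro mult_left_mono power_mono) auto
    also have "\<dots> = (6 * n) ^ s" unfolding power_mult_distrib [symmetric] by simp
    finally show ?thesis .
  qed
  have 2: "(n choose (3 * s)) * s ^ (3 * s) \<le> n ^ (3 * s)"
  proof -
    have "3 ^ (3 * s) * s ^ (3 * s) \<le> 3 ^ (3 * s) * (fact (3 * s) :: nat)"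
      using power_le_fact [of "3 * s"] by (simp add: power_mult_distrib)
    then have "s ^ (3 * s) \<le> fact (3 * s)" by simp
    then have "(n choose (3 * s)) * s ^ (3 * s) \<le> (n choose (3 * s)) * fact (3 * s)" by (intro mult_left_mono) auto
    also have "\<dots> \<le> n ^ (3 * s)" by (rule binomial_fact_pow)
    finally show ?thesis .
  qed
  \<comment> \<open>Of the five factors \<open>s\<close> per equation, one pays for
    \<open>m choose s\<close> and three for \<open>n choose (3 * s)\<close>. The last is played off
    against a factor \<open>n\<close>, with constant \<open>2 * 3 ^ 5 * 6 = 2916\<close>. The
    leading \<open>2 ^ s\<close> makes the union bound geometric.\<close>
  have "2 ^ s * ((m choose s) * (n choose (3 * s)) * (3 * s) ^ (5 * s))
      = 2 ^ s * 3 ^ (5 * s) * s ^ s * (((m choose s) * s ^ s) * ((n choose (3 * s)) * s ^ (3 * s)))"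
  proof -
    have "s ^ (5 * s) = s ^ s * s ^ s * s ^ (3 * s)" by (simp flip: power_add)
    then show ?thesis by (simp add: power_mult_distrib mult_ac)
  qed
  also have "\<dots> \<le> 2 ^ s * 3 ^ (5 * s) * s ^ s * ((6 * n) ^ s * n ^ (3 * s))"
    using 1 2 by (intro mult_left_mono mult_mono) auto
  also have "\<dots> = (2916 * s) ^ s * n ^ (4 * s)"
  proof -
    have "n ^ (4 * s) = n ^ s * n ^ (3 * s)" by (simp flip: power_add)
    moreover have "(2916 * s) ^ s = 2 ^ s * 3 ^ (5 * s) * 6 ^ s * s ^ s"
      unfolding power_mult power_mult_distrib [symmetric] by simp
    moreover have "(6 * n) ^ s = 6 ^ s * n ^ s" by (rule power_mult_distrib)
    ultimately show ?thesis by (simp only: mult_ac)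
  qed
  also have "\<dots> \<le> n ^ s * n ^ (4 * s)" using s by (intro mult_right_mono power_mono) auto
  also have "\<dots> = n ^ (5 * s)" by (simp flip: power_add)
  finally show ?thesis .
qed

lemma card_confined:
  assumes "U \<subseteq> {..<m}" "W \<subseteq> {..<n::nat}"
  shows "card (\<Pi>\<^sub>E x\<in>{..<m} \<times> {..<5::nat}. if fst x \<in> U then W else {..<n})
    = card W ^ (5 * card U) * n ^ (5 * (m - card U))"
proof -
  have fU: "finite U" using assms finite_subset by blast
  have e: "{..<m} \<times> {..<5::nat} = U \<times> {..<5} \<union> ({..<m} - U) \<times> {..<5}" using assms by auto
  have "card (\<Pi>\<^sub>E x\<in>{..<m} \<times> {..<5::nat}. if fst x \<in> U then W else {..<n})
      = (\<Prod>x\<in>{..<m} \<times> {..<5::nat}. card (if fst x \<in> U then W else {..<n}))"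
    by (rule card_PiE) simp
  also have "\<dots> = (\<Prod>x\<in>U \<times> {..<5::nat}. card (if fst x \<in> U then W else {..<n}))
      * (\<Prod>x\<in>({..<m} - U) \<times> {..<5::nat}. card (if fst x \<in> U then W else {..<n}))"
    unfolding e by (rule prod.union_disjoint) (use fU in auto)
  also have "(\<Prod>x\<in>U \<times> {..<5::nat}. card (if fst x \<in> U then W else {..<n})) = (\<Prod>x\<in>U \<times> {..<5::nat}. card W)"
    by (rule prod.cong) auto
  also have "(\<Prod>x\<in>({..<m} - U) \<times> {..<5::nat}. card (if fst x \<in> U then W else {..<n})) = (\<Prod>x\<in>({..<m} - U) \<times> {..<5::nat}. n)"
    by (rule prod.cong) auto
  finally show ?thesis
    using assms fU by (simp add: card_cartesian_product card_Diff_subset mult.commute)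
qed

text \<open>Among the \<open>n ^ (5 * m)\<close> incidence functions, at most a fraction
  \<open>(1/2) ^ s\<close> fails at some set of \<open>s\<close> equations. For \<open>s\<close>
  from 1 to \<open>r\<close> these fractions add up to less than 1.\<close>

lemma expanding_exists:
  assumes n: "0 < n" and m: "m \<le> 2 * n" and r: "2916 * r \<le> n"
  shows "\<exists>T. expanding m n r T"
proof -
  let ?I = "{..<m} \<times> {..<5::nat}"
  let ?N = "n ^ (5 * m)"
  define conf where "conf = (\<lambda>(U, W). \<Pi>\<^sub>E x\<in>?I. if fst x \<in> U then W else {..<n})"
  define prs where "prs s = {U. U \<subseteq> {..<m} \<and> card U = s} \<times> {W. W \<subseteq> {..<n} \<and> card W = 3 * s}" for s
  define bad where "bad = (\<Union>s\<in>{1..r}. \<Union>q\<in>prs s. conf q)"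
  have fprs: "finite (prs s)" for s unfolding prs_def by (intro finite_cartesian_product) auto
  have cprs: "card (prs s) = (m choose s) * (n choose (3 * s))" for s
    unfolding prs_def by (simp add: card_cartesian_product n_subsets)
  have cconf: "card (conf q) = (3 * s) ^ (5 * s) * n ^ (5 * (m - s))" if "q \<in> prs s" for q s
    using that by (auto simp: prs_def conf_def card_confined)
  have "real (card bad) \<le> (\<Sum>s\<in>{1..r}. real (card (\<Union>q\<in>prs s. conf q)))"
    unfolding bad_def using card_UN_le [of "{1..r}" "\<lambda>s. \<Union>q\<in>prs s. conf q"]
    by (metis finite_atLeastAtMost of_nat_le_iff of_nat_sum)
  also have "\<dots> \<le> (\<Sum>s\<in>{1..r}. real ?N * (1/2) ^ s)"
  proof (rule sum_mono)
    fix s assume s: "s \<in> {1..r}"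
    show "real (card (\<Union>q\<in>prs s. conf q)) \<le> real ?N * (1/2) ^ s"
    proof (cases "s \<le> m")
      case True
      have "card (\<Union>q\<in>prs s. conf q) \<le> (\<Sum>q\<in>prs s. card (conf q))" by (rule card_UN_le [OF fprs])
      also have "\<dots> = (m choose s) * (n choose (3 * s)) * ((3 * s) ^ (5 * s) * n ^ (5 * (m - s)))"
        using cconf by (simp add: cprs)
      finally have "2 ^ s * card (\<Union>q\<in>prs s. conf q)
          \<le> 2 ^ s * ((m choose s) * (n choose (3 * s)) * (3 * s) ^ (5 * s)) * n ^ (5 * (m - s))"
        by (simp add: mult.assoc)
      also have "\<dots> \<le> n ^ (5 * s) * n ^ (5 * (m - s))"
        by (intro mult_right_mono bad_count_bound m) (use s r in auto)
      also have "\<dots> = ?N" using True by (simp flip: power_add add: algebra_simps)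
      finally have "real (2 ^ s * card (\<Union>q\<in>prs s. conf q)) \<le> real ?N" by (simp only: of_nat_le_iff)
      then show ?thesis by (simp add: power_one_over field_simps)
    next
      case False
      then have "prs s = {}" by (auto simp: prs_def dest: card_mono [rotated])
      then show ?thesis by simp
    qed
  qed
  also have "\<dots> = real ?N * (1 - (1/2) ^ r)"
  proof -
    have "(\<Sum>s\<in>{1..r}. (1/2::real) ^ s) = 1 - (1/2) ^ r" by (induction r) auto
    then show ?thesis by (simp add: sum_distrib_left [symmetric])
  qed
  also have "\<dots> < real ?N" using n by (simp add: field_simps)
  finally have "card bad < card (?I \<rightarrow>\<^sub>E {..<n})" by (simp add: card_PiE card_cartesian_product mult.commute)
  moreover have "finite bad"
  proof -
    have "finite (conf q)" if "q \<in> prs s" for q s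
      using that finite_subset [OF _ finite_lessThan [of n]]
      unfolding conf_def prs_def by (auto intro!: finite_PiE)
    then show ?thesis unfolding bad_def using fprs by blast
  qed
  ultimately obtain F where F: "F \<in> ?I \<rightarrow>\<^sub>E {..<n}" "F \<notin> bad"
    by (meson card_mono not_le subsetI)
  have "3 * card U \<le> card (F ` (U \<times> {..<5}))" if U: "U \<subseteq> {..<m}" "U \<noteq> {}" "card U \<le> r" for U
  proof (rule ccontr)
    assume less: "\<not> 3 * card U \<le> card (F ` (U \<times> {..<5}))"
    have im: "F ` (U \<times> {..<5}) \<subseteq> {..<n}" using F U by (auto simp: PiE_iff)
    have fU: "finite U" using U finite_subset by blast
    \<comment> \<open>A too small image is padded to exactly \<open>3 * card U\<close> variables, to
      match the pairs counted in \<open>bad\<close>; the bound on \<open>r\<close> leaves room for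
      this.\<close>
    have "3 * card U \<le> card {..<n}" using U r by simp
    then obtain W where W: "F ` (U \<times> {..<5}) \<subseteq> W" "W \<subseteq> {..<n}" "card W = 3 * card U"
      using exists_subset_between [of "F ` (U \<times> {..<5})" "3 * card U" "{..<n}"] im less by auto
    have "F \<in> conf (U, W)" using F W by (auto simp: conf_def PiE_iff)
    moreover have "(U, W) \<in> prs (card U)" using U W by (simp add: prs_def)
    moreover have "card U \<in> {1..r}" using U fU by (simp add: Suc_le_eq card_gt_0_iff)
    ultimately show False using F(2) unfolding bad_def by blast
  qed
  then have "expanding m n r (\<lambda>j i. F (j, i))"
    using F by (auto simp: expanding_def PiE_iff)
  then show ?thesis by blast
qed

text \<open>Pigeonhole: \<open>p ^ n\<close> assignments cannot reach all \<open>p ^ m\<close>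
  right-hand sides. As \<open>T\<close> is arbitrary, one pattern serves both moduli.\<close>

lemma overdetermined_unsolvable:
  assumes "n < m" "2 \<le> p" and T: "\<And>j i. j < m \<Longrightarrow> i < l \<Longrightarrow> T j i < n"
  shows "\<exists>c. \<forall>x. \<exists>j<m. \<not> [(\<Sum>i<l. x (T j i :: nat)) = c j] (mod int p)"
proof -
  define \<Phi> where "\<Phi> x = (\<lambda>j\<in>{..<m}. (\<Sum>i<l. x (T j i)) mod int p)" for x
  let ?X = "{..<n} \<rightarrow>\<^sub>E {0..<int p}" and ?C = "{..<m} \<rightarrow>\<^sub>E {0..<int p}"
  have "card (\<Phi> ` ?X) \<le> card ?X" by (intro card_image_le finite_PiE) auto
  also have "\<dots> < card ?C" using assms by (simp add: card_PiE)
  finally have "\<Phi> ` ?X \<noteq> ?C" by auto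
  moreover have "\<Phi> ` ?X \<subseteq> ?C" using assms by (auto simp: \<Phi>_def)
  ultimately obtain c where c: "c \<in> ?C" "c \<notin> \<Phi> ` ?X" by blast
  have "\<exists>j<m. \<not> [(\<Sum>i<l. x (T j i)) = c j] (mod int p)" for x
  proof (rule ccontr)
    assume "\<not> ?thesis"
    then have all: "[(\<Sum>i<l. x (T j i)) = c j] (mod int p)" if "j < m" for j using that by blast
    let ?y = "\<lambda>u\<in>{..<n}. x u mod int p"
    have "\<Phi> ?y = c"
    proof
      fix j
      show "\<Phi> ?y j = c j"
      proof (cases "j < m")
        case True
        have "(\<Sum>i<l. ?y (T j i)) = (\<Sum>i<l. x (T j i) mod int p)" using T [OF True] by (intro sum.cong) auto
        then have "\<Phi> ?y j = (\<Sum>i<l. x (T j i)) mod int p" using True by (simp add: \<Phi>_def mod_sum_eq)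
        also have "\<dots> = c j mod int p" using all [OF True] by (simp add: cong_def)
        also have "\<dots> = c j" using c True by (auto simp: PiE_iff)
        finally show ?thesis .
      next
        case False
        then show ?thesis using c by (auto simp: \<Phi>_def PiE_def extensional_def)
      qed
    qed
    moreover have "?y \<in> ?X" using assms by auto
    ultimately show False using c by blast
  qed
  then show ?thesis by blast
qed

text \<open>Double counting: an image point hit only once absorbs one element of \<open>S\<close>,
  every other at least two. So \<open>2 * 3 * c\<close> is at most \<open>5 * c\<close> plus the
  number of points hit once.\<close>

lemma unique_neighbours:
  assumes fin: "finite S" and im: "3 * c \<le> card (f ` S)" and S: "card S = 5 * c"
  shows "c \<le> card {u. \<exists>!x. x \<in> S \<and> f x = u}"
proof -
  let ?Q = "{u. \<exists>!x. x \<in> S \<and> f x = u}"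
  let ?fib = "\<lambda>u. {x \<in> S. f x = u}"
  have Q: "?Q \<subseteq> f ` S" by blast
  have "2 - (if u \<in> ?Q then 1 else 0) \<le> card (?fib u)" if u: "u \<in> f ` S" for u
  proof -
    have pos: "0 < card (?fib u)" using u fin by (auto simp: card_gt_0_iff)
    have "u \<in> ?Q" if c1: "card (?fib u) = 1"
    proof -
      obtain x where "?fib u = {x}" using c1 by (rule card_1_singletonE)
      then have "\<exists>!x. x \<in> S \<and> f x = u" by (auto simp: set_eq_iff)
      then show ?thesis by blast
    qed
    then show ?thesis using pos by (cases "card (?fib u) = 1") auto
  qed
  then have "(\<Sum>u\<in>f ` S. 2 - (if u \<in> ?Q then 1 else 0)) \<le> (\<Sum>u\<in>f ` S. card (?fib u))"
    by (rule sum_mono)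
  also have "\<dots> = card S"
    using sum.group [of S "f ` S" f "\<lambda>_. 1::nat"] fin by simp
  finally have le: "(\<Sum>u\<in>f ` S. 2 - (if u \<in> ?Q then 1 else 0)) \<le> card S" .
  have "2 * card (f ` S) = (\<Sum>u\<in>f ` S. (2 - (if u \<in> ?Q then 1 else 0)) + (if u \<in> ?Q then 1 else 0))"
    by (simp add: sum.If_cases)
  also have "\<dots> = (\<Sum>u\<in>f ` S. 2 - (if u \<in> ?Q then 1 else 0)) + (\<Sum>u\<in>f ` S. if u \<in> ?Q then 1 else 0)"
    by (rule sum.distrib)
  also have "(\<Sum>u\<in>f ` S. if u \<in> ?Q then 1 else 0) = card (f ` S \<inter> ?Q)"
    using fin by (simp add: sum.If_cases)
  also have "f ` S \<inter> ?Q = ?Q" using Q by blast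
  finally show ?thesis using le im S by linarith
qed

text \<open>Coefficient of the variable \<open>u\<close> in the combination, with multipliers \<open>y\<close>, of the left-hand sides
  \<open>\<Sum>i<5. x (T j i)\<close>, where entries of \<open>T j\<close> may repeat.\<close>

definition lin_coef :: "nat \<Rightarrow> (nat \<Rightarrow> nat \<Rightarrow> nat) \<Rightarrow> (nat \<Rightarrow> int) \<Rightarrow> nat \<Rightarrow> int" where
  "lin_coef m T y u = (\<Sum>j<m. \<Sum>i<5. if T j i = u then y j else 0)"

lemma lin_coef_add: "lin_coef m T (\<lambda>j. y j + k * y' j) u = lin_coef m T y u + k * lin_coef m T y' u"
  unfolding lin_coef_def sum_distrib_left sum.distrib [symmetric] by (intro sum.cong) auto

text \<open>A variable that occurs exactly once among the equations with nonzero multiplier has nonzero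
  coefficient, and by expansion there are at least as many of them as such equations. Hence a
  combination on few variables uses few equations, which makes \<open>lin_eqs\<close> closed under combinations.\<close>

lemma lin_coef_support:
  assumes T: "expanding m n r T" and r: "card {j. j < m \<and> \<not> p dvd y j} \<le> r"
    and X: "finite X" "\<And>u. u \<notin> X \<Longrightarrow> p dvd lin_coef m T y u"
  shows "card {j. j < m \<and> \<not> p dvd y j} \<le> card X"
proof (cases "{j. j < m \<and> \<not> p dvd y j} = {}")
  case True
  then show ?thesis by (simp only: card.empty)
next
  case False
  let ?U = "{j. j < m \<and> \<not> p dvd y j}"
  let ?S = "?U \<times> {..<5::nat}" and ?f = "\<lambda>(j, i). T j i"
  have fU: "finite ?U" by simp
  have U: "?U \<subseteq> {..<m}" by auto
  have im: "3 * card ?U \<le> card (?f ` ?S)"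
    using T unfolding expanding_def by (elim conjE allE [of _ ?U] impE) (intro conjI U False r)
  have cS: "card ?S = 5 * card ?U" unfolding card_cartesian_product by simp
  have "card ?U \<le> card {u. \<exists>!x. x \<in> ?S \<and> ?f x = u}"
    by (rule unique_neighbours [OF finite_cartesian_product [OF fU finite_lessThan] im cS])
  also have "\<dots> \<le> card X"
  proof (rule card_mono [OF X(1)], rule subsetI, rule ccontr)
    fix u assume "u \<in> {u. \<exists>!x. x \<in> ?S \<and> ?f x = u}" and nX: "u \<notin> X"
    then obtain x where x: "x \<in> ?S" "?f x = u" and ux: "\<And>x'. x' \<in> ?S \<Longrightarrow> ?f x' = u \<Longrightarrow> x' = x"
      by blast
    obtain j i where xji: "x = (j, i)" by (cases x)
    have ji: "(j, i) \<in> ?S" "T j i = u" using x xji by auto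
    have uniq: "(j', i') = (j, i)" if "(j', i') \<in> ?S" "T j' i' = u" for j' i'
      using ux [of "(j', i')"] that xji by simp
    have "lin_coef m T y u = (\<Sum>x\<in>{..<m} \<times> {..<5}. if ?f x = u then y (fst x) else 0)"
      by (simp add: lin_coef_def sum.cartesian_product case_prod_unfold)
    also have "\<dots> = y j + (\<Sum>x\<in>{..<m} \<times> {..<5} - {(j, i)}. if ?f x = u then y (fst x) else 0)"
      using ji by (subst sum.remove [of _ "(j, i)"]) auto
    finally have e: "lin_coef m T y u = y j + (\<Sum>x\<in>{..<m} \<times> {..<5} - {(j, i)}. if ?f x = u then y (fst x) else 0)" .
    have "p dvd (\<Sum>x\<in>{..<m} \<times> {..<5} - {(j, i)}. if ?f x = u then y (fst x) else 0)"
    proof (rule dvd_sum)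
      fix x assume x: "x \<in> {..<m} \<times> {..<5} - {(j, i)}"
      show "p dvd (if ?f x = u then y (fst x) else 0)"
        using x uniq [of "fst x" "snd x"] by (cases x) auto
    qed
    then have "p dvd y j" using X(2) [OF nX] e by (simp add: dvd_add_left_iff)
    then show False using ji by simp
  qed
  finally show ?thesis .
qed

text \<open>Consequences of at most \<open>r\<close> rows count as derivable. Multipliers divisible
  by \<open>p\<close> are not counted, since they do not matter modulo \<open>p\<close>.\<close>

definition lin_eqs :: "nat \<Rightarrow> nat \<Rightarrow> int \<Rightarrow> (nat \<Rightarrow> nat \<Rightarrow> nat) \<Rightarrow> (nat \<Rightarrow> int) \<Rightarrow> ((nat \<Rightarrow> int) \<times> int) set" where
  "lin_eqs m r p T c = {(lin_coef m T y, \<Sum>j<m. y j * c j) | y. card {j. j < m \<and> \<not> p dvd y j} \<le> r}"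

text \<open>An equation on at most \<open>r div 2\<close> variables stems from at most
  \<open>r div 2\<close> rows, so two of them combine within \<open>r\<close> rows. An equation
  without variables uses no row, so its right-hand side is 0 modulo \<open>p\<close>.\<close>

lemma solution_family_lin_eqs:
  assumes T: "expanding m n r T" and p: "prime p" and V: "finite V"
  shows "solution_family p V (r div 2) (lin_eqs m r (int p) T c)"
proof
  fix X :: "nat set" and a d a' d' k
  assume X: "X \<subseteq> V" "card X \<le> r div 2" and ad: "(a, d) \<in> lin_eqs m r (int p) T c" "(a', d') \<in> lin_eqs m r (int p) T c"
    and s: "\<And>u. u \<notin> X \<Longrightarrow> int p dvd a u" "\<And>u. u \<notin> X \<Longrightarrow> int p dvd a' u"
  let ?U = "\<lambda>y. {j. j < m \<and> \<not> int p dvd y j}"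
  obtain y where y: "a = lin_coef m T y" "d = (\<Sum>j<m. y j * c j)" "card (?U y) \<le> r"
    using ad(1) by (auto simp: lin_eqs_def)
  obtain y' where y': "a' = lin_coef m T y'" "d' = (\<Sum>j<m. y' j * c j)" "card (?U y') \<le> r"
    using ad(2) by (auto simp: lin_eqs_def)
  have fX: "finite X" using X V finite_subset by blast
  have "card (?U y) \<le> card X" "card (?U y') \<le> card X"
    using lin_coef_support [OF T y(3) fX] lin_coef_support [OF T y'(3) fX] s y y' by auto
  moreover have "card (?U (\<lambda>j. y j + k * y' j)) \<le> card (?U y \<union> ?U y')"
    by (rule card_mono) auto
  moreover have "card (?U y \<union> ?U y') \<le> card (?U y) + card (?U y')" by (rule card_Un_le)
  ultimately have "card (?U (\<lambda>j. y j + k * y' j)) \<le> r" using X by linarith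
  moreover have "(\<lambda>u. a u + k * a' u) = lin_coef m T (\<lambda>j. y j + k * y' j)"
    by (rule ext) (simp add: y y' lin_coef_add)
  moreover have "d + k * d' = (\<Sum>j<m. (y j + k * y' j) * c j)"
    by (simp add: y y' algebra_simps sum.distrib sum_distrib_left)
  ultimately show "(\<lambda>u. a u + k * a' u, d + k * d') \<in> lin_eqs m r (int p) T c"
    unfolding lin_eqs_def by blast
next
  fix a d assume ad: "(a, d) \<in> lin_eqs m r (int p) T c" and a: "\<And>u. int p dvd a u"
  let ?U = "\<lambda>y. {j. j < m \<and> \<not> int p dvd y j}"
  obtain y where y: "a = lin_coef m T y" "d = (\<Sum>j<m. y j * c j)" "card (?U y) \<le> r"
    using ad by (auto simp: lin_eqs_def)
  have "card (?U y) \<le> card ({} :: nat set)"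
    by (rule lin_coef_support [OF T y(3)]) (use a y in auto)
  then have "int p dvd y j" if "j < m" for j using that by auto
  then show "int p dvd d" unfolding y by (intro dvd_sum) auto
qed (use p V in auto)

lemma lin_eqs_row:
  assumes "j < m" "1 \<le> r"
  shows "(lin_coef m T (\<lambda>j'. if j' = j then 1 else 0), c j) \<in> lin_eqs m r p T c"
proof -
  have "{j'. j' < m \<and> \<not> p dvd (if j' = j then 1 else 0)} \<subseteq> {j}" by auto
  then have "card {j'. j' < m \<and> \<not> p dvd (if j' = j then 1 else 0)} \<le> card {j}" by (intro card_mono) auto
  moreover have "(\<Sum>j'<m. (if j' = j then 1 else 0) * c j') = c j"
  proof -
    have "(\<Sum>j'<m. (if j' = j then 1 else 0) * c j') = (\<Sum>j'<m. if j' = j then c j' else 0)"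
      by (intro sum.cong) auto
    then show ?thesis using assms by simp
  qed
  ultimately show ?thesis using assms unfolding lin_eqs_def by force
qed

section \<open>A template over the symmetric group\<close>

text \<open>The map \<open>x \<mapsto> e x + w\<close> on the integers mod 6, where the residue \<open>x\<close> is the point \<open>x + 1\<close>.\<close>

definition dih :: "int \<Rightarrow> int \<Rightarrow> nat \<Rightarrow> nat" where
  "dih e w z = (if 1 \<le> z \<and> z \<le> 6 then Suc (nat ((e * (int z - 1) + w) mod 6)) else z)"

lemma dih_comp: "dih e w \<circ> dih e' w' = dih (e * e') (w + e * w')"
proof
  fix z
  show "(dih e w \<circ> dih e' w') z = dih (e * e') (w + e * w') z"
  proof (cases "1 \<le> z \<and> z \<le> 6")
    case True
    let ?v = "(e' * (int z - 1) + w') mod 6"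
    have v: "0 \<le> ?v" "?v < 6" by simp_all
    have "dih e w (Suc (nat ?v)) = Suc (nat ((e * ?v + w) mod 6))"
      using v by (simp add: dih_def)
    also have "(e * ?v + w) mod 6 = (e * e' * (int z - 1) + (w + e * w')) mod 6"
    proof -
      have "(e * ?v + w) mod 6 = (e * (e' * (int z - 1) + w') + w) mod 6"
        by (rule mod_add_cong [OF mod_mult_right_eq refl])
      then show ?thesis by (simp add: algebra_simps)
    qed
    finally show ?thesis using True by (simp add: dih_def)
  qed (auto simp: dih_def)
qed

lemma dih_id: "dih 1 0 = id"
  by (auto simp: dih_def fun_eq_iff)

lemma dih_carrier:
  assumes "e \<in> {1, -1}"
  shows "dih e w \<in> carrier (sym_group 18)"
proof -
  have "e * e = 1" using assms by auto
  then have "dih e w \<circ> dih e (- (e * w)) = id" "dih e (- (e * w)) \<circ> dih e w = id"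
    by (simp_all add: dih_comp dih_id [symmetric] mult.assoc [symmetric])
  then have "bij (dih e w)" using o_bij by blast
  moreover have "dih e w z = z" if "z \<notin> {1..18}" for z using that by (auto simp: dih_def)
  ultimately have "dih e w permutes {1..18}" unfolding permutes_def by (auto simp: bij_iff)
  then show ?thesis by (simp add: sym_group_carrier)
qed

text \<open>The image of residue 0 reveals \<open>w\<close> and that of residue 1 reveals
  \<open>e + w\<close>, while 1 and -1 differ modulo 6.\<close>

lemma dih_eqD:
  assumes "e \<in> {1, -1}" "e' \<in> {1, -1}" "dih e w = dih e' w'"
  shows "e = e'" "[w = w'] (mod 6)"
proof -
  have 1: "w mod 6 = w' mod 6" using fun_cong [OF assms(3), of 1] by (simp add: dih_def eq_nat_nat_iff)
  then show "[w = w'] (mod 6)" by (simp add: cong_def)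
  have "(e + w) mod 6 = (e' + w') mod 6" using fun_cong [OF assms(3), of 2] by (simp add: dih_def eq_nat_nat_iff)
  then have "e mod 6 = e' mod 6" using mod_diff_cong [OF _ 1, of "e + w" "e' + w'"] by simp
  then show "e = e'" using assms(1,2) by auto
qed

text \<open>3 and 4 are the idempotents mod 6 of the factors \<open>\<int>/2\<close> and \<open>\<int>/3\<close>: the sign \<open>e\<close> selects the component of
  \<open>m\<close> that the equation keeps. In \<open>dih_rel\<close>, the first entry of a tuple only contributes its sign.\<close>

definition dih_rhs :: "int \<Rightarrow> int \<Rightarrow> int" where
  "dih_rhs e m = (if e = 1 then 3 * m else 4 * m)"

definition dih_rel :: "int \<Rightarrow> (nat \<Rightarrow> nat) list set" where
  "dih_rel m = {map (\<lambda>i. dih e (w i)) [0..<6] | e w. e \<in> {1, -1} \<and> [(\<Sum>i<5. w (Suc i)) = dih_rhs e m] (mod 6)}"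

definition dih_vocab :: "nat vocab" where
  "dih_vocab = \<lparr>symbols = {..<6}, ar = (\<lambda>_. 6)\<rparr>"

definition dih_template :: "(nat \<Rightarrow> nat, nat) rel_struct" where
  "dih_template = \<lparr>univ = carrier (sym_group 18), rel = (\<lambda>m. dih_rel (int m))\<rparr>"

text \<open>Composition adds \<open>e * w'\<close> to \<open>w\<close>, so the sums in a subgroup
  must obey \<open>D (e * e') = D e + e * D e'\<close>. With \<open>D 1 = 0\<close> this holds for
  every value at \<open>-1\<close>, which is why the right-hand sides for the two signs are
  independent.\<close>

lemma dih_rel_coset:
  fixes m :: int
  defines "P \<equiv> product_group {..<6::nat} (\<lambda>_. sym_group 18)"
  shows "\<exists>\<Delta> \<delta>. subgroup \<Delta> P \<and> \<delta> \<in> carrier P \<and> dih_rel m = (\<lambda>t. map t [0..<6]) ` (\<Delta> #>\<^bsub>P\<^esub> \<delta>)"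
proof -
  interpret P: group P unfolding P_def by (intro product_group sym_group_is_group)
  \<comment> \<open>Translation by \<open>w0\<close> contributes \<open>e * (3 * m)\<close>; for
    \<open>e = -1\<close> the subgroup needs \<open>7 * m\<close> to arrive at
    \<open>4 * m\<close>.\<close>
  define D :: "int \<Rightarrow> int" where "D e = (if e = 1 then 0 else 7 * m)" for e
  define tup where "tup e w = (\<lambda>i\<in>{..<6::nat}. dih e (w i))" for e and w :: "nat \<Rightarrow> int"
  define \<Delta> where "\<Delta> = {tup e w | e w. e \<in> {1, -1} \<and> [(\<Sum>i<5. w (Suc i)) = D e] (mod 6)}"
  define w0 :: "nat \<Rightarrow> int" where "w0 i = (if i = 1 then 3 * m else 0)" for i
  have w0: "(\<Sum>i<5. w0 (Suc i)) = 3 * m" by (simp add: w0_def)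
  have tup_carrier: "tup e w \<in> carrier P" if "e \<in> {1, -1}" for e w
    using dih_carrier [OF that] by (auto simp: tup_def P_def)
  have tup_mult: "tup e w \<otimes>\<^bsub>P\<^esub> tup e' w' = tup (e * e') (\<lambda>i. w i + e * w' i)" for e w e' w'
    by (auto simp: tup_def P_def fun_eq_iff sym_group_mult dih_comp [unfolded o_def fun_eq_iff] o_def)
  have tup_one: "tup 1 (\<lambda>_. 0) = \<one>\<^bsub>P\<^esub>"
    by (auto simp: tup_def P_def sym_group_one dih_id)
  have "subgroup \<Delta> P"
  proof (rule P.subgroupI)
    show "\<Delta> \<subseteq> carrier P" using tup_carrier by (auto simp: \<Delta>_def)
    have "tup 1 (\<lambda>_. 0) \<in> \<Delta>" unfolding \<Delta>_def D_def by (intro CollectI exI conjI refl) auto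
    then show "\<Delta> \<noteq> {}" by blast
  next
    fix t assume "t \<in> \<Delta>"
    then obtain e w where t: "t = tup e w" "e \<in> {1, -1}" "[(\<Sum>i<5. w (Suc i)) = D e] (mod 6)"
      by (auto simp: \<Delta>_def)
    let ?s = "tup e (\<lambda>i. - e * w i)"
    have "?s \<otimes>\<^bsub>P\<^esub> t = \<one>\<^bsub>P\<^esub>" unfolding t(1) tup_mult tup_one [symmetric] using t(2) by auto
    then have "inv\<^bsub>P\<^esub> t = ?s" using t tup_carrier by (intro P.inv_equality) auto
    moreover have "[(\<Sum>i<5. - e * w (Suc i)) = D e] (mod 6)"
    proof -
      have "[- e * (\<Sum>i<5. w (Suc i)) = - e * D e] (mod 6)" using t(3) by (rule cong_scalar_left)
      moreover have "- e * D e = D e" using t(2) by (auto simp: D_def)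
      ultimately show ?thesis by (simp only: sum_distrib_left)
    qed
    ultimately show "inv\<^bsub>P\<^esub> t \<in> \<Delta>" unfolding \<Delta>_def using t(2) by blast
    fix t' assume "t' \<in> \<Delta>"
    then obtain e' w' where t': "t' = tup e' w'" "e' \<in> {1, -1}" "[(\<Sum>i<5. w' (Suc i)) = D e'] (mod 6)"
      by (auto simp: \<Delta>_def)
    have "[(\<Sum>i<5. w (Suc i)) + e * (\<Sum>i<5. w' (Suc i)) = D e + e * D e'] (mod 6)"
      using t(3) t'(3) by (intro cong_add cong_scalar_left)
    moreover have "D e + e * D e' = D (e * e')" using t(2) t'(2) by (auto simp: D_def)
    ultimately have "[(\<Sum>i<5. w (Suc i) + e * w' (Suc i)) = D (e * e')] (mod 6)"
      by (simp only: sum_distrib_left sum.distrib)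
    moreover have "e * e' \<in> {1, -1}" using t(2) t'(2) by auto
    ultimately show "t \<otimes>\<^bsub>P\<^esub> t' \<in> \<Delta>" unfolding t(1) t'(1) tup_mult \<Delta>_def by blast
  qed
  moreover have "tup 1 w0 \<in> carrier P" by (rule tup_carrier) simp
  moreover have "dih_rel m = (\<lambda>t. map t [0..<6]) ` (\<Delta> #>\<^bsub>P\<^esub> tup 1 w0)"
  proof -
    have sum: "(\<Sum>i<5. w (Suc i) + e * w0 (Suc i)) = (\<Sum>i<5. w (Suc i)) + e * (3 * m)" for w e
      by (simp only: sum.distrib sum_distrib_left [symmetric] w0)
    have rhs: "dih_rhs e m = D e + e * (3 * m)" if "e \<in> {1, -1}" for e using that by (auto simp: dih_rhs_def D_def)
    have tm: "map (tup e w) [0..<6] = map (\<lambda>i. dih e (w i)) [0..<6]" for e w by (simp add: tup_def)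
    have cos: "\<Delta> #>\<^bsub>P\<^esub> tup 1 w0 = {tup e (\<lambda>i. w i + e * w0 i) | e w. e \<in> {1, -1} \<and> [(\<Sum>i<5. w (Suc i)) = D e] (mod 6)}"
    proof -
      have "\<Delta> #>\<^bsub>P\<^esub> tup 1 w0 = {t \<otimes>\<^bsub>P\<^esub> tup 1 w0 | t. t \<in> \<Delta>}" unfolding r_coset_def by blast
      also have "\<dots> = {tup e w \<otimes>\<^bsub>P\<^esub> tup 1 w0 | e w. e \<in> {1, -1} \<and> [(\<Sum>i<5. w (Suc i)) = D e] (mod 6)}"
        unfolding \<Delta>_def by blast
      finally show ?thesis unfolding tup_mult by simp
    qed
    show ?thesis
    proof (intro equalityI subsetI)
      fix a assume "a \<in> dih_rel m"
      then obtain e w where a: "a = map (\<lambda>i. dih e (w i)) [0..<6]" "e \<in> {1, -1}" "[(\<Sum>i<5. w (Suc i)) = dih_rhs e m] (mod 6)"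
        by (auto simp: dih_rel_def)
      let ?w = "\<lambda>i. w i - e * w0 i"
      have "(\<Sum>i<5. ?w (Suc i)) = (\<Sum>i<5. w (Suc i)) - e * (3 * m)"
        by (simp only: sum_subtractf sum_distrib_left [symmetric] w0)
      moreover have "[(\<Sum>i<5. w (Suc i)) - e * (3 * m) = dih_rhs e m - e * (3 * m)] (mod 6)"
        using a(3) by (intro cong_diff) auto
      ultimately have "[(\<Sum>i<5. ?w (Suc i)) = D e] (mod 6)" using rhs [OF a(2)] by simp
      then have "tup e (\<lambda>i. ?w i + e * w0 i) \<in> \<Delta> #>\<^bsub>P\<^esub> tup 1 w0" 
        unfolding cos using a(2) by (intro CollectI exI [of _ e] exI [of _ ?w] conjI refl)
      then have "map (tup e w) [0..<6] \<in> (\<lambda>t. map t [0..<6]) ` (\<Delta> #>\<^bsub>P\<^esub> tup 1 w0)"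
        by (intro imageI) simp
      then show "a \<in> (\<lambda>t. map t [0..<6]) ` (\<Delta> #>\<^bsub>P\<^esub> tup 1 w0)" unfolding tm a(1) .
    next
      fix a assume "a \<in> (\<lambda>t. map t [0..<6]) ` (\<Delta> #>\<^bsub>P\<^esub> tup 1 w0)"
      then obtain e w where a: "a = map (tup e (\<lambda>i. w i + e * w0 i)) [0..<6]" "e \<in> {1, -1}"
        "[(\<Sum>i<5. w (Suc i)) = D e] (mod 6)"
        unfolding cos by blast
      have "[(\<Sum>i<5. w (Suc i) + e * w0 (Suc i)) = dih_rhs e m] (mod 6)"
        unfolding sum rhs [OF a(2)] using a(3) by (intro cong_add) auto
      then show "a \<in> dih_rel m"
        unfolding a(1) tm dih_rel_def using a(2)
        by (intro CollectI exI [of _ e] exI [of _ "\<lambda>i. w i + e * w0 i"] conjI refl)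
    qed
  qed
  ultimately show ?thesis by blast
qed

lemma finite_sym_group: "finite (carrier (sym_group n))"
  by (simp add: sym_group_def finite_permutations)

lemma dih_coset_template: "coset_template (sym_group 18) dih_vocab dih_template"
  unfolding coset_template_def Let_def
  using dih_rel_coset by (simp add: sym_group_is_group finite_sym_group dih_vocab_def dih_template_def)

lemma dih_rel_subset: "dih_rel m \<subseteq> {a. set a \<subseteq> carrier (sym_group 18) \<and> length a = 6}"
  using dih_carrier by (auto simp: dih_rel_def)

lemma finite_dih_rel: "finite (dih_rel m)"
  by (rule finite_subset [OF dih_rel_subset finite_lists_length_eq [OF finite_sym_group]])

lemma sym_group_not_comm: "\<not> comm_group (sym_group 18)"
proof
  assume "comm_group (sym_group 18)"
  then interpret comm_group "sym_group 18" .
  have "dih 1 1 \<circ> dih (- 1) 0 = dih (- 1) 0 \<circ> dih 1 1"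
    using m_comm [OF dih_carrier dih_carrier, of 1 "- 1" 1 0] by (simp add: sym_group_mult)
  then have "[1 = - 1] (mod (6::int))"
    unfolding dih_comp by (intro dih_eqD(2) [of "- 1" "- 1"]) auto
  then show False by (simp add: cong_def)
qed

text \<open>The variables of the linear system are \<open>0, \<dots>, n - 1\<close>; the element \<open>n\<close> occurs in all equations and
  synchronizes their signs. The isolated constraint on \<open>n + 1\<close> serves CLAP: fixing its tuple does not
  fix the sign of the others.\<close>

definition dih_instance :: "nat \<Rightarrow> (nat \<Rightarrow> nat \<Rightarrow> nat) \<Rightarrow> (nat \<Rightarrow> nat) \<Rightarrow> (nat, nat) rel_struct" where
  "dih_instance n T c = \<lparr>univ = {..<n + 2},
     rel = (\<lambda>m. {n # map (T j) [0..<5] | j. j < n + 1 \<and> c j = m} \<union> (if m = 0 then {replicate 6 (n + 1)} else {}))\<rparr>"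

lemma fin_struct_dih_instance:
  assumes "\<And>j i. j < n + 1 \<Longrightarrow> i < 5 \<Longrightarrow> T j i < n"
  shows "fin_struct dih_vocab (dih_instance n T c)"
proof -
  have "rel (dih_instance n T c) R \<subseteq> {b. length b = 6 \<and> set b \<subseteq> {..<n + 2}}" for R
    using assms by (fastforce simp: dih_instance_def split: if_splits)
  then show ?thesis by (simp add: fin_struct_def dih_vocab_def) (simp add: dih_instance_def)
qed

text \<open>All equations share the element \<open>n\<close>, whose image determines the sign, so
  one sign holds throughout. As 3 is 1 modulo 2 and 4 is 1 modulo 3, the translations then solve one
  of the two systems.\<close>

lemma homs_dih_instance:
  assumes c: "\<And>j. j < n + 1 \<Longrightarrow> c j < 6"
    and c2: "\<forall>x. \<exists>j<n + 1. \<not> [(\<Sum>i<5. x (T j i)) = int (c j)] (mod 2)"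
    and c3: "\<forall>x. \<exists>j<n + 1. \<not> [(\<Sum>i<5. x (T j i)) = int (c j)] (mod 3)"
  shows "homs dih_vocab (dih_instance n T c) dih_template = {}"
proof (rule ccontr)
  assume "\<not> ?thesis"
  then obtain h where h: "h \<in> homs dih_vocab (dih_instance n T c) dih_template" by blast
  have "\<exists>e w. h n = dih e (w 0) \<and> (\<forall>i<5. h (T j i) = dih e (w (Suc i))) \<and> e \<in> {1, -1}
      \<and> [(\<Sum>i<5. w (Suc i)) = dih_rhs e (int (c j))] (mod 6)" if j: "j < n + 1" for j
  proof -
    have "map h (n # map (T j) [0..<5]) \<in> dih_rel (int (c j))"
    proof -
      have "n # map (T j) [0..<5] \<in> rel (dih_instance n T c) (c j)" using j by (auto simp: dih_instance_def)
      moreover have "c j \<in> symbols dih_vocab" using c [OF j] by (simp add: dih_vocab_def)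
      ultimately have "map h (n # map (T j) [0..<5]) \<in> rel dih_template (c j)"
        using h unfolding homs_def by blast
      then show ?thesis by (simp add: dih_template_def)
    qed
    then obtain e w where ew: "map h (n # map (T j) [0..<5]) = map (\<lambda>i. dih e (w i)) [0..<6]"
        "e \<in> {1, -1}" "[(\<Sum>i<5. w (Suc i)) = dih_rhs e (int (c j))] (mod 6)"
      unfolding dih_rel_def by blast
    have nth: "map h (n # map (T j) [0..<5]) ! i = dih e (w i)" if "i < 6" for i
      unfolding ew(1) using that by simp
    have "h n = dih e (w 0)" using nth [of 0] by simp
    moreover have "h (T j i) = dih e (w (Suc i))" if "i < 5" for i using nth [of "Suc i"] that by simp
    ultimately show ?thesis using ew by blast
  qed
  then obtain e w where ew: "\<And>j. j < n + 1 \<Longrightarrow> h n = dih (e j) (w j 0)"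
      "\<And>j i. j < n + 1 \<Longrightarrow> i < 5 \<Longrightarrow> h (T j i) = dih (e j) (w j (Suc i))"
      "\<And>j. j < n + 1 \<Longrightarrow> e j \<in> {1, -1}"
      "\<And>j. j < n + 1 \<Longrightarrow> [(\<Sum>i<5. w j (Suc i)) = dih_rhs (e j) (int (c j))] (mod 6)"
    by metis
  let ?e = "e 0"
  have e: "e j = ?e" if "j < n + 1" for j
    using ew(1) [OF that] ew(1) [of 0] ew(3) [OF that] ew(3) [of 0] by (intro dih_eqD(1) [of _ _ "w j 0" "w 0 0"]) auto
  \<comment> \<open>An element determines its translation only modulo 6, so a representative is
    chosen.\<close>
  define x where "x u = (SOME v. h u = dih ?e v)" for u
  have sum: "[(\<Sum>i<5. x (T j i)) = dih_rhs ?e (int (c j))] (mod 6)" if j: "j < n + 1" for j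
  proof -
    have "[x (T j i) = w j (Suc i)] (mod 6)" if i: "i < 5" for i
    proof -
      have 1: "h (T j i) = dih ?e (w j (Suc i))" using ew(2) [OF j i] e [OF j] by simp
      then have "h (T j i) = dih ?e (x (T j i))" unfolding x_def by (rule someI)
      with 1 show ?thesis using ew(3) [of 0] by (intro dih_eqD(2)) auto
    qed
    then have "[(\<Sum>i<5. x (T j i)) = (\<Sum>i<5. w j (Suc i))] (mod 6)" by (intro cong_sum) auto
    then show ?thesis using cong_trans ew(4) [OF j] e [OF j] by fastforce
  qed
  show False
  proof (cases "?e = 1")
    case True
    obtain j where j: "j < n + 1" "\<not> [(\<Sum>i<5. x (T j i)) = int (c j)] (mod 2)" using c2 by blast
    have "[(\<Sum>i<5. x (T j i)) = 3 * int (c j)] (mod 2)"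
      by (rule cong_dvd_modulus [of _ _ 6]) (use sum [OF j(1)] True in \<open>simp_all add: dih_rhs_def\<close>)
    moreover have "[3 * int (c j) = int (c j)] (mod 2)" by (simp add: cong_iff_dvd_diff)
    ultimately show False using j cong_trans by blast
  next
    case False
    obtain j where j: "j < n + 1" "\<not> [(\<Sum>i<5. x (T j i)) = int (c j)] (mod 3)" using c3 by blast
    have "[(\<Sum>i<5. x (T j i)) = 4 * int (c j)] (mod 3)"
      by (rule cong_dvd_modulus [of _ _ 6]) (use sum [OF j(1)] False in \<open>simp_all add: dih_rhs_def\<close>)
    moreover have "[4 * int (c j) = int (c j)] (mod 3)" by (simp add: cong_iff_dvd_diff)
    ultimately show False using j cong_trans by blast
  qed
qed

text \<open>Multiplication by \<open>s\<close> lifts residues modulo \<open>p\<close> to residues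
  modulo 6: as 6 divides \<open>s * p\<close>, equations modulo \<open>p\<close> become equations
  modulo 6. The two uses are \<open>p = 2\<close>, \<open>s = 3\<close>, \<open>e = 1\<close> and
  \<open>p = 3\<close>, \<open>s = 4\<close>, \<open>e = -1\<close>.\<close>

lemma dih_instance_weights:
  assumes T: "expanding (n + 1) n r T" and r: "1 \<le> r" and p: "prime p"
    and e: "e \<in> {1, -1}" and s: "6 dvd s * int p" "\<And>m. dih_rhs e m = s * m"
  obtains w where "weights (r div 2) {..<n + 2} (carrier (sym_group 18)) (int p ^ (r div 2)) w"
    and "\<And>X f. 0 \<le> w X f" and "supported dih_vocab dih_template (dih_instance n T c) w"
    and "1 \<le> r div 2 \<Longrightarrow> lsys_point dih_template w (Mu 0 (replicate 6 (n + 1)) (replicate 6 id)) = int p ^ (r div 2)"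
proof -
  let ?K = "r div 2" and ?A = "carrier (sym_group 18)"
  interpret solution_family p "{..<n + 2}" ?K "lin_eqs (n + 1) r (int p) T (\<lambda>j. int (c j))"
    by (rule solution_family_lin_eqs [OF T p]) simp
  \<comment> \<open>The element \<open>n\<close> shows only the sign, and \<open>n + 1\<close>
    receives the identity for either sign, so its constraint has one tuple of full weight.\<close>
  define \<phi> where "\<phi> u y = (if u < n then dih e (s * y) else if u = n then dih e 0 else id)" for u and y :: int
  define w where "w X f = (\<Sum>y\<in>{y \<in> X \<rightarrow>\<^sub>E {0..<int p}. (\<lambda>u\<in>X. \<phi> u (y u)) = f}. solution_weight X y)" for X f
  have \<phi>A: "\<phi> u y \<in> ?A" for u y
    using dih_carrier [OF e] dih_carrier [of 1 0] by (simp add: \<phi>_def dih_id)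
  have ww: "weights ?K {..<n + 2} ?A (int p ^ ?K) w"
    unfolding w_def by (rule weights_push [OF _ _ finite_sym_group weights_solution_weight]) (use \<phi>A in auto)
  have nn: "0 \<le> w X f" for X f unfolding w_def by (intro sum_nonneg solution_weight_nonneg)
  have Tn: "T j i < n" if "j < n + 1" "i < 5" for j i using T that by (simp add: expanding_def)
  have "supported dih_vocab dih_template (dih_instance n T c) w"
    unfolding supported_def
  proof (intro ballI impI)
    fix R b f
    assume R: "R \<in> symbols dih_vocab" and b: "b \<in> rel (dih_instance n T c) R" and nz: "w (set b) f \<noteq> 0"
    from nz [unfolded w_def] obtain y where
      "y \<in> {y \<in> set b \<rightarrow>\<^sub>E {0..<int p}. (\<lambda>u\<in>set b. \<phi> u (y u)) = f}" and wy: "solution_weight (set b) y \<noteq> 0"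
      by (rule sum.not_neutral_contains_not_neutral)
    then have y: "(\<lambda>u\<in>set b. \<phi> u (y u)) = f" "solution_weight (set b) y \<noteq> 0" by simp_all
    have ysol: "y \<in> solutions (set b)"
    proof (rule ccontr)
      assume "y \<notin> solutions (set b)"
      then have "solution_weight (set b) y = 0" by (simp only: solution_weight_def if_False)
      with y(2) show False by contradiction
    qed
    have mapf: "map f b = map (\<lambda>u. \<phi> u (y u)) b" unfolding y(1) [symmetric] by (rule map_cong) auto
    consider j where "b = n # map (T j) [0..<5]" "j < n + 1" "c j = R" | "b = replicate 6 (n + 1)" "R = 0"
      using b by (auto simp: dih_instance_def split: if_splits)
    then have "map f b \<in> dih_rel (int R)"
    proof cases
      case 1
      let ?y = "\<lambda>j'. if j' = j then 1 else (0::int)"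
      have coef: "lin_coef (n + 1) T ?y u = (\<Sum>i<5. if T j i = u then 1 else 0)" for u
      proof -
        have "lin_coef (n + 1) T ?y u = (\<Sum>j'<n + 1. if j' = j then (\<Sum>i<5. if T j i = u then 1 else 0) else 0)"
          unfolding lin_coef_def by (rule sum.cong) simp_all
        then show ?thesis using 1(2) by simp
      qed
      have setb: "set b = insert n (T j ` {..<5})" unfolding 1 by auto
      have zero: "lin_coef (n + 1) T ?y u = 0" if "u \<notin> set b" for u
        unfolding coef using that setb by (intro sum.neutral) auto
      \<comment> \<open>A single row is derivable, so local solutions on its scope satisfy
        it.\<close>
      have "(lin_coef (n + 1) T ?y, int (c j)) \<in> eqs (set b)"
        unfolding eqs_def using lin_eqs_row [OF 1(2) r, of T "\<lambda>j. int (c j)" "int p"] zero by auto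
      from solutions_cong [OF ysol this] have "[(\<Sum>u\<in>set b. lin_coef (n + 1) T ?y u * y u) = int (c j)] (mod int p)" .
      also have "(\<Sum>u\<in>set b. lin_coef (n + 1) T ?y u * y u) = (\<Sum>i<5. \<Sum>u\<in>set b. if T j i = u then y u else 0)"
        unfolding coef sum_distrib_right by (subst sum.swap) (intro sum.cong, auto)
      also have "\<dots> = (\<Sum>i<5. y (T j i))" using setb by (intro sum.cong) (auto simp: sum.delta)
      finally have "int p dvd (\<Sum>i<5. y (T j i)) - int (c j)" by (simp add: cong_iff_dvd_diff)
      then have "s * int p dvd s * ((\<Sum>i<5. y (T j i)) - int (c j))" by (rule mult_dvd_mono [OF dvd_refl])
      then have "6 dvd (\<Sum>i<5. s * y (T j i)) - dih_rhs e (int (c j))"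
        using s(1) dvd_trans by (auto simp: s(2) sum_distrib_left [symmetric] right_diff_distrib)
      moreover define v where "v i = (case i of 0 \<Rightarrow> 0 | Suc i' \<Rightarrow> s * y (T j i'))" for i
      ultimately have "[(\<Sum>i<5. v (Suc i)) = dih_rhs e (int R)] (mod 6)" using 1(3) by (simp add: cong_iff_dvd_diff)
      moreover have "map f b = map (\<lambda>i. dih e (v i)) [0..<6]"
      proof (rule nth_equalityI)
        fix i assume "i < length (map f b)"
        then have i: "i < 6" using 1 by simp
        show "map f b ! i = map (\<lambda>i. dih e (v i)) [0..<6] ! i"
          unfolding mapf using i Tn [OF 1(2)] unfolding 1(1) by (cases i) (auto simp: \<phi>_def v_def)
      qed (simp add: 1)
      ultimately show ?thesis unfolding dih_rel_def using e by blast
    next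
      case 2
      have "map f b = map (\<lambda>i. dih 1 ((\<lambda>_. 0) i)) [0..<6]"
        unfolding mapf unfolding 2(1) by (simp add: \<phi>_def dih_id map_replicate_const)
      then show ?thesis unfolding dih_rel_def 2(2) by (intro CollectI exI conjI) (auto simp: dih_rhs_def)
    qed
    then show "map f b \<in> rel dih_template R" by (simp add: dih_template_def)
  qed
  moreover have "lsys_point dih_template w (Mu 0 (replicate 6 (n + 1)) (replicate 6 id)) = int p ^ ?K" if K: "1 \<le> ?K"
  proof -
    let ?v = "n + 1" and ?f = "\<lambda>_\<in>{n + 1}. id :: nat \<Rightarrow> nat"
    have id: "id \<in> ?A" using dih_carrier [of 1 0] by (simp add: dih_id)
    have E: "{f \<in> set (replicate 6 ?v) \<rightarrow>\<^sub>E univ dih_template. map f (replicate 6 ?v) = replicate 6 id} = {?f}"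
    proof (intro equalityI subsetI)
      fix f assume "f \<in> {f \<in> set (replicate 6 ?v) \<rightarrow>\<^sub>E univ dih_template. map f (replicate 6 ?v) = replicate 6 id}"
      then have eq: "map f (replicate 6 ?v) = replicate 6 id" and f: "f \<in> set (replicate 6 ?v) \<rightarrow>\<^sub>E univ dih_template"
        by blast+
      have "map f (replicate 6 ?v) ! 0 = replicate 6 id ! 0" by (simp only: eq)
      then have "f ?v = id" by simp
      moreover have "f \<in> {?v} \<rightarrow>\<^sub>E univ dih_template" using f by simp
      ultimately have "f = ?f" by (intro ext) (auto simp: PiE_def extensional_def)
      then show "f \<in> {?f}" by simp
    qed (use id in \<open>simp add: dih_template_def map_replicate\<close>)
    have "lsys_point dih_template w (Mu 0 (replicate 6 ?v) (replicate 6 id)) = (\<Sum>f\<in>{?f}. w (set (replicate 6 ?v)) f)"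
      by (simp only: lsys_point_simps E)
    also have "\<dots> = w {?v} ?f" by simp
    also have "\<dots> = (\<Sum>y\<in>{?v} \<rightarrow>\<^sub>E {0..<int p}. solution_weight {?v} y)"
    proof -
      have "(\<lambda>u\<in>{?v}. \<phi> u (y u)) = ?f" for y by (rule restrict_ext) (simp add: \<phi>_def)
      then show ?thesis unfolding w_def by (simp only: simp_thms Collect_mem_eq)
    qed
    also have "\<dots> = int p ^ ?K"
      by (rule weightsD(1) [OF weights_solution_weight]) (use K in auto)
    finally show ?thesis .
  qed
  ultimately show thesis by (rule that [OF ww nn])
qed

lemma dih_template_not_solved:
  assumes k: "(\<lambda>n. real (k n)) \<in> o(\<lambda>n. real n)"
  shows "\<not> solves TYPE(nat) alg k dih_vocab dih_template"
proof -
  \<comment> \<open>\<open>K\<close> is about \<open>n / 5832\<close>, with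
    \<open>5832 = 2 * 2916\<close>; the smaller factor \<open>1 / 20000\<close> absorbs the
    roundings.\<close>
  have "eventually (\<lambda>n. real (k n) \<le> 1 / 20000 * real n) at_top"
    using landau_o.smallD [OF k, of "1 / 20000"] by simp
  then obtain N0 where N0: "\<And>n. N0 \<le> n \<Longrightarrow> real (k n) \<le> 1 / 20000 * real n"
    by (auto simp: eventually_at_top_linorder)
  \<comment> \<open>The offset ensures \<open>12 \<le> K\<close>, twice the arity 6, as needed for
    CLAP.\<close>
  define n where "n = N0 + 100000"
  define r where "r = n div 2916"
  define K where "K = r div 2"
  have K: "12 \<le> K" "1 \<le> r" unfolding K_def r_def n_def by auto
  have kK: "k (n + 2) \<le> K"
  proof -
    have "20000 * k (n + 2) \<le> n + 2" using N0 [of "n + 2"] by (simp add: n_def)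
    then show ?thesis unfolding K_def r_def n_def by linarith
  qed
  obtain T where T: "expanding (n + 1) n r T"
    using expanding_exists [of n "n + 1" r] by (auto simp: n_def r_def)
  have Tn: "T j i < n" if "j < n + 1" "i < 5" for j i using T that by (simp add: expanding_def)
  obtain c2 :: "nat \<Rightarrow> int" where c2: "\<forall>x. \<exists>j<n + 1. \<not> [(\<Sum>i<5. x (T j i)) = c2 j] (mod 2)"
    using overdetermined_unsolvable [of n "n + 1" 2 5 T] Tn by auto
  obtain c3 :: "nat \<Rightarrow> int" where c3: "\<forall>x. \<exists>j<n + 1. \<not> [(\<Sum>i<5. x (T j i)) = c3 j] (mod 3)"
    using overdetermined_unsolvable [of n "n + 1" 3 5 T] Tn by auto
  \<comment> \<open>Chinese remainders: 3 is 1 modulo 2 and 0 modulo 3, while 4 is 0 modulo 2 and 1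
    modulo 3.\<close>
  define c where "c j = nat ((3 * c2 j + 4 * c3 j) mod 6)" for j
  have c6: "c j < 6" for j by (simp add: c_def nat_less_iff)
  have ic: "[int (c j) = 3 * c2 j + 4 * c3 j] (mod 6)" for j by (simp add: c_def cong_def)
  have "[int (c j) = c2 j] (mod 2)" for j
  proof -
    have "[int (c j) = 3 * c2 j + 4 * c3 j] (mod 2)" by (rule cong_dvd_modulus [OF ic]) simp
    moreover have "[3 * c2 j + 4 * c3 j = c2 j] (mod 2)" by (simp add: cong_iff_dvd_diff)
    ultimately show ?thesis by (rule cong_trans)
  qed
  then have u2: "\<forall>x. \<exists>j<n + 1. \<not> [(\<Sum>i<5. x (T j i)) = int (c j)] (mod 2)"
    using c2 cong_trans by blast
  have "[int (c j) = c3 j] (mod 3)" for j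
  proof -
    have "[int (c j) = 3 * c2 j + 4 * c3 j] (mod 3)" by (rule cong_dvd_modulus [OF ic]) simp
    moreover have "[3 * c2 j + 4 * c3 j = c3 j] (mod 3)"
    proof -
      have "3 * c2 j + 4 * c3 j - c3 j = 3 * (c2 j + c3 j)" by simp
      then show ?thesis by (simp add: cong_iff_dvd_diff)
    qed
    ultimately show ?thesis by (rule cong_trans)
  qed
  then have u3: "\<forall>x. \<exists>j<n + 1. \<not> [(\<Sum>i<5. x (T j i)) = int (c j)] (mod 3)"
    using c3 cong_trans by blast
  let ?B = "dih_instance n T c"
  have B: "fin_struct dih_vocab ?B" using Tn by (rule fin_struct_dih_instance)
  have univ: "univ ?B = {..<n + 2}" "univ dih_template = carrier (sym_group 18)"
    by (simp_all add: dih_instance_def dih_template_def)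
  have card: "card (univ ?B) = n + 2" by (simp add: univ)
  have fin: "finite (univ dih_template)" "finite (symbols dih_vocab)" "\<And>R. R \<in> symbols dih_vocab \<Longrightarrow> finite (rel dih_template R)"
    using finite_sym_group finite_dih_rel by (simp_all add: univ dih_vocab_def) (simp add: dih_template_def finite_dih_rel)
  have K1: "1 \<le> r div 2" using K by (simp add: K_def)
  obtain w where w: "weights (r div 2) {..<n + 2} (carrier (sym_group 18)) (int 2 ^ (r div 2)) w"
    "\<And>X f. 0 \<le> w X f" "supported dih_vocab dih_template ?B w"
    and w0: "lsys_point dih_template w (Mu 0 (replicate 6 (n + 1)) (replicate 6 id)) = int 2 ^ (r div 2)"
    by (rule dih_instance_weights [OF T K(2) two_is_prime_nat, of 1 3 c]) (use K1 in \<open>auto simp: dih_rhs_def\<close>)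
  obtain v where v: "weights (r div 2) {..<n + 2} (carrier (sym_group 18)) (int 3 ^ (r div 2)) v"
    "\<And>X f. 0 \<le> v X f" "supported dih_vocab dih_template ?B v"
    and v0: "lsys_point dih_template v (Mu 0 (replicate 6 (n + 1)) (replicate 6 id)) = int 3 ^ (r div 2)"
  proof (rule dih_instance_weights [OF T K(2), of 3 "- 1" 4 c])
    show "prime (3::nat)" by (simp add: prime_nat_numeral_eq)
  qed (use K1 in \<open>auto simp: dih_rhs_def\<close>)
  note w' = w(1) [folded univ K_def] and v' = v(1) [folded univ K_def]
  have cop: "coprime (int 2 ^ K) (int 3 ^ K)" by simp
  have pos: "0 < int 2 ^ K" "0 < int 3 ^ K" by simp_all
  have ar: "ar dih_vocab R \<le> K" for R using K by (simp add: dih_vocab_def)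
  have ba: "ba_accepts k' dih_vocab dih_template ?B" if "k' \<le> K" for k'
    unfolding ba_accepts_def
    by (rule ba_accepts_weights [OF B fin w' pos(1) w(2,3) v' pos(2) v(2,3) cop that ar]) auto
  have "accepts alg (k (n + 2)) dih_vocab dih_template ?B"
  proof (cases alg)
    case Z_Affine_Consistency
    then show ?thesis
      using z_affine_accepts_weights [OF B fin(1) w' w(2,3) v' v(2,3) cop kK] by simp
  next
    case BLP_AIP
    then show ?thesis using ba [of 1] K by simp
  next
    case BA
    then show ?thesis using ba [OF kK] by simp
  next
    case CLAP
    have "clap_accepts dih_vocab dih_template ?B"
    proof (rule clap_accepts_weights [OF B fin w' pos(1) w(2,3) v' pos(2) v(2,3) cop, where M = 6])
      have "replicate 6 id \<in> dih_rel 0"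
      proof -
        have "replicate 6 id = map (\<lambda>i. dih 1 ((\<lambda>_. 0) i)) [0..<6]"
          by (simp add: dih_id map_replicate_const)
        then show ?thesis unfolding dih_rel_def by (intro CollectI exI conjI) (auto simp: dih_rhs_def)
      qed
      then show "(0, replicate 6 (n + 1), replicate 6 id) \<in> clap_init dih_vocab dih_template ?B \<and>
          lsys_point dih_template w (Mu 0 (replicate 6 (n + 1)) (replicate 6 id)) = int 2 ^ K \<and>
          lsys_point dih_template v (Mu 0 (replicate 6 (n + 1)) (replicate 6 id)) = int 3 ^ K"
        using w0 v0 unfolding K_def
        by (simp add: clap_init_def del: lsys_point_simps) (simp add: dih_vocab_def dih_template_def dih_instance_def)
    qed (use K in \<open>auto simp: dih_vocab_def\<close>)
    then show ?thesis using CLAP by simp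
  qed
  moreover have "?B \<notin> CSP dih_vocab dih_template"
    using homs_dih_instance [OF c6 u2 u3] by (simp add: CSP_def)
  ultimately show ?thesis unfolding solves_def using B card by metis
qed

theorem theorem1p2:
  shows
    "(\<forall>(alg :: algorithm) (G :: ('g, 'm) monoid_scheme) (\<tau> :: 'r vocab) A (k :: nat).
        comm_group G \<and> coset_template G \<tau> A \<and>
        1 \<le> k \<and> (alg = Z_Affine_Consistency \<longrightarrow> arity \<tau> \<le> k) \<longrightarrow>
        solves TYPE('b) alg (\<lambda>_. k) \<tau> A)
   \<and> (\<not> comm_group (sym_group 18) \<and>
      (\<forall>alg :: algorithm. \<exists>(\<tau> :: nat vocab) A. coset_template (sym_group 18) \<tau> A \<and>
        (\<forall>k :: nat \<Rightarrow> nat. (\<forall>n. 1 \<le> k n) \<and> (\<lambda>n. real (k n)) \<in> o(\<lambda>n. real n) \<longrightarrow>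
          \<not> solves TYPE(nat) alg k \<tau> A)))
   \<and> (\<forall>(alg :: algorithm) (G :: ('g, 'm) monoid_scheme) (\<tau> :: 'r vocab) A (k :: nat).
        two_nilpotent G \<and> odd (order G) \<and> coset_template G \<tau> A \<and>
        1 \<le> k \<and> (alg = Z_Affine_Consistency \<longrightarrow> arity \<tau> \<le> k) \<longrightarrow>
        solves TYPE('b) alg (\<lambda>_. k) \<tau> A)
   \<and> (\<forall>p :: nat. prime p \<and> odd p \<longrightarrow>
        (\<exists>\<theta> \<in> hom (integer_mod_group p) (AutoGroup (integer_mod_group (p\<^sup>2))).
          let G = semidirect_product (integer_mod_group (p\<^sup>2)) (integer_mod_group p) \<theta> in
          group G \<and> order G = p ^ 3 \<and> \<not> comm_group G \<and> two_nilpotent G \<and>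
          (\<forall>(alg :: algorithm) (\<tau> :: 'r vocab) A (k :: nat).
             coset_template G \<tau> A \<and>
             1 \<le> k \<and> (alg = Z_Affine_Consistency \<longrightarrow> arity \<tau> \<le> k) \<longrightarrow>
             solves TYPE('b) alg (\<lambda>_. k) \<tau> A)))"
proof (intro conjI allI impI)
  show "solves TYPE('b) alg (\<lambda>_. k) \<tau> A"
    if "comm_group G \<and> coset_template G \<tau> A \<and> 1 \<le> k \<and> (alg = Z_Affine_Consistency \<longrightarrow> arity \<tau> \<le> k)"
    for alg and G :: "('g, 'm) monoid_scheme" and \<tau> :: "'r vocab" and A k
    using that by (intro solves_abelian) auto
  show "\<not> comm_group (sym_group 18)" by (rule sym_group_not_comm)
  show "\<exists>(\<tau> :: nat vocab) A. coset_template (sym_group 18) \<tau> A \<and>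
      (\<forall>k :: nat \<Rightarrow> nat. (\<forall>n. 1 \<le> k n) \<and> (\<lambda>n. real (k n)) \<in> o(\<lambda>n. real n) \<longrightarrow> \<not> solves TYPE(nat) alg k \<tau> A)"
    for alg
    using dih_coset_template dih_template_not_solved by blast
  show "solves TYPE('b) alg (\<lambda>_. k) \<tau> A"
    if "two_nilpotent G \<and> odd (order G) \<and> coset_template G \<tau> A \<and> 1 \<le> k \<and>
      (alg = Z_Affine_Consistency \<longrightarrow> arity \<tau> \<le> k)"
    for alg and G :: "('g, 'm) monoid_scheme" and \<tau> :: "'r vocab" and A k
    using that by (intro solves_two_nilpotent_odd) auto
  fix p :: nat assume "prime p \<and> odd p"
  then have p: "2 \<le> p" "odd p" by (auto dest: prime_ge_2_nat)
  have ord: "odd (order (p3_group p))" using p by (simp add: p3_group_order)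
  show "\<exists>\<theta> \<in> hom (integer_mod_group p) (AutoGroup (integer_mod_group (p\<^sup>2))).
      let G = semidirect_product (integer_mod_group (p\<^sup>2)) (integer_mod_group p) \<theta> in
      group G \<and> order G = p ^ 3 \<and> \<not> comm_group G \<and> two_nilpotent G \<and>
      (\<forall>(alg :: algorithm) (\<tau> :: 'r vocab) A (k :: nat).
         coset_template G \<tau> A \<and> 1 \<le> k \<and> (alg = Z_Affine_Consistency \<longrightarrow> arity \<tau> \<le> k) \<longrightarrow>
         solves TYPE('b) alg (\<lambda>_. k) \<tau> A)"
    unfolding Let_def
  proof (intro bexI [OF _ p_action_hom] conjI allI impI, unfold p3_group_def [OF p(1), symmetric])
    show "solves TYPE('b) alg (\<lambda>_. k) \<tau> A"
      if "coset_template (p3_group p) \<tau> A \<and> 1 \<le> k \<and> (alg = Z_Affine_Consistency \<longrightarrow> arity \<tau> \<le> k)"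
      for alg and \<tau> :: "'r vocab" and A k
      using that p3_group_two_nilpotent [OF p(1)] ord by (intro solves_two_nilpotent_odd) auto
  qed (use p group_p3_group p3_group_order p3_group_not_comm p3_group_two_nilpotent in auto)
qed

end
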